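(* Let $n$ be an integer. Suppose there exists a diamond-free strongly regular graph $G$ with parameters $\bigl((n^2+3n-2)^2,\; n(n^2+3n-1),\; 2,\; n(n+1)\bigr)$ satisfying the following condition: for every two (distinct) non-adjacent vertices $u$ and $v$ of $G$, there is a vertex that is adjacent neither to $u$, nor to $v$, nor to any common neighbor of $u$ and $v$, and that is different from $u$ and $v$. Then $n\in\{-2,2,3,10\}$.
   Context: All graphs are finite and simple. A strongly regular graph with parameters $(\nu,k,\lambda,\mu)$ is a $k$-regular graph on $\nu$ vertices that is neither complete nor edgeless, in which every two adjacent vertices have exactly $\lambda$ common neighbors and every two distinct non-adjacent vertices have exactly $\mu$ common neighbors. It is assumed throughout that a strongly regular graph and its complement are connected; equivalently, $0<\mu<k<\nu-1$. The diamond is the graph on four vertices with five edges; a graph is diamond-free if it has no induced subgraph isomorphic to the diamond. *)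

theory Defs
  imports "Graph_Theory.Kuratowski" "Graph_Theory.Digraph_Isomorphism"
begin

text \<open>
  Finite simple graphs are represented by the locale \<^locale>\<open>pair_graph\<close>: a finite vertex set together
  with a symmetric irreflexive relation \<^const>\<open>parcs\<close> on it. An undirected edge is the pair of its two
  orientations, so degrees are out-degrees.
\<close>

definition graph_complement :: "'a pair_pre_digraph \<Rightarrow> 'a pair_pre_digraph" where
  "graph_complement G =
    \<lparr> pverts = pverts G,
      parcs = {(u, v). u \<in> pverts G \<and> v \<in> pverts G \<and> u \<noteq> v \<and> (u, v) \<notin> parcs G} \<rparr>"

definition common_neighbors :: "'a pair_pre_digraph \<Rightarrow> 'a \<Rightarrow> 'a \<Rightarrow> 'a set" where
  "common_neighbors G u v = {w \<in> pverts G. (u, w) \<in> parcs G \<and> (v, w) \<in> parcs G}"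

text \<open>
  The parameters are integers, so that polynomial expressions in a possibly negative integer
  can be supplied without truncation. Connectedness is not part of this definition.
\<close>

definition strongly_regular :: "'a pair_pre_digraph \<Rightarrow> int \<Rightarrow> int \<Rightarrow> int \<Rightarrow> int \<Rightarrow> bool" where
  "strongly_regular G \<nu> k l m \<longleftrightarrow>
    pair_graph G \<and>
    int (card (pverts G)) = \<nu> \<and>
    (\<forall>v \<in> pverts G. int (out_degree (with_proj G) v) = k) \<and>
    \<not> complete_digraph (card (pverts G)) (with_proj G) \<and>
    parcs G \<noteq> {} \<and>
    (\<forall>u \<in> pverts G. \<forall>v \<in> pverts G. (u, v) \<in> parcs G \<longrightarrow>
      int (card (common_neighbors G u v)) = l) \<and>
    (\<forall>u \<in> pverts G. \<forall>v \<in> pverts G. u \<noteq> v \<and> (u, v) \<notin> parcs G \<longrightarrow>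
      int (card (common_neighbors G u v)) = m)"

definition diamond :: "nat pair_pre_digraph" where
  "diamond =
    \<lparr> pverts = {0, 1, 2, 3},
      parcs = {(u, v). u \<in> {0, 1, 2, 3} \<and> v \<in> {0, 1, 2, 3} \<and> u \<noteq> v} - {(0, 1), (1, 0)} \<rparr>"

definition diamond_free :: "'a pair_pre_digraph \<Rightarrow> bool" where
  "diamond_free G \<longleftrightarrow>
    \<not> (\<exists>H. induced_subgraph H (with_proj G) \<and> digraph_iso H (with_proj diamond))"

end

theory Submission imports Defs "HOL-Computational_Algebra.Primes"
begin

text \<open>For \<open>n < 3\<close> the parameters alone leave only \<open>n = \<plusminus>2\<close>. Let \<open>n \<ge> 3\<close>. An integer vector supported near two
  non-adjacent vertices that behaves like an eigenvector for \<open>n\<close> on its support is an eigenvector; the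
  resulting counts show that three pairwise non-adjacent vertices without a common neighbour have a unique
  fourth companion, their line. A line and a common neighbour of two of its points generate a
  \<open>4 \<times> 4\<close> grid. The lines through a vertex \<open>v\<close> induce bijections between the cliques at \<open>v\<close> that agree up to
  rotation, so that rotating all cliques and lines at \<open>v\<close> simultaneously is an automorphism of order 3. The
  quotient of two such rotations at adjacent vertices is an involutive automorphism that moves every
  vertex to a neighbour. These involutions commute and join any two adjacent vertices; hence they act
  transitively and the number of vertices is a power of 2.

  This leaves the equation \<open>n\<^sup>2 + 3 n - 2 = 2\<^sup>e\<close>, that is \<open>x\<^sup>2 - 2\<^sup>e\<^sup>+\<^sup>2 = 17\<close> with \<open>x = 2 n + 3\<close>. For even \<open>e\<close> the left-hand
  side factors; for odd \<open>e\<close> the Pell equation \<open>x\<^sup>2 - 2 y\<^sup>2 = 17\<close> has no solution in which \<open>y\<close> is a power of 2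
  divisible by 32.\<close>

text \<open>The model behind every construction is an affine space over the field of order 4.
  Cliques and lines are its affine lines, a rotation at v is multiplication about v by a primitive
  cube root of unity, and two rotations with inverse multipliers compose to a translation, which is
  an involution in characteristic 2. The obstacle is that no symmetry of the graph is given, so
  every incidence of this model has to be forced by counting. The counts come from the fact that on
  vectors of sum 0 the adjacency operator has only the eigenvalues n and -(n^2 + 2 n - 2), applied
  to vectors living on v, its neighbours and one more vertex. The hypothesis on far vertices
  supplies the third point of a line; the fourth is forced because a second-moment identity fails by
  exactly the contribution of one missing vertex. The bound n \<ge> 3 is what allows the division by
  n - 2 in the linear systems of counts.\<close>

locale diamond_free_srg =
  fixes V :: "'a set" and adj :: "'a \<Rightarrow> 'a \<Rightarrow> bool" (infix "\<sim>" 50) and n :: int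
  assumes finite_V: "finite V"
    and n_ge_3: "3 \<le> n"
    and adj_sym: "x \<sim> y \<Longrightarrow> y \<sim> x"
    and adj_irrefl: "\<not> x \<sim> x"
    and adj_V: "x \<sim> y \<Longrightarrow> x \<in> V"
    and card_V: "int (card V) = (n\<^sup>2 + 3 * n - 2)\<^sup>2"
    and degree: "x \<in> V \<Longrightarrow> int (card {y. x \<sim> y}) = n * (n\<^sup>2 + 3 * n - 1)"
    and lambda: "x \<sim> y \<Longrightarrow> card {z. x \<sim> z \<and> y \<sim> z} = 2"
    and mu: "x \<in> V \<Longrightarrow> y \<in> V \<Longrightarrow> x \<noteq> y \<Longrightarrow> \<not> x \<sim> y \<Longrightarrow> int (card {z. x \<sim> z \<and> y \<sim> z}) = n * (n + 1)"
    and no_diamond: "x \<sim> y \<Longrightarrow> x \<sim> z \<Longrightarrow> y \<sim> z \<Longrightarrow> x \<sim> w \<Longrightarrow> y \<sim> w \<Longrightarrow> z \<noteq> w \<Longrightarrow> z \<sim> w"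
    and far_vertex: "x \<in> V \<Longrightarrow> y \<in> V \<Longrightarrow> x \<noteq> y \<Longrightarrow> \<not> x \<sim> y \<Longrightarrow>
      \<exists>w\<in>V. w \<noteq> x \<and> w \<noteq> y \<and> \<not> w \<sim> x \<and> \<not> w \<sim> y \<and> (\<forall>z. x \<sim> z \<and> y \<sim> z \<longrightarrow> \<not> w \<sim> z)"
begin

section \<open>The adjacency operator and its eigenvalues\<close>

definition N :: "'a \<Rightarrow> 'a set" where "N x = {y. x \<sim> y}"

definition nadj :: "'a \<Rightarrow> 'a \<Rightarrow> bool" (infix "\<parallel>" 50)
  where "x \<parallel> y \<longleftrightarrow> x \<in> V \<and> y \<in> V \<and> x \<noteq> y \<and> \<not> x \<sim> y"

definition Ad :: "('a \<Rightarrow> int) \<Rightarrow> 'a \<Rightarrow> int" where "Ad f x = (\<Sum>y\<in>N x. f y)"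

lemma adj_commute: "x \<sim> y \<longleftrightarrow> y \<sim> x"
  using adj_sym by blast

lemma nadj_commute: "x \<parallel> y \<longleftrightarrow> y \<parallel> x"
  using adj_sym by (auto simp: nadj_def)

lemma in_N [simp]: "y \<in> N x \<longleftrightarrow> x \<sim> y"
  by (simp add: N_def)

lemma adj_V2: "x \<sim> y \<Longrightarrow> y \<in> V"
  using adj_V adj_sym by blast

lemma N_subset: "N x \<subseteq> V"
  using adj_V2 by auto

lemma finite_N [simp]: "finite (N x)"
  using N_subset finite_V finite_subset by blast

lemma card_N: "x \<in> V \<Longrightarrow> int (card (N x)) = n * (n\<^sup>2 + 3 * n - 1)"
  using degree by (simp add: N_def)

lemma N_Int: "N x \<inter> N y = {z. x \<sim> z \<and> y \<sim> z}"
  by auto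

lemma card_common_adj: "x \<sim> y \<Longrightarrow> card (N x \<inter> N y) = 2"
  using lambda by (simp add: N_Int)

lemma card_common_nadj: "x \<parallel> y \<Longrightarrow> int (card (N x \<inter> N y)) = n * (n + 1)"
  using mu by (simp add: N_Int nadj_def)

lemma card_common:
  assumes "x \<in> V" "y \<in> V"
  shows "int (card (N x \<inter> N y)) =
    (n * (n\<^sup>2 + 3 * n - 1) - n * (n + 1)) * of_bool (x = y) + (2 - n * (n + 1)) * of_bool (x \<sim> y) + n * (n + 1)"
proof (cases "x = y")
  case True then show ?thesis using assms card_N adj_irrefl by auto
next
  case False
  show ?thesis
  proof (cases "x \<sim> y")
    case True then show ?thesis using False card_common_adj by auto
  next
    case False2: False
    then have "x \<parallel> y" using False assms by (simp add: nadj_def)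
    then show ?thesis using card_common_nadj False False2 by auto
  qed
qed

lemma Ad_alt: "Ad f x = (\<Sum>y\<in>V. of_bool (x \<sim> y) * f y)"
proof -
  have "(\<Sum>y\<in>V. of_bool (x \<sim> y) * f y) = (\<Sum>y\<in>N x. of_bool (x \<sim> y) * f y)"
    by (rule sum.mono_neutral_right) (use finite_V N_subset in auto)
  also have "\<dots> = Ad f x"
    unfolding Ad_def by (rule sum.cong) auto
  finally show ?thesis by (rule sym)
qed

lemma Ad_adjoint: "(\<Sum>x\<in>V. f x * Ad g x) = (\<Sum>x\<in>V. Ad f x * g x)"
proof -
  have "(\<Sum>x\<in>V. f x * Ad g x) = (\<Sum>x\<in>V. \<Sum>y\<in>V. f x * (of_bool (x \<sim> y) * g y))"
    by (simp add: Ad_alt sum_distrib_left)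
  also have "\<dots> = (\<Sum>y\<in>V. \<Sum>x\<in>V. f x * (of_bool (x \<sim> y) * g y))"
    by (rule sum.swap)
  also have "\<dots> = (\<Sum>y\<in>V. Ad f y * g y)"
    by (simp add: Ad_alt sum_distrib_left sum_distrib_right mult.commute adj_commute mult.left_commute)
  finally show ?thesis .
qed

text \<open>The matrix identity A^2 = (k - \<mu>) I + (\<lambda> - \<mu>) A + \<mu> J. On vectors of
  sum 0 it factors as (A - n)(A + n^2 + 2 n - 2) = 0.\<close>

lemma Ad_Ad:
  assumes "x \<in> V"
  shows "Ad (Ad f) x = (n * (n\<^sup>2 + 3 * n - 1) - n * (n + 1)) * f x + (2 - n * (n + 1)) * Ad f x
    + n * (n + 1) * (\<Sum>y\<in>V. f y)"
proof -
  have c: "(\<Sum>y\<in>V. of_bool (x \<sim> y) * of_bool (y \<sim> z)) = int (card (N x \<inter> N z))" if "z \<in> V" for z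
  proof -
    have "(\<Sum>y\<in>V. of_bool (x \<sim> y) * of_bool (y \<sim> z)) = (\<Sum>y\<in>V. of_bool (y \<in> N x \<inter> N z) :: int)"
      by (rule sum.cong) (auto simp: adj_commute)
    also have "\<dots> = int (card (V \<inter> {y. y \<in> N x \<inter> N z}))"
      using finite_V by (subst sum_of_bool_eq) auto
    also have "V \<inter> {y. y \<in> N x \<inter> N z} = N x \<inter> N z" using N_subset by auto
    finally show ?thesis .
  qed
  have "Ad (Ad f) x = (\<Sum>y\<in>V. \<Sum>z\<in>V. of_bool (x \<sim> y) * (of_bool (y \<sim> z) * f z))"
    by (simp add: Ad_alt sum_distrib_left)
  also have "\<dots> = (\<Sum>z\<in>V. \<Sum>y\<in>V. of_bool (x \<sim> y) * (of_bool (y \<sim> z) * f z))"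
    by (rule sum.swap)
  also have "\<dots> = (\<Sum>z\<in>V. (\<Sum>y\<in>V. of_bool (x \<sim> y) * of_bool (y \<sim> z)) * f z)"
    by (simp add: sum_distrib_right mult.assoc)
  also have "\<dots> = (\<Sum>z\<in>V. ((n * (n\<^sup>2 + 3 * n - 1) - n * (n + 1)) * of_bool (x = z)
      + (2 - n * (n + 1)) * of_bool (x \<sim> z) + n * (n + 1)) * f z)"
    by (rule sum.cong) (use assms in \<open>auto simp only: c card_common\<close>)
  also have "\<dots> = (\<Sum>z\<in>V. (n * (n\<^sup>2 + 3 * n - 1) - n * (n + 1)) * (of_bool (x = z) * f z))
      + (\<Sum>z\<in>V. (2 - n * (n + 1)) * (of_bool (x \<sim> z) * f z)) + (\<Sum>z\<in>V. n * (n + 1) * f z)"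
    by (simp add: distrib_right sum.distrib mult.assoc)
  also have "\<dots> = (n * (n\<^sup>2 + 3 * n - 1) - n * (n + 1)) * (\<Sum>z\<in>V. (of_bool (x = z) * f z))
      + (2 - n * (n + 1)) * Ad f x + n * (n + 1) * (\<Sum>z\<in>V. f z)"
    by (simp add: sum_distrib_left Ad_alt)
  also have "(\<Sum>z\<in>V. (of_bool (x = z) * f z)) = f x"
  proof -
    have "(\<Sum>z\<in>V. (of_bool (x = z) * f z)) = (\<Sum>z\<in>V. (if x = z then f z else 0))"
      by (rule sum.cong) auto
    then show ?thesis using assms finite_V by simp
  qed
  finally show ?thesis .
qed

lemma sum_Ad_square:
  "(\<Sum>y\<in>V. (Ad f y)\<^sup>2) = (n * (n\<^sup>2 + 3 * n - 1) - n * (n + 1)) * (\<Sum>x\<in>V. (f x)\<^sup>2)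
    + (2 - n * (n + 1)) * (\<Sum>x\<in>V. f x * Ad f x) + n * (n + 1) * (\<Sum>x\<in>V. f x)\<^sup>2"
proof -
  have "(\<Sum>y\<in>V. (Ad f y)\<^sup>2) = (\<Sum>x\<in>V. f x * Ad (Ad f) x)"
    using Ad_adjoint[of f "Ad f"] by (simp add: power2_eq_square)
  also have "\<dots> = (\<Sum>x\<in>V. f x * ((n * (n\<^sup>2 + 3 * n - 1) - n * (n + 1)) * f x + (2 - n * (n + 1)) * Ad f x
    + n * (n + 1) * (\<Sum>y\<in>V. f y)))"
    by (rule sum.cong) (auto simp only: Ad_Ad)
  also have "\<dots> = (\<Sum>x\<in>V. (n * (n\<^sup>2 + 3 * n - 1) - n * (n + 1)) * (f x)\<^sup>2)
    + (\<Sum>x\<in>V. (2 - n * (n + 1)) * (f x * Ad f x)) + (\<Sum>x\<in>V. f x * (n * (n + 1) * (\<Sum>y\<in>V. f y)))"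
    by (simp add: sum.distrib[symmetric]) (rule sum.cong, auto simp: algebra_simps power2_eq_square)
  also have "\<dots> = (n * (n\<^sup>2 + 3 * n - 1) - n * (n + 1)) * (\<Sum>x\<in>V. (f x)\<^sup>2)
    + (2 - n * (n + 1)) * (\<Sum>x\<in>V. f x * Ad f x) + n * (n + 1) * (\<Sum>x\<in>V. f x)\<^sup>2"
    unfolding sum_distrib_left[symmetric] sum_distrib_right[symmetric] by (simp add: power2_eq_square)
  finally show ?thesis .
qed

text \<open>The vector \<open>w = Ad z - n z\<close> lies in the other nontrivial eigenspace, so that \<open>\<Sum>w\<^sup>2\<close> is a multiple of
  \<open>\<Sum>w z\<close>, and the products \<open>w z\<close> vanish.\<close>

lemma eigenvector_if_on_support:
  assumes s0: "(\<Sum>y\<in>V. z y) = 0" and sup: "\<And>y. y \<in> V \<Longrightarrow> z y \<noteq> 0 \<Longrightarrow> Ad z y = n * z y"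
    and "x \<in> V"
  shows "Ad z x = n * z x"
proof -
  define w where "w = (\<lambda>y. Ad z y - n * z y)"
  define s where "s = - (n\<^sup>2 + 2 * n - 2)"
  have Aw: "Ad w y = s * w y" if "y \<in> V" for y
  proof -
    have "Ad w y = Ad (Ad z) y - n * Ad z y"
      by (simp add: w_def Ad_def sum_subtractf sum_distrib_left)
    then show ?thesis unfolding Ad_Ad[OF that] s0 w_def s_def
      by (simp add: power2_eq_square algebra_simps)
  qed
  have wz: "w y * z y = 0" if "y \<in> V" for y
    using sup[OF that] by (auto simp: w_def)
  have "(\<Sum>y\<in>V. (w y)\<^sup>2) = (\<Sum>y\<in>V. w y * Ad z y - n * (w y * z y))"
    by (rule sum.cong) (auto simp: w_def power2_eq_square algebra_simps)
  also have "\<dots> = (\<Sum>y\<in>V. w y * Ad z y) - n * (\<Sum>y\<in>V. w y * z y)"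
    by (simp only: sum_subtractf sum_distrib_left)
  also have "(\<Sum>y\<in>V. w y * z y) = 0" by (rule sum.neutral) (use wz in blast)
  also have "(\<Sum>y\<in>V. w y * Ad z y) - n * 0 = (\<Sum>y\<in>V. Ad w y * z y)"
    by (simp only: Ad_adjoint)
  also have "\<dots> = (\<Sum>y\<in>V. s * (w y * z y))"
    by (rule sum.cong) (auto simp: Aw)
  also have "\<dots> = 0" by (rule sum.neutral) (use wz in auto)
  finally have "\<forall>y\<in>V. (w y)\<^sup>2 = 0"
    using sum_nonneg_eq_0_iff[OF finite_V, of "\<lambda>y. (w y)\<^sup>2"] by simp
  then show ?thesis using \<open>x \<in> V\<close> by (auto simp: w_def)
qed

section \<open>Lines\<close>

text \<open>The quadruples in \<open>L4\<close> are called lines: like the 4-cliques, they are meant to be lines of an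
  affine space over the field of order 4.\<close>

definition K4 :: "'a \<Rightarrow> 'a \<Rightarrow> 'a \<Rightarrow> 'a \<Rightarrow> bool" where
  "K4 a b c d \<longleftrightarrow> a \<sim> b \<and> a \<sim> c \<and> a \<sim> d \<and> b \<sim> c \<and> b \<sim> d \<and> c \<sim> d"

definition indep :: "'a \<Rightarrow> 'a \<Rightarrow> 'a \<Rightarrow> bool" where
  "indep a b c \<longleftrightarrow> a \<parallel> b \<and> a \<parallel> c \<and> b \<parallel> c \<and> (\<forall>x. \<not> (a \<sim> x \<and> b \<sim> x \<and> c \<sim> x))"

definition L4 :: "'a \<Rightarrow> 'a \<Rightarrow> 'a \<Rightarrow> 'a \<Rightarrow> bool" where
  "L4 a b c d \<longleftrightarrow> indep a b c \<and> indep a b d \<and> indep a c d \<and> indep b c d"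

lemma adj_neq: "x \<sim> y \<Longrightarrow> x \<noteq> y"
  using adj_irrefl by blast

text \<open>The two common neighbours of an edge are adjacent since there is no diamond. Every edge
  thus lies in just one 4-clique, and the neighbourhood of a vertex is a disjoint union of
  triangles.\<close>

lemma K4_ex:
  assumes "x \<sim> y"
  obtains z w where "K4 x y z w"
proof -
  obtain z w where zw: "N x \<inter> N y = {z, w}" "z \<noteq> w"
    using card_common_adj[OF assms] by (meson card_2_iff)
  then have "x \<sim> z" "y \<sim> z" "x \<sim> w" "y \<sim> w" by auto
  with no_diamond[OF assms] zw(2) assms that show thesis unfolding K4_def by blast
qed

lemma K4_perm:
  "K4 a b c d \<Longrightarrow> K4 b a c d" "K4 a b c d \<Longrightarrow> K4 a c b d" "K4 a b c d \<Longrightarrow> K4 a b d c"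
  unfolding K4_def using adj_sym by blast+

lemma K4_common:
  assumes "K4 a b c d" "x \<sim> a" "x \<sim> b"
  shows "x = c \<or> x = d"
proof -
  have ab: "a \<sim> b" and cd: "c \<noteq> d" "{c, d} \<subseteq> N a \<inter> N b"
    using assms adj_neq by (auto simp: K4_def)
  have "card {c, d} = 2" using cd by simp
  then have "N a \<inter> N b = {c, d}"
    using cd card_common_adj[OF ab] by (metis card_subset_eq finite_Int finite_N)
  then show ?thesis using assms adj_sym by auto
qed

lemma K4_adj_two:
  assumes "K4 a b c d" "p \<in> {a, b, c, d}" "q \<in> {a, b, c, d}" "p \<noteq> q" "x \<sim> p" "x \<sim> q"
  shows "x \<in> {a, b, c, d}"
proof -
  have K: "K4 a b c d" "K4 a c b d" "K4 a d b c" "K4 b c a d" "K4 b d a c" "K4 c d a b"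
    using assms(1) adj_sym unfolding K4_def by blast+
  show ?thesis using assms(2-) K[THEN K4_common, of x] by auto
qed


section \<open>How the cliques at a vertex v meet the neighbourhood of a second vertex\<close>

definition T :: "'a \<Rightarrow> 'a \<Rightarrow> 'a set" where
  "T v u = {x'. v \<sim> x' \<and> (\<exists>x. v \<sim> x \<and> u \<sim> x \<and> x \<sim> x')}"

text \<open>Consequently a clique at v contains at most one neighbour of u, and \<open>T v u\<close>
  consists of the two remaining points of each clique at v that contains one.\<close>

lemma coclique: "u \<parallel> v \<Longrightarrow> u \<sim> a \<Longrightarrow> v \<sim> a \<Longrightarrow> u \<sim> b \<Longrightarrow> v \<sim> b \<Longrightarrow> \<not> a \<sim> b"
  using no_diamond[of a b u v] adj_sym by (auto simp: nadj_def)

lemma same_clique_trans: "v \<sim> x \<Longrightarrow> v \<sim> y \<Longrightarrow> v \<sim> z \<Longrightarrow> x \<sim> y \<Longrightarrow> y \<sim> z \<Longrightarrow> x \<noteq> z \<Longrightarrow> x \<sim> z"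
  using no_diamond[of v y x z] adj_sym by blast

lemma T_subset: "T v u \<subseteq> N v"
  by (auto simp: T_def)

lemma finite_T [simp]: "finite (T v u)"
  using T_subset finite_N finite_subset by blast

lemma T_Int_N: "v \<parallel> u \<Longrightarrow> T v u \<inter> N u = {}"
  using coclique[of v u] by (auto simp: T_def)

lemma card_T:
  assumes "v \<parallel> u"
  shows "int (card (T v u)) = 2 * (n * (n + 1))"
proof -
  have T: "T v u = (\<Union>x\<in>N v \<inter> N u. N v \<inter> N x)"
    by (auto simp: T_def)
  have "card (T v u) = (\<Sum>x\<in>N v \<inter> N u. card (N v \<inter> N x))"
    unfolding T
  proof (rule card_UN_disjoint)
    show "\<forall>i\<in>N v \<inter> N u. \<forall>j\<in>N v \<inter> N u. i \<noteq> j \<longrightarrow> (N v \<inter> N i) \<inter> (N v \<inter> N j) = {}"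
    proof (intro ballI impI equals0I)
      fix i j x assume a: "i \<in> N v \<inter> N u" "j \<in> N v \<inter> N u" "i \<noteq> j" "x \<in> (N v \<inter> N i) \<inter> (N v \<inter> N j)"
      then have "i \<sim> j" using same_clique_trans[of v i x j] adj_sym by auto
      then show False using coclique[OF assms, of i j] a by auto
    qed
  qed auto
  also have "\<dots> = (\<Sum>x\<in>N v \<inter> N u. 2)"
    by (rule sum.cong) (auto simp: card_common_adj)
  finally show ?thesis using card_common_nadj[OF assms] by simp
qed

lemma Ad_of_bool: "Ad (\<lambda>x. of_bool (x \<in> S)) y = int (card (N y \<inter> S))"
  by (simp add: Ad_def Int_def)

lemma sum_of_bool_V: "S \<subseteq> V \<Longrightarrow> (\<Sum>x\<in>V. of_bool (x \<in> S) :: int) = int (card S)"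
  using finite_V by (simp add: Int_absorb1 Int_def[symmetric])

lemma Ad_add: "Ad (\<lambda>x. f x + g x) y = Ad f y + Ad g y"
  by (simp add: Ad_def sum.distrib)

lemma Ad_diff: "Ad (\<lambda>x. f x - g x) y = Ad f y - Ad g y"
  by (simp add: Ad_def sum_subtractf)

lemma Ad_mult: "Ad (\<lambda>x. c * f x) y = c * Ad f y"
  by (simp add: Ad_def sum_distrib_left)

text \<open>The vector \<open>z\<close> has the value (n + 1)(n - 2) at u, n - 2 on the common
  neighbours of u and v, 0 on \<open>T v u\<close>, -1 on the rest of N v and -(n - 2) at v. With
  these weights it has sum 0 and satisfies the eigenvalue equation for n on its support, hence also
  at y, where \<open>z\<close> vanishes. That equation at y is the count.\<close>

lemma triple_count:
  assumes vu: "v \<parallel> u" and y: "y \<parallel> v" "y \<noteq> u"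
  shows "(n - 1) * int (card (N y \<inter> (N v \<inter> N u))) + int (card (N y \<inter> T v u))
    = n * (n + 1) - (n + 1) * (n - 2) * of_bool (u \<sim> y)"
proof -
  define z where "z = (\<lambda>x. (n + 1) * (n - 2) * of_bool (x \<in> {u}) + (n - 1) * of_bool (x \<in> N v \<inter> N u)
    + of_bool (x \<in> T v u) - of_bool (x \<in> N v) - (n - 2) * of_bool (x \<in> {v}))"
  have V: "u \<in> V" "v \<in> V" and nvu: "\<not> v \<sim> u" "\<not> u \<sim> v" "v \<noteq> u"
    using vu adj_sym by (auto simp: nadj_def)
  have Az: "Ad z x = (n + 1) * (n - 2) * int (card (N x \<inter> {u})) + (n - 1) * int (card (N x \<inter> (N v \<inter> N u)))
    + int (card (N x \<inter> T v u)) - int (card (N x \<inter> N v)) - (n - 2) * int (card (N x \<inter> {v}))" for x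
    unfolding z_def by (simp only: Ad_add Ad_diff Ad_mult Ad_of_bool)
  have sing: "int (card (N x \<inter> {a})) = of_bool (x \<sim> a)" for x a
    by (cases "x \<sim> a") auto
  have A: "int (card (N v \<inter> N u)) = n * (n + 1)" and Tc: "int (card (T v u)) = 2 * (n * (n + 1))"
    using vu card_common_nadj card_T by auto
  have "(\<Sum>x\<in>V. z x) = (n + 1) * (n - 2) * (\<Sum>x\<in>V. of_bool (x \<in> {u})) + (n - 1) * (\<Sum>x\<in>V. of_bool (x \<in> N v \<inter> N u))
    + (\<Sum>x\<in>V. of_bool (x \<in> T v u)) - (\<Sum>x\<in>V. of_bool (x \<in> N v)) - (n - 2) * (\<Sum>x\<in>V. of_bool (x \<in> {v}))"
    unfolding z_def by (simp only: sum.distrib sum_subtractf sum_distrib_left)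
  also have "\<dots> = (n + 1) * (n - 2) * int (card {u}) + (n - 1) * int (card (N v \<inter> N u))
    + int (card (T v u)) - int (card (N v)) - (n - 2) * int (card {v})"
  proof -
    have "{u} \<subseteq> V" "{v} \<subseteq> V" "N v \<inter> N u \<subseteq> V" "T v u \<subseteq> V" "N v \<subseteq> V"
      using V N_subset[of v] T_subset[of v u] by auto
    then show ?thesis by (simp only: sum_of_bool_V)
  qed
  also have "\<dots> = 0"
    using A Tc card_N[OF V(2)] by (simp add: algebra_simps power2_eq_square)
  finally have s0: "(\<Sum>x\<in>V. z x) = 0" .
  have "Ad z x = n * z x" if x: "x \<in> V" "z x \<noteq> 0" for x
  proof -
    consider "x = u" | "x = v" | "x \<in> N v \<inter> N u" | "x \<in> N v" "x \<notin> N u" "x \<notin> T v u"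
    proof -
      have "x \<in> N v \<Longrightarrow> x \<in> T v u \<Longrightarrow> x \<notin> N u \<Longrightarrow> z x = 0"
        using nvu adj_neq by (auto simp: z_def)
      moreover have "x \<notin> N v \<Longrightarrow> x \<noteq> u \<Longrightarrow> x \<noteq> v \<Longrightarrow> z x = 0"
        using T_subset[of v u] by (auto simp: z_def)
      ultimately show ?thesis using x(2) that by blast
    qed
    then show ?thesis
    proof cases
      case 1
      have "N u \<inter> T v u = {}" using T_Int_N[OF vu] by blast
      moreover have "N u \<inter> N v = N v \<inter> N u" "N u \<inter> (N v \<inter> N u) = N v \<inter> N u" by auto
      ultimately have "Ad z u = (n - 1) * (n * (n + 1)) - n * (n + 1)"
        unfolding Az sing using A nvu adj_irrefl by simp
      moreover have "z u = (n + 1) * (n - 2)"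
        using nvu T_subset[of v u] adj_irrefl by (auto simp: z_def)
      ultimately show ?thesis unfolding 1 by algebra
    next
      case 2
      have "N v \<inter> T v u = T v u" using T_subset by blast
      then have "Ad z v = (n - 1) * (n * (n + 1)) + 2 * (n * (n + 1)) - n * (n\<^sup>2 + 3 * n - 1)"
        unfolding Az sing using A Tc nvu adj_irrefl card_N[OF V(2)] by simp
      moreover have "z v = - (n - 2)"
        using nvu T_subset[of v u] adj_irrefl by (auto simp: z_def)
      ultimately show ?thesis unfolding 2 by algebra
    next
      case 3
      then have vx: "v \<sim> x" "u \<sim> x" by auto
      have "N x \<inter> (N v \<inter> N u) = {}" using coclique[OF vu, of x] vx by auto
      moreover have "N x \<inter> T v u = N x \<inter> N v" using vx by (auto simp: T_def)
      ultimately have "Ad z x = (n + 1) * (n - 2) - (n - 2)"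
        unfolding Az sing using vx adj_sym by simp
      moreover have "x \<notin> T v u" using coclique[OF vu, of _ x] vx by (auto simp: T_def)
      then have "z x = n - 2" using vx nvu adj_irrefl by (auto simp: z_def)
      ultimately show ?thesis by algebra
    next
      case 4
      then have vx: "v \<sim> x" "\<not> u \<sim> x" by auto
      have "N x \<inter> (N v \<inter> N u) = {}" using 4 adj_sym by (auto simp: T_def)
      moreover have "N x \<inter> T v u = {}"
      proof (rule equals0I)
        fix x' assume "x' \<in> N x \<inter> T v u"
        then obtain a where a: "x \<sim> x'" "v \<sim> x'" "v \<sim> a" "u \<sim> a" "a \<sim> x'" by (auto simp: T_def)
        then have "a \<noteq> x" using vx by auto
        then have "a \<sim> x" using same_clique_trans[of v a x' x] a vx adj_sym by blast
        then show False using 4 a vx by (auto simp: T_def)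
      qed
      moreover have "card (N x \<inter> N v) = 2" using card_common_adj[of x v] vx adj_sym by blast
      moreover have "\<not> x \<sim> u" "x \<sim> v" using vx adj_sym by auto
      ultimately have "Ad z x = - 2 - (n - 2)"
        unfolding Az sing by simp
      moreover have "z x = -1" using 4 nvu adj_irrefl by (auto simp: z_def)
      ultimately show ?thesis by simp
    qed
  qed
  then have "Ad z y = n * z y"
    using eigenvector_if_on_support[OF s0] y by (auto simp: nadj_def)
  moreover have "z y = 0"
    using y T_subset[of v u] adj_sym by (auto simp: z_def nadj_def)
  moreover have "\<not> y \<sim> v" using y by (simp add: nadj_def)
  ultimately show ?thesis
    unfolding Az sing using card_common_nadj[OF y(1)] by (simp add: adj_commute[of u y] algebra_simps)
qed

lemma indep_perm:
  "indep a b c \<Longrightarrow> indep b a c" "indep a b c \<Longrightarrow> indep a c b"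
  unfolding indep_def using nadj_commute by blast+

lemma indep_ex:
  assumes "v \<parallel> u"
  obtains w where "indep v u w"
proof -
  obtain w where w: "w \<in> V" "w \<noteq> v" "w \<noteq> u" "\<not> w \<sim> v" "\<not> w \<sim> u"
      "\<forall>z. v \<sim> z \<and> u \<sim> z \<longrightarrow> \<not> w \<sim> z"
    using far_vertex[of v u] assms by (auto simp: nadj_def)
  have "w \<parallel> v" "w \<parallel> u" using w assms unfolding nadj_def by blast+
  then have "indep v u w" using assms w(6) nadj_commute unfolding indep_def by blast
  then show thesis by (rule that)
qed

text \<open>With no vertex adjacent to all three, \<open>triple_count\<close> leaves n(n + 1)
  neighbours of w inside \<open>T v u\<close>, which already exhausts N v \<inter> N w.\<close>

lemma indep_N_subset_T:
  assumes "indep v u w"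
  shows "N v \<inter> N w \<subseteq> T v u"
proof -
  have a: "v \<parallel> u" "w \<parallel> v" "w \<parallel> u" "N w \<inter> (N v \<inter> N u) = {}"
    using assms nadj_commute unfolding indep_def by auto
  have "w \<noteq> u" "\<not> u \<sim> w" using a by (auto simp: nadj_def adj_commute)
  then have "int (card (N w \<inter> T v u)) = n * (n + 1)"
    using triple_count[OF a(1,2)] a by simp
  then have "card (N w \<inter> T v u) = card (N v \<inter> N w)"
    using card_common_nadj[OF a(2)] by (simp add: Int_commute)
  moreover have "N w \<inter> T v u \<subseteq> N v \<inter> N w" using T_subset by auto
  ultimately have "N w \<inter> T v u = N v \<inter> N w"
    by (intro card_subset_eq) auto
  then show ?thesis by auto
qed

text \<open>A clique at v that meets N u must meet N w too, by the inclusion above; it cannot do so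
  twice, by \<open>coclique\<close>.\<close>

lemma indep_mate:
  assumes "indep v u w" "K4 v x y z" "u \<sim> x"
  shows "w \<sim> y \<longleftrightarrow> \<not> w \<sim> z"
proof
  have vw: "v \<parallel> w" using assms by (simp add: indep_def)
  show "\<not> w \<sim> z" if "w \<sim> y"
    using coclique[OF vw, of y z] that assms(2) by (auto simp: K4_def)
  have "x \<in> T v w"
    using indep_N_subset_T[OF indep_perm(2)[OF assms(1)]] assms by (auto simp: K4_def)
  then obtain x2 where "v \<sim> x2" "w \<sim> x2" "x2 \<sim> x" by (auto simp: T_def)
  then have "w \<sim> y \<or> w \<sim> z" using K4_common[OF assms(2)] adj_sym by blast
  then show "w \<sim> y" if "\<not> w \<sim> z" using that by blast
qed

lemma indep_mate_ex:
  assumes "indep v u w" "v \<sim> x" "u \<sim> x"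
  obtains y z where "K4 v x y z" "w \<sim> y" "\<not> w \<sim> z"
proof -
  obtain y z where "K4 v x y z" using K4_ex assms by blast
  then show thesis using indep_mate[OF assms(1) _ assms(3)] that K4_perm by blast
qed

text \<open>Every clique at v through a neighbour of y contains a neighbour of y'. Moving from one
  to the other inside the clique is injective because no clique at v holds two neighbours of
  y.\<close>

lemma mate_card_le:
  assumes i: "indep v y y'" and P: "P \<subseteq> N v"
    and Q: "\<And>x x'. x \<in> P \<Longrightarrow> v \<sim> x' \<Longrightarrow> x \<sim> x' \<Longrightarrow> x' \<in> Q"
  shows "card (N y \<inter> P) \<le> card (N y' \<inter> Q)"
proof -
  have "\<exists>x'. v \<sim> x' \<and> y' \<sim> x' \<and> x \<sim> x'" if "x \<in> N y \<inter> P" for x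
  proof -
    have "v \<sim> x" "y \<sim> x" using that P by auto
    then obtain a b where "K4 v x a b" "y' \<sim> a" using indep_mate_ex[OF i] by blast
    then show ?thesis by (auto simp: K4_def)
  qed
  then obtain f where f: "\<And>x. x \<in> N y \<inter> P \<Longrightarrow> v \<sim> f x \<and> y' \<sim> f x \<and> x \<sim> f x" by metis
  have vy: "v \<parallel> y" using i by (simp add: indep_def)
  have "inj_on f (N y \<inter> P)"
  proof (rule inj_onI, rule ccontr)
    fix a b assume ab: "a \<in> N y \<inter> P" "b \<in> N y \<inter> P" "f a = f b" "a \<noteq> b"
    have v: "v \<sim> a" "v \<sim> b" using ab P by auto
    have "f a \<sim> b" using f[OF ab(2)] ab(3) adj_sym by auto
    then have "a \<sim> b" using same_clique_trans[of v a "f a" b] f[OF ab(1)] v ab(4) by blast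
    then show False using coclique[OF vy, of a b] ab v by auto
  qed
  moreover have "f ` (N y \<inter> P) \<subseteq> N y' \<inter> Q" using f Q by auto
  ultimately show ?thesis by (intro card_inj_on_le) auto
qed

lemma common_adj_le_1:
  assumes "v \<parallel> u" "u \<sim> y"
  shows "card (N y \<inter> (N v \<inter> N u)) \<le> 1"
proof -
  have "a = b" if "a \<in> N y \<inter> (N v \<inter> N u)" "b \<in> N y \<inter> (N v \<inter> N u)" for a b
  proof (rule ccontr)
    assume "a \<noteq> b"
    then have "a \<sim> b" using no_diamond[of u y a b] that assms by auto
    then show False using coclique[OF assms(1), of a b] that by auto
  qed
  then show ?thesis by (auto simp: card_le_Suc0_iff_eq)
qed


lemma T_indep:
  assumes i: "indep v u w"
  shows "T v w = (N v \<inter> N u) \<union> (T v u - N w)"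
proof (intro set_eqI iffI)
  have vu: "v \<parallel> u" and vw: "v \<parallel> w" using i by (auto simp: indep_def)
  fix x
  { assume "x \<in> T v w"
    then obtain b where b: "v \<sim> x" "v \<sim> b" "w \<sim> b" "b \<sim> x" by (auto simp: T_def)
    then have nw: "\<not> w \<sim> x" using coclique[OF vw, of b x] by blast
    have "b \<in> T v u" using indep_N_subset_T[OF i] b by auto
    then obtain a where a: "v \<sim> a" "u \<sim> a" "a \<sim> b" by (auto simp: T_def)
    have "x = a \<or> a \<sim> x" using same_clique_trans[of v a b x] a b by blast
    then show "x \<in> (N v \<inter> N u) \<union> (T v u - N w)" using a b nw by (auto simp: T_def) }
  { assume x: "x \<in> (N v \<inter> N u) \<union> (T v u - N w)"
    show "x \<in> T v w"
    proof (cases "u \<sim> x")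
      case True
      then show ?thesis using x indep_N_subset_T[OF indep_perm(2)[OF i]] T_subset[of v u] by auto
    next
      case False
      then obtain a where a: "v \<sim> x" "v \<sim> a" "u \<sim> a" "a \<sim> x" "\<not> w \<sim> x" using x by (auto simp: T_def)
      then obtain y z where K: "K4 v a y z" "w \<sim> y" using indep_mate_ex[OF i] by blast
      then have "x = y \<or> x = z" using K4_common[OF K(1), of x] a adj_sym by blast
      then have "x = z" using a K by blast
      then show ?thesis using K by (auto simp: K4_def T_def)
    qed }
qed

section \<open>The third class of clique points and the fourth point of a line\<close>

definition third :: "'a \<Rightarrow> 'a \<Rightarrow> 'a \<Rightarrow> 'a set" where
  "third v u w = T v u - N w"

lemma third_sym: "indep v u w \<Longrightarrow> third v w u = third v u w"
proof -
  assume i: "indep v u w"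
  then have "T v u \<inter> N u = {}" by (intro T_Int_N) (simp add: indep_def)
  then show "third v w u = third v u w" unfolding third_def T_indep[OF i] by blast
qed

text \<open>A clique at v that meets N u consists of v, a neighbour of u, a neighbour of w and a
  point of \<open>third v u w\<close>. The last class turns out to be the common neighbours of v and
  the fourth point of the line, see \<open>third_L4\<close>.\<close>

lemma T_split: "indep v u w \<Longrightarrow> T v u = (N v \<inter> N w) \<union> third v u w"
  using indep_N_subset_T[of v u w] T_subset[of v u] by (auto simp: third_def)

lemma indep_count:
  assumes i: "indep v u w" and y: "y \<parallel> v" "y \<noteq> u"
  shows "(n - 1) * int (card (N y \<inter> (N v \<inter> N u))) + int (card (N y \<inter> (N v \<inter> N w)))
    + int (card (N y \<inter> third v u w)) = n * (n + 1) - (n + 1) * (n - 2) * of_bool (u \<sim> y)"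
proof -
  have "v \<parallel> u" using i by (simp add: indep_def)
  moreover have "card (N y \<inter> T v u) = card (N y \<inter> (N v \<inter> N w)) + card (N y \<inter> third v u w)"
    unfolding T_split[OF i] Int_Un_distrib by (rule card_Un_disjoint) (auto simp: third_def)
  ultimately show ?thesis using triple_count[OF _ y] by simp
qed

definition fourth :: "'a \<Rightarrow> 'a \<Rightarrow> 'a \<Rightarrow> 'a \<Rightarrow> bool" where
  "fourth v u w y \<longleftrightarrow> y \<parallel> v \<and> y \<parallel> u \<and> y \<parallel> w \<and> N y \<inter> N v \<inter> N u = {} \<and> N y \<inter> N v \<inter> N w = {}"

lemma T_closed: "x \<in> T v u \<union> (N v \<inter> N u) \<Longrightarrow> v \<sim> x' \<Longrightarrow> x \<sim> x' \<Longrightarrow> x' \<in> T v u \<union> (N v \<inter> N u)"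
proof -
  assume a: "x \<in> T v u \<union> (N v \<inter> N u)" "v \<sim> x'" "x \<sim> x'"
  then obtain b where b: "v \<sim> b" "u \<sim> b" "b = x \<or> b \<sim> x" by (auto simp: T_def)
  have vx: "v \<sim> x" using a T_subset[of v u] by auto
  have "x' = b \<or> b \<sim> x'" using same_clique_trans[of v b x x'] a b vx by blast
  then show ?thesis using a b by (auto simp: T_def)
qed

text \<open>The weight is the value at y of the operator applied to the test vector of
  \<open>fourth_ex\<close>; a fourth vertex would have the weight (n - 1) n (n + 1) instead. The
  difference of the two equations \<open>eu\<close> and \<open>ew\<close> is divisible by n - 2 and
  settles each adjacency pattern of y to u and w, except for the range 0 < \<open>iu\<close> < n
  when y is adjacent to neither.\<close>

lemma not_fourth_weight:
  assumes i: "indep v u w" and y: "y \<parallel> v" "y \<noteq> u" "y \<noteq> w" and nf: "\<not> fourth v u w y"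
  defines "iu \<equiv> int (card (N y \<inter> (N v \<inter> N u)))" and "iw \<equiv> int (card (N y \<inter> (N v \<inter> N w)))"
    and "ic \<equiv> int (card (N y \<inter> third v u w))"
  shows "iu + iw + (n - 1) * ic \<in> {n * (n + 1), 2 * n + 2}"
proof -
  have vu: "v \<parallel> u" and vw: "v \<parallel> w" and uw: "u \<parallel> w" using i by (auto simp: indep_def)
  have i': "indep v w u" using indep_perm(2)[OF i] .
  have eu: "(n - 1) * iu + iw + ic = n * (n + 1) - (n + 1) * (n - 2) * of_bool (u \<sim> y)"
    using indep_count[OF i y(1,2)] by (simp add: iu_def iw_def ic_def)
  have ew: "(n - 1) * iw + iu + ic = n * (n + 1) - (n + 1) * (n - 2) * of_bool (w \<sim> y)"
    using indep_count[OF i' y(1,3)] third_sym[OF i] by (simp add: iu_def iw_def ic_def)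
  have pos: "0 \<le> iu" "0 \<le> iw" "0 \<le> ic" by (auto simp: iu_def iw_def ic_def)
  have n2: "n - 2 > 0" using n_ge_3 by simp
  consider "\<not> u \<sim> y" "\<not> w \<sim> y" | "u \<sim> y" "\<not> w \<sim> y" | "\<not> u \<sim> y" "w \<sim> y" | "u \<sim> y" "w \<sim> y" by blast
  then show ?thesis
  proof cases
    case 1
    have "(n - 2) * iu = (n - 2) * iw" using eu ew 1 by (simp add: algebra_simps)
    then have iuw: "iu = iw" using n2 by simp
    have ic: "ic = n * (n + 1) - n * iu" using eu 1 iuw by (simp add: algebra_simps)
    have ub: "iu \<le> n + 1"
    proof -
      have "n * iu \<le> n * (n + 1)" using ic pos by simp
      then show ?thesis using n_ge_3 by (simp add: mult_le_cancel_left)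
    qed
    have "iu \<noteq> 0"
    proof
      assume "iu = 0"
      then have "N y \<inter> N v \<inter> N u = {}" "N y \<inter> N v \<inter> N w = {}" using iuw
        by (auto simp: iu_def iw_def Int_assoc)
      moreover have "y \<parallel> u" "y \<parallel> w" using 1 y vu vw adj_sym by (auto simp: nadj_def)
      ultimately show False using nf y by (simp add: fourth_def)
    qed
    \<comment> \<open>A vertex \<open>y2\<close> independent of v and y has the same three counts as
      y. Moving along cliques sends its neighbours in \<open>third v u w\<close> injectively to
      neighbours of y in the other two classes, so \<open>ic\<close> \<le> 2 \<open>iu\<close>. This
      yields n(n + 1) \<le> (n + 2)(n - 1), which is false.\<close>
    moreover have "\<not> iu < n" if "iu \<noteq> 0"
    proof
      assume lt: "iu < n"
      obtain y2 where y2: "indep v y y2" using indep_ex[of v y] y nadj_commute by blast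
      have y2v: "y2 \<parallel> v" using y2 nadj_commute by (auto simp: indep_def)
      have e: "N y \<inter> (N v \<inter> N u) \<noteq> {}" "N y \<inter> (N v \<inter> N w) \<noteq> {}"
        using that iuw by (intro notI; simp add: iu_def iw_def)+
      have "N y \<inter> (N v \<inter> N y2) = {}" using y2 by (auto simp: indep_def)
      then have "y2 \<noteq> u" "y2 \<noteq> w" using e by blast+
      have eu2: "(n - 1) * int (card (N y2 \<inter> (N v \<inter> N u))) + int (card (N y2 \<inter> (N v \<inter> N w)))
        + int (card (N y2 \<inter> third v u w)) = n * (n + 1) - (n + 1) * (n - 2) * of_bool (u \<sim> y2)"
        by (rule indep_count[OF i y2v \<open>y2 \<noteq> u\<close>])
      have ew2: "(n - 1) * int (card (N y2 \<inter> (N v \<inter> N w))) + int (card (N y2 \<inter> (N v \<inter> N u)))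
        + int (card (N y2 \<inter> third v u w)) = n * (n + 1) - (n + 1) * (n - 2) * of_bool (w \<sim> y2)"
        using indep_count[OF i' y2v \<open>y2 \<noteq> w\<close>] third_sym[OF i] by simp
      \<comment> \<open>A union of full triangles at v, so the injection along cliques works in both
        directions and y and \<open>y2\<close> have equally many neighbours in it.\<close>
      let ?S = "T v u \<union> (N v \<inter> N u)"
      have S3: "card (N p \<inter> ?S) = card (N p \<inter> (N v \<inter> N u)) + card (N p \<inter> (N v \<inter> N w)) + card (N p \<inter> third v u w)" for p
      proof -
        have "N p \<inter> ?S = (N p \<inter> (N v \<inter> N u)) \<union> ((N p \<inter> (N v \<inter> N w)) \<union> (N p \<inter> third v u w))"
          unfolding T_split[OF i] by blast
        moreover have "card ((N p \<inter> (N v \<inter> N w)) \<union> (N p \<inter> third v u w)) = card (N p \<inter> (N v \<inter> N w)) + card (N p \<inter> third v u w)"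
          by (rule card_Un_disjoint) (auto simp: third_def)
        moreover have "card ((N p \<inter> (N v \<inter> N u)) \<union> ((N p \<inter> (N v \<inter> N w)) \<union> (N p \<inter> third v u w)))
          = card (N p \<inter> (N v \<inter> N u)) + card ((N p \<inter> (N v \<inter> N w)) \<union> (N p \<inter> third v u w))"
          by (rule card_Un_disjoint) (use T_Int_N[OF vu] i in \<open>auto simp: third_def indep_def\<close>)
        ultimately show ?thesis by simp
      qed
      have Sv: "?S \<subseteq> N v" using T_subset by auto
      have "card (N y \<inter> ?S) \<le> card (N y2 \<inter> ?S)"
        by (rule mate_card_le[OF y2 Sv]) (rule T_closed)
      moreover have "card (N y2 \<inter> ?S) \<le> card (N y \<inter> ?S)"
        by (rule mate_card_le[OF indep_perm(2)[OF y2] Sv]) (rule T_closed)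
      ultimately have s: "int (card (N y2 \<inter> (N v \<inter> N u))) + int (card (N y2 \<inter> (N v \<inter> N w)))
        + int (card (N y2 \<inter> third v u w)) = iu + iw + ic"
        unfolding S3 iu_def iw_def ic_def by linarith
      have "card (N y2 \<inter> third v u w) \<le> card (N y \<inter> ((N v \<inter> N u) \<union> (N v \<inter> N w)))"
      proof (rule mate_card_le[OF indep_perm(2)[OF y2]])
        show "third v u w \<subseteq> N v" using T_subset by (auto simp: third_def)
        fix x x' assume x: "x \<in> third v u w" "v \<sim> x'" "x \<sim> x'"
        then have "x' \<in> ?S" using T_closed[of x v u x'] by (auto simp: third_def)
        moreover have "x' \<notin> third v u w"
        proof
          assume x': "x' \<in> third v u w"
          obtain a where a: "v \<sim> a" "u \<sim> a" "a \<sim> x" using x by (auto simp: third_def T_def)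
          have vx: "v \<sim> x" using x T_subset[of v u] by (auto simp: third_def)
          have "a \<noteq> x'" using x' a T_Int_N[OF vu] by (auto simp: third_def)
          then have "a \<sim> x'" using same_clique_trans[of v a x x'] a x vx by blast
          then have "K4 v a x x'" using a x vx by (auto simp: K4_def)
          then show False using indep_mate[OF i, of a x x'] a x x' by (auto simp: third_def)
        qed
        ultimately show "x' \<in> (N v \<inter> N u) \<union> (N v \<inter> N w)" unfolding T_split[OF i] by blast
      qed
      also have "\<dots> \<le> card (N y \<inter> (N v \<inter> N u)) + card (N y \<inter> (N v \<inter> N w))"
        unfolding Int_Un_distrib by (rule card_Un_le)
      finally have c2: "int (card (N y2 \<inter> third v u w)) \<le> iu + iw" unfolding iu_def iw_def by linarith
      define ju where "ju = int (card (N y2 \<inter> (N v \<inter> N u)))"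
      define jw where "jw = int (card (N y2 \<inter> (N v \<inter> N w)))"
      define jc where "jc = int (card (N y2 \<inter> third v u w))"
      note J = ju_def[symmetric] jw_def[symmetric] jc_def[symmetric]
      have jpos: "0 \<le> ju" "0 \<le> jw" by (auto simp: ju_def jw_def)
      \<comment> \<open>If \<open>P\<close> holds, the equation has the solution \<open>iu\<close> -
        (n + 1), which is negative.\<close>
      have jeq: "j = iu" if "0 \<le> j" "(n - 2) * j + (iu + iw + ic) = n * (n + 1) - (n + 1) * (n - 2) * of_bool P" for j P
      proof (cases P)
        case True
        then have "(n - 2) * j = (n - 2) * (iu - (n + 1))"
          using that iuw ic by (simp add: algebra_simps)
        then show ?thesis using n2 that lt by simp
      next
        case False
        then have "(n - 2) * j = (n - 2) * iu"
          using that iuw ic by (simp add: algebra_simps)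
        then show ?thesis using n2 by simp
      qed
      have "(n - 2) * ju + (iu + iw + ic) = n * (n + 1) - (n + 1) * (n - 2) * of_bool (u \<sim> y2)"
        using eu2 s unfolding J by (simp add: algebra_simps)
      then have ju: "ju = iu" by (rule jeq[OF jpos(1)])
      have "(n - 2) * jw + (iu + iw + ic) = n * (n + 1) - (n + 1) * (n - 2) * of_bool (w \<sim> y2)"
        using ew2 s unfolding J by (simp add: algebra_simps)
      then have jw: "jw = iu" by (rule jeq[OF jpos(2)])
      have "ic \<le> 2 * iu" using s c2 iuw ju jw unfolding J by simp
      then have "n * (n + 1) \<le> (n + 2) * iu" using ic by (simp add: algebra_simps)
      also have "\<dots> \<le> (n + 2) * (n - 1)" using lt n_ge_3 by (intro mult_left_mono) auto
      finally show False by (simp add: algebra_simps)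
    qed
    ultimately have "iu = n \<or> iu = n + 1" using ub by linarith
    then show ?thesis using ic iuw by (auto simp: algebra_simps)
  next
    case 2
    have "iu \<le> 1" using common_adj_le_1[OF vu 2(1)] by (simp add: iu_def)
    then consider "iu = 0" | "iu = 1" using pos by linarith
    then show ?thesis
    proof cases
      case 1
      then have "(n - 2) * iw = (n - 2) * (n + 1)" using eu ew 2 by (simp add: algebra_simps)
      then have "iw = n + 1" using n2 by simp
      then show ?thesis using 1 eu 2 by (auto simp: algebra_simps)
    next
      case b: 2
      then have "(n - 2) * iw = (n - 2) * (n + 2)" using eu ew 2 by (simp add: algebra_simps)
      then have "iw = n + 2" using n2 by simp
      then show ?thesis using b eu 2 by (auto simp: algebra_simps)
    qed
  next
    case 3
    have "iw \<le> 1" using common_adj_le_1[OF vw 3(2)] by (simp add: iw_def)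
    then consider "iw = 0" | "iw = 1" using pos by linarith
    then show ?thesis
    proof cases
      case 1
      then have "(n - 2) * iu = (n - 2) * (n + 1)" using eu ew 3 by (simp add: algebra_simps)
      then have "iu = n + 1" using n2 by simp
      then show ?thesis using 1 eu 3 by (auto simp: algebra_simps)
    next
      case b: 2
      then have "(n - 2) * iu = (n - 2) * (n + 2)" using eu ew 3 by (simp add: algebra_simps)
      then have "iu = n + 2" using n2 by simp
      then show ?thesis using b ew 3 by (auto simp: algebra_simps)
    qed
  next
    case 4
    have le: "iu \<le> 1" "iw \<le> 1" using common_adj_le_1[OF vu 4(1)] common_adj_le_1[OF vw 4(2)]
      by (simp_all add: iu_def iw_def)
    obtain r r' where K: "K4 u y r r'" using K4_ex[OF 4(1)] .
    have "indep u w v" using indep_perm i by blast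
    then have "v \<sim> r \<or> v \<sim> r'" using indep_mate[OF _ K 4(2)] by blast
    then have "N y \<inter> (N v \<inter> N u) \<noteq> {}" using K by (auto simp: K4_def)
    then have "iu \<noteq> 0" by (auto simp: iu_def)
    then have iu1: "iu = 1" using le pos by linarith
    have "(n - 2) * iu = (n - 2) * iw" using eu ew 4 by (simp add: algebra_simps)
    then have "iw = 1" using n2 iu1 by simp
    then show ?thesis using iu1 eu 4 by (auto simp: algebra_simps)
  qed
qed

text \<open>Without a fourth vertex, A f takes only the values m = n(n + 1) and 2 n + 2 on the
  non-neighbours of v, so the sum of (A f - m)(A f - (2 n + 2)) is concentrated on v and N v. The
  moments of f evaluate the same sum over all vertices. The two results differ by (n - 2) m ((n - 1)
  m - (2 n + 2)), exactly the term that a single fourth vertex would contribute.\<close>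

lemma fourth_ex:
  assumes i: "indep v u w"
  shows "\<exists>y. fourth v u w y"
proof (rule ccontr)
  assume none: "\<not> (\<exists>y. fourth v u w y)"
  define C where "C = third v u w"
  define A where "A = N v \<inter> N u"
  define B where "B = N v \<inter> N w"
  have vu: "v \<parallel> u" and vw: "v \<parallel> w" and uw: "u \<parallel> w" using i by (auto simp: indep_def)
  have V: "v \<in> V" "u \<in> V" "w \<in> V" using vu vw by (auto simp: nadj_def)
  have cA: "int (card A) = n * (n + 1)" and cB: "int (card B) = n * (n + 1)"
    using card_common_nadj vu vw by (auto simp: A_def B_def)
  have TBC: "T v u = B \<union> C" using T_split[OF i] by (simp add: B_def C_def)
  have TAC: "T v w = A \<union> C" using T_split[OF indep_perm(2)[OF i]] third_sym[OF i] by (simp add: A_def C_def)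
  have dBC: "B \<inter> C = {}" by (auto simp: B_def C_def third_def)
  have dAC: "A \<inter> C = {}" using T_Int_N[OF vu] by (auto simp: A_def C_def third_def)
  have dAB: "A \<inter> B = {}" using i by (auto simp: A_def B_def indep_def)
  have fin [simp]: "finite A" "finite B" "finite C" by (auto simp: A_def B_def C_def third_def)
  have sub: "A \<subseteq> N v" "B \<subseteq> N v" "C \<subseteq> N v" using T_subset by (auto simp: A_def B_def C_def third_def)
  have cC: "int (card C) = n * (n + 1)"
    using card_T[OF vu] cB unfolding TBC card_Un_disjoint[OF fin(2,3) dBC] by simp
  \<comment> \<open>For the missing vertex w' one expects N v \<inter> N w' = C and T v w' = A
    \<union> B. So f is the combination that \<open>triple_count\<close> would use for v and w',
    written down without knowing w'.\<close>
  define f where "f = (\<lambda>x. of_bool (x \<in> A) + of_bool (x \<in> B) + (n - 1) * of_bool (x \<in> C))"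
  have Af: "Ad f y = int (card (N y \<inter> A)) + int (card (N y \<inter> B)) + (n - 1) * int (card (N y \<inter> C))" for y
    unfolding f_def by (simp only: Ad_add Ad_mult Ad_of_bool)
  have sV: "A \<subseteq> V" "B \<subseteq> V" "C \<subseteq> V" using sub N_subset by blast+
  have fA: "f x = 1" if "x \<in> A" for x using that dAB dAC by (auto simp: f_def)
  have fB: "f x = 1" if "x \<in> B" for x using that dAB dBC by (auto simp: f_def)
  have fC: "f x = n - 1" if "x \<in> C" for x using that dAC dBC by (auto simp: f_def)
  have f0: "f x = 0" if "x \<notin> A \<union> B \<union> C" for x using that by (auto simp: f_def)
  have sum3: "(\<Sum>x\<in>V. g x) = (\<Sum>x\<in>A. g x) + (\<Sum>x\<in>B. g x) + (\<Sum>x\<in>C. g x)"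
    if "\<And>x. x \<notin> A \<union> B \<union> C \<Longrightarrow> g x = 0" for g :: "'a \<Rightarrow> int"
  proof -
    have "(\<Sum>x\<in>V. g x) = (\<Sum>x\<in>A \<union> B \<union> C. g x)"
      by (rule sum.mono_neutral_right) (use finite_V sV that in auto)
    also have "\<dots> = (\<Sum>x\<in>A \<union> B. g x) + (\<Sum>x\<in>C. g x)"
      by (rule sum.union_disjoint) (use dAC dBC in auto)
    also have "(\<Sum>x\<in>A \<union> B. g x) = (\<Sum>x\<in>A. g x) + (\<Sum>x\<in>B. g x)"
      by (rule sum.union_disjoint) (use dAB in auto)
    finally show ?thesis .
  qed
  have Hv: "Ad f v = (n + 1) * (n * (n + 1))"
  proof -
    have "N v \<inter> A = A" "N v \<inter> B = B" "N v \<inter> C = C" using sub by auto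
    then show ?thesis unfolding Af using cA cB cC by (simp add: algebra_simps)
  qed
  have mates: "\<exists>a b c. a \<in> A \<and> b \<in> B \<and> c \<in> C \<and> K4 v a b c \<and> x \<in> {a, b, c}" if x: "x \<in> A \<union> B \<union> C" for x
  proof -
    have vx: "v \<sim> x" using x sub by auto
    obtain a where a: "a \<in> A" "a = x \<or> a \<sim> x"
    proof (cases "x \<in> A")
      case False
      then have "x \<in> T v u" using x TBC by auto
      then show ?thesis using that by (auto simp: T_def A_def)
    qed (use that in auto)
    then have va: "v \<sim> a" "u \<sim> a" by (auto simp: A_def)
    obtain b c where bc: "K4 v a b c" "w \<sim> b" "\<not> w \<sim> c" using indep_mate_ex[OF i va] by blast
    then have b: "b \<in> B" by (auto simp: B_def K4_def)
    have c: "c \<in> C" using bc va by (auto simp: C_def third_def T_def K4_def)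
    have "x \<in> {a, b, c}" using a K4_common[OF bc(1), of x] vx adj_sym by auto
    then show ?thesis using a b c bc by blast
  qed
  have NK: "N x \<inter> S = S \<inter> {p, q}" if "K4 v x p q" "S \<subseteq> N v" for x p q S
  proof
    show "N x \<inter> S \<subseteq> S \<inter> {p, q}"
    proof
      fix a assume "a \<in> N x \<inter> S"
      then have "a \<sim> v" "a \<sim> x" "a \<in> S" using that(2) adj_sym by auto
      then show "a \<in> S \<inter> {p, q}" using K4_common[OF that(1)] by blast
    qed
    show "S \<inter> {p, q} \<subseteq> N x \<inter> S" using that(1) by (auto simp: K4_def)
  qed
  have disj: "a \<notin> B" "a \<notin> C" "b \<notin> A" "b \<notin> C" "c \<notin> A" "c \<notin> B" if "a \<in> A" "b \<in> B" "c \<in> C" for a b c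
    using that dAB dAC dBC by auto
  have HA: "Ad f x = n" if x: "x \<in> A" for x
  proof -
    obtain a b c where m: "a \<in> A" "b \<in> B" "c \<in> C" "K4 v a b c" "x \<in> {a, b, c}" using mates x by blast
    then have "x = a" using x disj[OF m(1-3)] by auto
    have "N x \<inter> A = {}" "N x \<inter> B = {b}" "N x \<inter> C = {c}"
      unfolding \<open>x = a\<close> NK[OF m(4) sub(1)] NK[OF m(4) sub(2)] NK[OF m(4) sub(3)] using m disj[OF m(1-3)] by auto
    then show ?thesis unfolding Af by simp
  qed
  have HB: "Ad f x = n" if x: "x \<in> B" for x
  proof -
    obtain a b c where m: "a \<in> A" "b \<in> B" "c \<in> C" "K4 v a b c" "x \<in> {a, b, c}" using mates x by blast
    then have "x = b" using x disj[OF m(1-3)] by auto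
    have K: "K4 v b a c" using m K4_perm by blast
    have "N x \<inter> A = {a}" "N x \<inter> B = {}" "N x \<inter> C = {c}"
      unfolding \<open>x = b\<close> NK[OF K sub(1)] NK[OF K sub(2)] NK[OF K sub(3)] using m disj[OF m(1-3)] by auto
    then show ?thesis unfolding Af by simp
  qed
  have HC: "Ad f x = 2" if x: "x \<in> C" for x
  proof -
    obtain a b c where m: "a \<in> A" "b \<in> B" "c \<in> C" "K4 v a b c" "x \<in> {a, b, c}" using mates x by blast
    then have "x = c" using x disj[OF m(1-3)] by auto
    have K: "K4 v c a b" using m K4_perm by blast
    have "N x \<inter> A = {a}" "N x \<inter> B = {b}" "N x \<inter> C = {}"
      unfolding \<open>x = c\<close> NK[OF K sub(1)] NK[OF K sub(2)] NK[OF K sub(3)] using m disj[OF m(1-3)] by auto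
    then show ?thesis unfolding Af by simp
  qed
  have H0: "Ad f x = 0" if x: "v \<sim> x" "x \<notin> A \<union> B \<union> C" for x
  proof -
    have "\<not> x \<sim> p" if p: "p \<in> A \<union> B \<union> C" for p
    proof
      assume xp: "x \<sim> p"
      obtain a b c where m: "a \<in> A" "b \<in> B" "c \<in> C" "K4 v a b c" "p \<in> {a, b, c}" using mates[OF p] by blast
      have "x \<in> {v, a, b, c}"
        by (rule K4_adj_two[OF m(4), of v p]) (use m x xp adj_sym adj_irrefl in \<open>auto simp: K4_def\<close>)
      then show False using x m adj_irrefl by auto
    qed
    then have "N x \<inter> A = {}" "N x \<inter> B = {}" "N x \<inter> C = {}" by auto
    then show ?thesis unfolding Af by simp
  qed
  have Hrest: "(Ad f y - n * (n + 1)) * (Ad f y - (2 * n + 2)) = 0" if y: "y \<parallel> v" for y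
  proof -
    consider "y = u" | "y = w" | "y \<noteq> u" "y \<noteq> w" by blast
    then show ?thesis
    proof cases
      case 1
      have "N u \<inter> A = A" "N u \<inter> B = {}" "N u \<inter> C = {}"
        using i T_Int_N[OF vu] by (auto simp: A_def B_def C_def third_def indep_def)
      then show ?thesis unfolding 1 Af using cA by simp
    next
      case 2
      have "N w \<inter> A = {}" "N w \<inter> B = B" "N w \<inter> C = {}"
        using i by (auto simp: A_def B_def C_def third_def indep_def)
      then show ?thesis unfolding 2 Af using cB by simp
    next
      case 3
      have "Ad f y \<in> {n * (n + 1), 2 * n + 2}"
        unfolding Af A_def B_def C_def by (rule not_fourth_weight[OF i y 3]) (use none in blast)
      then show ?thesis by auto
    qed
  qed
  define k where "k = n * (n\<^sup>2 + 3 * n - 1)"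
  define m where "m = n * (n + 1)"
  have Nv: "int (card (N v)) = k" using card_N V by (simp add: k_def)
  have S0: "(\<Sum>x\<in>V. f x) = (n + 1) * m"
  proof -
    have "(\<Sum>x\<in>A. f x) = m" "(\<Sum>x\<in>B. f x) = m" "(\<Sum>x\<in>C. f x) = m * (n - 1)"
      using fA fB fC cA cB cC by (simp_all add: m_def)
    then show ?thesis by (subst sum3) (use f0 in \<open>auto simp: algebra_simps\<close>)
  qed
  have S1: "(\<Sum>x\<in>V. Ad f x) = k * ((n + 1) * m)"
  proof -
    have "(\<Sum>x\<in>V. Ad f x) = (\<Sum>x\<in>V. f x * Ad (\<lambda>_. 1) x)"
      using Ad_adjoint[of f "\<lambda>_. 1"] by simp
    also have "\<dots> = (\<Sum>x\<in>V. f x * k)"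
      by (rule sum.cong) (auto simp: Ad_def card_N k_def)
    also have "\<dots> = (\<Sum>x\<in>V. f x) * k" by (simp add: sum_distrib_right)
    finally show ?thesis using S0 by simp
  qed
  have Sff: "(\<Sum>x\<in>V. (f x)\<^sup>2) = 2 * m + (n - 1)\<^sup>2 * m"
    by (subst sum3) (use f0 fA fB fC cA cB cC in \<open>auto simp: m_def\<close>)
  have SfA: "(\<Sum>x\<in>V. f x * Ad f x) = 2 * n * m + 2 * (n - 1) * m"
    by (subst sum3) (use f0 fA fB fC HA HB HC cA cB cC in \<open>auto simp: m_def\<close>)
  have S2: "(\<Sum>x\<in>V. (Ad f x)\<^sup>2) = (k - m) * (2 * m + (n - 1)\<^sup>2 * m) + (2 - m) * (2 * n * m + 2 * (n - 1) * m)
      + m * ((n + 1) * m)\<^sup>2"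
    unfolding sum_Ad_square S0 Sff SfA by (simp add: k_def m_def)
  let ?g = "\<lambda>y. (Ad f y - m) * (Ad f y - (2 * n + 2))"
  have "(\<Sum>y\<in>V. ?g y) = (\<Sum>y\<in>V. (Ad f y)\<^sup>2 - (m + 2 * n + 2) * Ad f y + m * (2 * n + 2))"
    by (rule sum.cong) (auto simp: algebra_simps power2_eq_square)
  also have "\<dots> = (\<Sum>y\<in>V. (Ad f y)\<^sup>2) - (m + 2 * n + 2) * (\<Sum>y\<in>V. Ad f y) + int (card V) * (m * (2 * n + 2))"
    by (simp only: sum.distrib sum_subtractf sum_distrib_left sum_constant)
  finally have g1: "(\<Sum>y\<in>V. ?g y) = (\<Sum>y\<in>V. (Ad f y)\<^sup>2) - (m + 2 * n + 2) * (\<Sum>y\<in>V. Ad f y)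
    + int (card V) * (m * (2 * n + 2))" .
  have "(\<Sum>y\<in>V. ?g y) = (\<Sum>y\<in>insert v (N v). ?g y)"
  proof (rule sum.mono_neutral_right)
    show "\<forall>i\<in>V - insert v (N v). ?g i = 0"
    proof
      fix i assume "i \<in> V - insert v (N v)"
      then have "i \<parallel> v" using V adj_sym by (auto simp: nadj_def)
      then show "?g i = 0" using Hrest unfolding m_def by blast
    qed
  qed (use finite_V V N_subset in auto)
  also have "\<dots> = ?g v + (\<Sum>y\<in>N v. ?g y)"
    using adj_irrefl by simp
  also have "(\<Sum>y\<in>N v. ?g y) = (\<Sum>y\<in>N v. m * (2 * n + 2)) + (\<Sum>y\<in>N v. ?g y - m * (2 * n + 2))"
    by (simp only: sum_subtractf)
  also have "(\<Sum>y\<in>N v. ?g y - m * (2 * n + 2)) = (\<Sum>y\<in>A \<union> B \<union> C. ?g y - m * (2 * n + 2))"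
    by (rule sum.mono_neutral_right) (use sub H0 in \<open>auto simp: algebra_simps\<close>)
  also have "\<dots> = (\<Sum>y\<in>A \<union> B. ?g y - m * (2 * n + 2)) + (\<Sum>y\<in>C. ?g y - m * (2 * n + 2))"
    by (rule sum.union_disjoint) (use dAC dBC in auto)
  also have "(\<Sum>y\<in>A \<union> B. ?g y - m * (2 * n + 2)) = (\<Sum>y\<in>A. ?g y - m * (2 * n + 2)) + (\<Sum>y\<in>B. ?g y - m * (2 * n + 2))"
    by (rule sum.union_disjoint) (use dAB in auto)
  also have "(\<Sum>y\<in>A. ?g y - m * (2 * n + 2)) = m * ((n - m) * (n - (2 * n + 2)) - m * (2 * n + 2))"
    using HA cA by (simp add: m_def)
  also have "(\<Sum>y\<in>B. ?g y - m * (2 * n + 2)) = m * ((n - m) * (n - (2 * n + 2)) - m * (2 * n + 2))"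
    using HB cB by (simp add: m_def)
  also have "(\<Sum>y\<in>C. ?g y - m * (2 * n + 2)) = m * ((2 - m) * (2 - (2 * n + 2)) - m * (2 * n + 2))"
    using HC cC by (simp add: m_def)
  also have "(\<Sum>y\<in>N v. m * (2 * n + 2)) = k * (m * (2 * n + 2))"
    using Nv by simp
  finally have g2: "(\<Sum>y\<in>V. ?g y) = ((n + 1) * m - m) * ((n + 1) * m - (2 * n + 2)) + (k * (m * (2 * n + 2))
    + (m * ((n - m) * (n - (2 * n + 2)) - m * (2 * n + 2)) + m * ((n - m) * (n - (2 * n + 2)) - m * (2 * n + 2))
    + m * ((2 - m) * (2 - (2 * n + 2)) - m * (2 * n + 2))))"
    unfolding Hv by (simp add: m_def)
  have "(n - 2) * m * ((n - 1) * m - (2 * n + 2)) = 0"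
    using g1 g2 unfolding S1 S2 card_V k_def m_def by algebra
  moreover have "(n - 1) * m - (2 * n + 2) = (n + 1) * ((n - 1) * n - 2)"
    by (simp add: m_def algebra_simps)
  moreover have "(n - 1) * n \<ge> 2 * 3" using n_ge_3 by (intro mult_mono) auto
  ultimately show False using n_ge_3 by (auto simp: m_def)
qed


section \<open>Counting and matching relative to a line\<close>

lemma indep_nadj: "indep a b c \<Longrightarrow> a \<parallel> b \<and> b \<parallel> a \<and> a \<parallel> c \<and> c \<parallel> a \<and> b \<parallel> c \<and> c \<parallel> b"
  using nadj_commute by (auto simp: indep_def)

lemma indep_no_common: "indep a b c \<Longrightarrow> x \<sim> a \<Longrightarrow> x \<sim> b \<Longrightarrow> x \<sim> c \<Longrightarrow> False"
  using adj_sym unfolding indep_def by blast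

lemma L4_perm:
  "L4 a b c d \<Longrightarrow> L4 b a c d" "L4 a b c d \<Longrightarrow> L4 a c b d" "L4 a b c d \<Longrightarrow> L4 a b d c"
  unfolding L4_def using indep_perm by blast+

lemma nadj_not_adj: "a \<parallel> b \<Longrightarrow> a \<noteq> b \<and> \<not> a \<sim> b \<and> \<not> b \<sim> a"
  using adj_sym by (auto simp: nadj_def)

text \<open>Seen from u, two counts share the term for \<open>third u v w\<close>. As y, u and v
  have no common neighbour, their difference is n - 2 times the number of common neighbours of y, u
  and w.\<close>

lemma fourth_L4:
  assumes i: "indep v u w" and f: "fourth v u w y"
  shows "L4 v u w y"
proof -
  have y: "y \<parallel> v" "y \<parallel> u" "y \<parallel> w" "N y \<inter> (N v \<inter> N u) = {}" "N y \<inter> (N v \<inter> N w) = {}"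
    using f by (auto simp: fourth_def)
  have iu: "indep u v w" "indep u w v" using i indep_perm by blast+
  have ny: "y \<noteq> v" "\<not> v \<sim> y" "y \<noteq> w" "\<not> w \<sim> y" using y nadj_not_adj by auto
  have e1: "(n - 1) * int (card (N y \<inter> (N u \<inter> N v))) + int (card (N y \<inter> (N u \<inter> N w)))
    + int (card (N y \<inter> third u v w)) = n * (n + 1)"
    using indep_count[OF iu(1) y(2) ny(1)] ny by simp
  have e2: "(n - 1) * int (card (N y \<inter> (N u \<inter> N w))) + int (card (N y \<inter> (N u \<inter> N v)))
    + int (card (N y \<inter> third u v w)) = n * (n + 1)"
    using indep_count[OF iu(2) y(2) ny(3)] ny third_sym[OF iu(1)] by simp
  have "N y \<inter> (N u \<inter> N v) = {}" using y(4) by blast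
  then have z: "int (card (N y \<inter> (N u \<inter> N v))) = 0" by simp
  have "(n - 2) * int (card (N y \<inter> (N u \<inter> N w))) = 0"
    using e1 e2 unfolding z left_diff_distrib by linarith
  then have "N y \<inter> (N u \<inter> N w) = {}" using n_ge_3 by simp
  then show ?thesis using y i nadj_commute unfolding L4_def indep_def by auto
qed

lemma L4_ex:
  assumes "v \<parallel> u"
  obtains w w' where "L4 v u w w'"
proof -
  obtain w where "indep v u w" using indep_ex[OF assms] .
  then show thesis using fourth_ex fourth_L4 that by blast
qed

lemma third_L4:
  assumes L: "L4 v u w w'"
  shows "third v u w = N v \<inter> N w'"
proof (intro set_eqI iffI)
  have i: "indep v u w" "indep v u w'" "indep v w w'" using L by (auto simp: L4_def)
  fix x
  { assume "x \<in> third v u w"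
    then obtain a where a: "v \<sim> x" "v \<sim> a" "u \<sim> a" "a \<sim> x" "\<not> w \<sim> x" by (auto simp: third_def T_def)
    then obtain z w0 where z: "K4 v a z w0" "w \<sim> z" "\<not> w \<sim> w0" using indep_mate_ex[OF i(1)] by blast
    have "x = w0" using K4_common[OF z(1), of x] a z adj_sym by blast
    moreover have "\<not> w' \<sim> z" using indep_no_common[OF i(3), of z] z adj_sym unfolding K4_def by blast+
    ultimately show "x \<in> N v \<inter> N w'" using indep_mate[OF i(2) z(1) a(3)] a by auto }
  { assume "x \<in> N v \<inter> N w'"
    then show "x \<in> third v u w"
      using indep_N_subset_T[OF i(2)] indep_no_common[OF i(3), of x] adj_sym by (auto simp: third_def) }
qed

text \<open>The three cyclic versions of \<open>indep_count\<close> form a linear system with matrix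
  (n - 2) I + J, invertible for n \<ge> 3. For b, c, d the counts are n, n, n if y is adjacent to
  none of them, 0, n + 1, n + 1 if only to b, and 1, 1, n + 2 if only to b and c. Later proofs
  deduce adjacencies by comparing these numbers along two lines.\<close>

lemma line_count:
  assumes L: "L4 a b c d" and y: "y \<parallel> a" "y \<notin> {b, c, d}"
  shows "int (card (N y \<inter> (N a \<inter> N b))) =
    n + of_bool (b \<sim> y) + of_bool (c \<sim> y) + of_bool (d \<sim> y) - (n + 1) * of_bool (b \<sim> y)"
proof -
  define ib ic id where "ib = int (card (N y \<inter> (N a \<inter> N b)))"
    and "ic = int (card (N y \<inter> (N a \<inter> N c)))" and "id = int (card (N y \<inter> (N a \<inter> N d)))"
  have i: "indep a b c" "indep a c d" "indep a d b" "L4 a c d b" "L4 a d b c"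
    using L indep_perm(2)[of a b d] L4_perm(2,3) unfolding L4_def by blast+
  have e: "(n - 1) * ib + ic + id = n * (n + 1) - (n + 1) * (n - 2) * of_bool (b \<sim> y)"
    "(n - 1) * ic + id + ib = n * (n + 1) - (n + 1) * (n - 2) * of_bool (c \<sim> y)"
    "(n - 1) * id + ib + ic = n * (n + 1) - (n + 1) * (n - 2) * of_bool (d \<sim> y)"
  proof -
    have "y \<noteq> b" "y \<noteq> c" "y \<noteq> d" using y(2) by auto
    note f = indep_count[OF i(1) y(1) this(1), unfolded third_L4[OF L]]
      indep_count[OF i(2) y(1) this(2), unfolded third_L4[OF i(4)]]
      indep_count[OF i(3) y(1) this(3), unfolded third_L4[OF i(5)]]
    show "(n - 1) * ib + ic + id = n * (n + 1) - (n + 1) * (n - 2) * of_bool (b \<sim> y)"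
      "(n - 1) * ic + id + ib = n * (n + 1) - (n + 1) * (n - 2) * of_bool (c \<sim> y)"
      "(n - 1) * id + ib + ic = n * (n + 1) - (n + 1) * (n - 2) * of_bool (d \<sim> y)"
      unfolding ib_def ic_def id_def by (fact f)+
  qed
  define X Y Z :: int where "X = of_bool (b \<sim> y)" and "Y = of_bool (c \<sim> y)" and "Z = of_bool (d \<sim> y)"
  note e = e[folded X_def Y_def Z_def]
  have "((n - 1) * ib + ic + id) + ((n - 1) * ic + id + ib) + ((n - 1) * id + ib + ic) =
    (n * (n + 1) - (n + 1) * (n - 2) * X) + (n * (n + 1) - (n + 1) * (n - 2) * Y) + (n * (n + 1) - (n + 1) * (n - 2) * Z)"
    by (simp only: e)
  then have "(n + 1) * (ib + ic + id) = (n + 1) * (3 * n - (n - 2) * (X + Y + Z))"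
    by (simp add: algebra_simps)
  then have s: "ib + ic + id = 3 * n - (n - 2) * (X + Y + Z)"
    using n_ge_3 by simp
  have "(n - 2) * ib = ((n - 1) * ib + ic + id) - (ib + ic + id)"
    by (simp add: algebra_simps)
  also have "\<dots> = (n - 2) * (n + X + Y + Z - (n + 1) * X)"
    unfolding e(1) s by (simp add: algebra_simps)
  finally show ?thesis using n_ge_3 by (simp add: ib_def X_def Y_def Z_def)
qed

text \<open>A vertex off the line and adjacent to neither v nor u has at least n common neighbours
  with v and u.\<close>

lemma L4_unique:
  assumes L: "L4 v u w w'" and i: "indep v u y"
  shows "y = w \<or> y = w'"
proof (rule ccontr)
  assume "\<not> ?thesis"
  then have ne: "y \<noteq> w" "y \<noteq> w'" by auto
  have y: "y \<parallel> v" "y \<parallel> u" using i indep_nadj by auto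
  then have yu: "y \<notin> {u, w, w'}" "\<not> u \<sim> y" using ne nadj_not_adj by auto
  have "N y \<inter> (N v \<inter> N u) = {}" using i by (auto simp: indep_def)
  then show False using line_count[OF L y(1) yu(1)] yu(2) n_ge_3 by (auto simp: of_bool_def split: if_splits)
qed

lemma L4_unique2:
  assumes "L4 v u w w'" and "L4 v u y y'"
  shows "(y = w \<and> y' = w') \<or> (y = w' \<and> y' = w)"
proof -
  have "indep v u y" "indep v u y'" "y \<noteq> y'"
    using assms(2) nadj_not_adj indep_nadj unfolding L4_def by blast+
  then show ?thesis using L4_unique[OF assms(1)] by blast
qed

text \<open>A clique and a line that meet in p are matched on their remaining points: s needs a
  neighbour in the clique, and y is taken by r.\<close>

lemma L4_K4:
  assumes L: "L4 p q r s" and K: "K4 p x y z" and "q \<sim> x" "r \<sim> y"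
  shows "s \<sim> z"
proof -
  have i: "indep p q r" "indep p q s" "indep p r s" using L by (auto simp: L4_def)
  have "\<not> s \<sim> y" using indep_no_common[OF i(3), of y] K assms adj_sym unfolding K4_def by blast+
  then show ?thesis using indep_mate[OF i(2) K \<open>q \<sim> x\<close>] by blast
qed

lemma L4_K4_ex:
  assumes L: "L4 p q r s" and "p \<sim> x" "q \<sim> x"
  obtains y z where "K4 p x y z" "r \<sim> y" "s \<sim> z"
proof -
  have i: "indep p q r" using L by (auto simp: L4_def)
  obtain y z where "K4 p x y z" "r \<sim> y" using indep_mate_ex[OF i assms(2,3)] .
  then show thesis using L4_K4[OF L] assms that by blast
qed

lemma L4_no_common:
  assumes "L4 a b c d"
  shows "x \<sim> a \<Longrightarrow> x \<sim> b \<Longrightarrow> x \<sim> c \<Longrightarrow> False" "x \<sim> a \<Longrightarrow> x \<sim> b \<Longrightarrow> x \<sim> d \<Longrightarrow> False"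
    "x \<sim> a \<Longrightarrow> x \<sim> c \<Longrightarrow> x \<sim> d \<Longrightarrow> False" "x \<sim> b \<Longrightarrow> x \<sim> c \<Longrightarrow> x \<sim> d \<Longrightarrow> False"
  using assms indep_no_common unfolding L4_def by blast+

lemma L4_nadj:
  assumes "L4 a b c d"
  shows "a \<parallel> b" "a \<parallel> c" "a \<parallel> d" "b \<parallel> c" "b \<parallel> d" "c \<parallel> d"
  using assms by (auto simp: L4_def indep_def)

text \<open>The line through \<open>v\<close> and a common neighbour of \<open>u\<close> and \<open>w\<close>. A count shows that its two further
  points are a neighbour of \<open>w, w'\<close> and one of \<open>u, w'\<close>; they could a priori meet the clique at \<open>v\<close>
  the other way round, but this would create a diamond.\<close>

lemma transversal_line:
  assumes L: "L4 v u w w'" and K1: "K4 u b' a c'" "v \<sim> a" "w \<sim> b'" "w' \<sim> c'"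
    and K2: "K4 v a b c" "w \<sim> b" "w' \<sim> c"
  obtains y y' where "L4 v b' y y'" "w \<sim> y" "w' \<sim> y" "b \<sim> y" "c' \<sim> y" "u \<sim> y'" "w' \<sim> y'" "c \<sim> y'"
proof -
  have Lu: "L4 v w u w'" "L4 v w' u w" using L L4_perm by blast+
  note nc = L4_no_common[OF L]
  note na = L4_nadj[OF L]
  have ub: "u \<sim> b'" "u \<sim> a" "u \<sim> c'" "a \<sim> c'" "a \<sim> b'" using K1 adj_sym unfolding K4_def by blast+
  have b'v: "\<not> v \<sim> b'" "\<not> w' \<sim> b'" using nc[of b'] ub K1 adj_sym by blast+
  have "b' \<noteq> v" "b' \<notin> {w, u, w'}" "b' \<notin> {w', u, w}"
    using ub K1 b'v na nadj_not_adj adj_irrefl by blast+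
  moreover have "b' \<in> V" "v \<in> V" using ub adj_V2 na by (auto simp: nadj_def)
  ultimately have b': "b' \<parallel> v" "v \<parallel> b'" using b'v adj_sym by (auto simp: nadj_def)
  obtain y y' where M: "L4 v b' y y'" using L4_ex[OF b'(2)] .
  have Mn: "L4 v b' y y'" "L4 v b' y' y" using M L4_perm by blast+
  have cw': "int (card (N b' \<inter> (N v \<inter> N w'))) = n + 2"
    using line_count[OF Lu(2) b'(1) \<open>b' \<notin> {w', u, w}\<close>] ub K1 b'v by simp
  have cw: "int (card (N b' \<inter> (N v \<inter> N w))) = 1"
    using line_count[OF Lu(1) b'(1) \<open>b' \<notin> {w, u, w'}\<close>] ub K1 b'v by simp
  have My: "N v \<inter> N b' \<inter> N y = {}" "N v \<inter> N b' \<inter> N y' = {}"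
    using M by (auto simp: L4_def indep_def)
  have off: "p \<notin> {b', y, y'}" if "N b' \<inter> (N v \<inter> N p) \<noteq> {}" "p \<noteq> b'" for p
    using that My by blast
  \<comment> \<open>The triples counted above relative to the line L are now counted relative to the
    line M through v and b'. The value n + 2 makes w' adjacent to both further points of M; the
    positive values at w and u make each adjacent to at least one.\<close>
  have E: "N p \<inter> (N v \<inter> N b') = N b' \<inter> (N v \<inter> N p)" for p by blast
  have w'off: "w' \<notin> {b', y, y'}" using cw' n_ge_3 b'v na \<open>b' \<notin> {w, u, w'}\<close> by (intro off) auto
  have nv: "u \<parallel> v" "w \<parallel> v" "w' \<parallel> v" using na nadj_commute by blast+
  have bw: "b' \<sim> w" "b' \<sim> u" "\<not> b' \<sim> w'" using K1 ub b'v adj_sym by blast+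
  have "y \<sim> w' \<and> y' \<sim> w'"
    using line_count[OF M nv(3) w'off] cw' bw unfolding E by (simp add: of_bool_def split: if_splits)
  then have w'y: "w' \<sim> y" "w' \<sim> y'" using adj_sym by blast+
  have woff: "w \<notin> {b', y, y'}" using cw b'v na \<open>b' \<notin> {w, u, w'}\<close> by (intro off) auto
  have "y \<sim> w \<or> y' \<sim> w"
    using line_count[OF M nv(2) woff] cw bw unfolding E by (simp add: of_bool_def split: if_splits)
  then have wy: "w \<sim> y \<or> w \<sim> y'" using adj_sym by blast
  have "a \<in> N b' \<inter> (N v \<inter> N u)" using K1 ub adj_sym by simp
  then have ne: "N b' \<inter> (N v \<inter> N u) \<noteq> {}" by blast
  then have cu: "int (card (N b' \<inter> (N v \<inter> N u))) \<noteq> 0" and uoff: "u \<notin> {b', y, y'}"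
    using off[OF ne] \<open>b' \<notin> {w, u, w'}\<close> by auto
  have "y \<sim> u \<or> y' \<sim> u"
    using line_count[OF M nv(1) uoff] cu bw unfolding E by (simp add: of_bool_def split: if_splits)
  then have uy: "u \<sim> y \<or> u \<sim> y'" using adj_sym by blast
  have nb: "\<not> (u \<sim> p \<and> w \<sim> p)" if "w' \<sim> p" for p using nc(4)[of p] that adj_sym by blast
  obtain p q where pq: "L4 v b' p q" "w' \<sim> p" "w' \<sim> q" "w \<sim> p" "u \<sim> q"
  proof (cases "w \<sim> y")
    case True
    then show ?thesis using that[of y y'] Mn w'y nb uy by blast
  next
    case False
    then show ?thesis using that[of y' y] Mn w'y nb uy wy by blast
  qed
  have c'p: "p \<sim> c'"
    by (rule L4_K4[OF L4_perm(1)[OF L4_perm(3)[OF pq(1)]] K4_perm(2)[OF K4_perm(1)[OF K1(1)]] K1(2) adj_sym[OF pq(5)]])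
  have bp: "p \<sim> b"
  proof (rule ccontr)
    assume "\<not> p \<sim> b"
    moreover have "indep v b' p" using pq by (simp add: L4_def)
    ultimately have pc: "p \<sim> c" using indep_mate[OF _ K2(1), of b' p] ub adj_sym by blast
    have "c \<noteq> c'" using nc(2)[of c] K2 ub adj_sym unfolding K4_def by blast+
    then have "c \<sim> c'" using no_diamond[OF pq(2), of c c'] K1 K2 c'p pc by blast
    have "a \<sim> c" using K2(1) by (simp add: K4_def)
    then have "c' \<in> {v, a, b, c}"
      using K4_adj_two[OF K2(1), of a c c'] adj_neq adj_sym[OF ub(4)] adj_sym[OF \<open>c \<sim> c'\<close>] by simp
    moreover have "c' \<noteq> v" "c' \<noteq> a" using ub(3) adj_neq[OF ub(4)] nadj_not_adj[OF na(1)] by auto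
    moreover have "c' \<noteq> b" using nc(1)[of b] K2 ub adj_sym unfolding K4_def by blast+
    ultimately show False using \<open>c \<noteq> c'\<close> by auto
  qed
  then have "q \<sim> c" using L4_K4[OF pq(1) K2(1)] ub adj_sym by blast
  then show thesis using that[OF pq(1)] pq bp c'p adj_sym by blast
qed

text \<open>In the intended grid with diagonal q0, q1, q2, q3 and column q0, x, b, c, the vertices
  c' and d3 are the entries of rows 1 and 2 in column 3. The transversal line through q0 and b'
  contains a neighbour of q2, q3, b and c', which can only be d3.\<close>

lemma clique_transfer:
  assumes L: "L4 q0 q1 q2 q3" and K0: "K4 q0 x b c" "q1 \<sim> x" "q2 \<sim> b" "q3 \<sim> c"
    and K1: "K4 q1 x b' c'" "q2 \<sim> b'" "q3 \<sim> c'" and K2: "K4 q2 b d1 d3" "q1 \<sim> d1" "q3 \<sim> d3"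
  shows "c' \<sim> d3"
proof -
  have K1': "K4 q1 b' x c'" using K1 K4_perm by blast
  have "q0 \<sim> x" using K0 by (simp add: K4_def)
  then obtain y where y: "q2 \<sim> y" "q3 \<sim> y" "b \<sim> y" "c' \<sim> y"
    using transversal_line[OF L K1' _ K1(2,3) K0(1,3,4)] by blast
  have "y = d1 \<or> y = d3" using K4_common[OF K2(1)] y adj_sym by blast
  moreover have "y \<noteq> d1" using L4_no_common(4)[OF L, of y] y K2 adj_sym by blast
  ultimately show ?thesis using y by blast
qed

section \<open>Grids\<close>

text \<open>A grid is an affine plane of order 4 in which two parallel classes, the rows and the columns, consist
  of cliques.\<close>

definition grid :: "(nat \<Rightarrow> nat \<Rightarrow> 'a) \<Rightarrow> bool" where
  "grid P \<longleftrightarrow> (\<forall>i<4. \<forall>j<4. \<forall>k<4. j \<noteq> k \<longrightarrow> P i j \<sim> P i k \<and> P j i \<sim> P k i) \<and>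
    (\<forall>i<4. \<forall>j<4. \<forall>k<4. distinct [i, j, k] \<longrightarrow> indep (P i i) (P j j) (P k k))"

lemma less_4: "(i::nat) < 4 \<longleftrightarrow> i = 0 \<or> i = 1 \<or> i = 2 \<or> i = 3"
  by auto

lemma all_less_4: "(\<forall>i<4. Q (i::nat)) \<longleftrightarrow> Q 0 \<and> Q 1 \<and> Q 2 \<and> Q 3"
  unfolding less_4 by blast

lemma gridI:
  assumes "K4 (P 0 0) (P 0 1) (P 0 2) (P 0 3)" "K4 (P 1 0) (P 1 1) (P 1 2) (P 1 3)"
    "K4 (P 2 0) (P 2 1) (P 2 2) (P 2 3)" "K4 (P 3 0) (P 3 1) (P 3 2) (P 3 3)"
    "K4 (P 0 0) (P 1 0) (P 2 0) (P 3 0)" "K4 (P 0 1) (P 1 1) (P 2 1) (P 3 1)"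
    "K4 (P 0 2) (P 1 2) (P 2 2) (P 3 2)" "K4 (P 0 3) (P 1 3) (P 2 3) (P 3 3)"
    and L: "L4 (P 0 0) (P 1 1) (P 2 2) (P 3 3)"
  shows "grid P"
proof -
  have i: "indep (P 0 0) (P 1 1) (P 2 2)" "indep (P 0 0) (P 1 1) (P 3 3)"
    "indep (P 0 0) (P 2 2) (P 3 3)" "indep (P 1 1) (P 2 2) (P 3 3)"
    using L by (auto simp: L4_def)
  have p: "indep b a c \<and> indep a c b \<and> indep b c a \<and> indep c a b \<and> indep c b a" if "indep a b c" for a b c
    using indep_perm that by blast
  show ?thesis
    unfolding grid_def all_less_4
    using assms(1-8) i p[OF i(1)] p[OF i(2)] p[OF i(3)] p[OF i(4)] by (simp add: K4_def adj_commute)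
qed

lemma gridD:
  assumes "grid P" "i < 4" "j < 4" "k < 4" "j \<noteq> k"
  shows "P i j \<sim> P i k" "P j i \<sim> P k i"
  using assms by (auto simp: grid_def)

text \<open>The clique of v and a is column 0. Its other points together with u, w, w' determine
  rows 1 to 3, and \<open>clique_transfer\<close> aligns these rows into columns, whose cliques are
  completed by f1, f2 and f3.\<close>

lemma grid_ex:
  assumes L: "L4 v u w w'" and a: "v \<sim> a" "u \<sim> a"
  obtains P where "grid P" "P 0 0 = v" "P 1 1 = u" "P 2 2 = w" "P 3 3 = w'" "P 1 0 = a"
proof -
  have Lp: "L4 u v w w'" "L4 w v u w'" "L4 w' v u w" "L4 w' u w v" "L4 w u w' v" "L4 u w w' v"
    "L4 v u w' w" "L4 v w w' u" "L4 u v w' w"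
    using L L4_perm by blast+
  note nc = L4_no_common[OF L]
  obtain b c where K0: "K4 v a b c" "w \<sim> b" "w' \<sim> c" using L4_K4_ex[OF L a] .
  obtain b' c' where K1: "K4 u a b' c'" "w \<sim> b'" "w' \<sim> c'" using L4_K4_ex[OF Lp(1) a(2,1)] .
  have vb: "v \<sim> b" "v \<sim> c" using K0 by (auto simp: K4_def)
  obtain d1 d3 where K2: "K4 w b d1 d3" "u \<sim> d1" "w' \<sim> d3" using L4_K4_ex[OF Lp(2) K0(2) vb(1)] .
  obtain e1 e2 where K3: "K4 w' c e1 e2" "u \<sim> e1" "w \<sim> e2" using L4_K4_ex[OF Lp(3) K0(3) vb(2)] .
  have c'd3: "c' \<sim> d3" by (rule clique_transfer[OF L K0(1) a(2) K0(2,3) K1 K2])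
  have b'e2: "b' \<sim> e2"
    by (rule clique_transfer[OF Lp(7) _ a(2) K0(3,2) _ K1(3,2) K3]) (use K0 K1 K4_perm in blast)+
  have d1e1: "d1 \<sim> e1"
  proof (rule clique_transfer[OF Lp(8) _ K0(2) K0(3) a(2) _ K2(3,2) _ K3(3,2)])
    show "K4 v b c a" "K4 w b d3 d1" "K4 w' c e2 e1" using K0(1) K2(1) K3(1) K4_perm by blast+
  qed
  obtain f3 where F3: "K4 w' c' d3 f3"
  proof -
    have "w' \<sim> d3" "w' \<sim> c'" using K1 K2 by auto
    obtain p q where pq: "K4 w' c' p q" using K4_ex[OF \<open>w' \<sim> c'\<close>] .
    then have "d3 = p \<or> d3 = q" using K4_common[OF pq] \<open>w' \<sim> d3\<close> c'd3 adj_sym by blast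
    then show thesis using pq that K4_perm by blast
  qed
  obtain f2 where F2: "K4 w b' e2 f2"
  proof -
    obtain p q where pq: "K4 w b' p q" using K4_ex[OF K1(2)] .
    then have "e2 = p \<or> e2 = q" using K4_common[OF pq] K3(3) b'e2 adj_sym by blast
    then show thesis using pq that K4_perm by blast
  qed
  obtain f1 where F1: "K4 u d1 e1 f1"
  proof -
    obtain p q where pq: "K4 u d1 p q" using K4_ex[OF K2(2)] .
    then have "e1 = p \<or> e1 = q" using K4_common[OF pq] K3(2) d1e1 adj_sym by blast
    then show thesis using pq that K4_perm by blast
  qed
  have d: "u \<sim> c'" "w \<sim> d3" "u \<sim> b'" "w' \<sim> e2" "w \<sim> d1" "w' \<sim> e1" using K1 K2 K3 by (auto simp: K4_def)
  have vf3: "v \<sim> f3" by (rule L4_K4[OF Lp(4) F3 d(1,2)])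
  have vf2: "v \<sim> f2" by (rule L4_K4[OF Lp(5) F2 d(3,4)])
  have vf1: "v \<sim> f1" by (rule L4_K4[OF Lp(6) F1 d(5,6)])
  have uf1: "u \<sim> f1" using F1 by (simp add: K4_def)
  \<comment> \<open>The clique at v through f1 should be row 0. Transfers based at u instead of v
    put its other two points into columns 2 and 3.\<close>
  obtain b2 c2 where K: "K4 v f1 b2 c2" "w \<sim> b2" "w' \<sim> c2" using L4_K4_ex[OF L vf1 uf1] .
  have KF1: "K4 u f1 d1 e1" "K4 u f1 e1 d1" using F1 K4_perm by blast+
  have "c2 \<sim> d3"
    by (rule clique_transfer[OF Lp(1) KF1(1) vf1 d(5,6) K _ vb(1) K2(3)]) (use K2 K4_perm in blast)
  then have "c2 = c' \<or> c2 = f3"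
    using K4_common[of w' d3 c' f3 c2] F3 K4_perm K adj_sym by blast
  moreover have "c2 \<noteq> c'" using nc(2)[of c'] d K1 K adj_sym unfolding K4_def by blast+
  ultimately have c2: "c2 = f3" by blast
  have "b2 \<sim> e2"
    by (rule clique_transfer[OF Lp(9) KF1(2) vf1 d(6,5) _ K(3,2) _ vb(2) K3(3)]) (use K K3 K4_perm in blast)+
  then have "b2 = b' \<or> b2 = f2"
    using K4_common[of w e2 b' f2 b2] F2 K4_perm K adj_sym by blast
  moreover have "b2 \<noteq> b'" using nc(1)[of b'] d K1 K adj_sym unfolding K4_def by blast+
  ultimately have b2: "b2 = f2" by blast
  define P :: "nat \<Rightarrow> nat \<Rightarrow> 'a" where
    "P = (\<lambda>i j. [[v, f1, f2, f3], [a, u, b', c'], [b, d1, w, d3], [c, e1, e2, w']] ! i ! j)"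
  have "grid P"
  proof (rule gridI)
    have "K4 v f1 f2 f3" using K b2 c2 by simp
    moreover have "K4 a u b' c'" "K4 b d1 w d3" "K4 c e1 e2 w'" "K4 f1 u d1 e1" "K4 f2 b' w e2" "K4 f3 c' d3 w'"
      using K1 K2 K3 F1 F2 F3 by (simp_all add: K4_def adj_commute)
    ultimately show "K4 (P 0 0) (P 0 1) (P 0 2) (P 0 3)" "K4 (P 1 0) (P 1 1) (P 1 2) (P 1 3)"
    "K4 (P 2 0) (P 2 1) (P 2 2) (P 2 3)" "K4 (P 3 0) (P 3 1) (P 3 2) (P 3 3)"
    "K4 (P 0 0) (P 1 0) (P 2 0) (P 3 0)" "K4 (P 0 1) (P 1 1) (P 2 1) (P 3 1)"
    "K4 (P 0 2) (P 1 2) (P 2 2) (P 3 2)" "K4 (P 0 3) (P 1 3) (P 2 3) (P 3 3)"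
      using K0 by (simp_all add: P_def eval_nat_numeral)
    show "L4 (P 0 0) (P 1 1) (P 2 2) (P 3 3)" using L by (simp add: P_def eval_nat_numeral)
  qed
  then show thesis by (rule that) (simp_all add: P_def eval_nat_numeral)
qed

text \<open>Apart from the 8 rows and columns, the 20 lines of the plane are transversals belonging
  to the 12 even permutations of the indices: the identity gives the diagonal, the 3-cycles give the
  lines here, the double transpositions those of \<open>grid_line2\<close>.\<close>

lemma grid_line3:
  assumes g: "grid P" and d: "distinct [i, j, k, l]" "i < 4" "j < 4" "k < 4" "l < 4"
  shows "L4 (P i i) (P j k) (P k l) (P l j)"
proof -
  have L: "L4 (P i i) (P j j) (P k k) (P l l)"
    using g d unfolding grid_def L4_def by simp
  note nc = L4_no_common[OF L]
  note A = gridD[OF g]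
  have K1: "K4 (P j j) (P j k) (P j i) (P j l)" and K2: "K4 (P i i) (P j i) (P k i) (P l i)"
    and K3: "K4 (P k k) (P k i) (P k j) (P k l)" and K4': "K4 (P l l) (P j l) (P i l) (P k l)"
    and K5: "K4 (P l l) (P l i) (P l j) (P l k)"
    using A d by (auto simp: K4_def)
  obtain y y' where y: "L4 (P i i) (P j k) y y'" "P k k \<sim> y" "P l l \<sim> y" "P k i \<sim> y" "P j l \<sim> y"
     "P j j \<sim> y'" "P l l \<sim> y'" "P l i \<sim> y'"
    using transversal_line[OF L K1 _ _ _ K2] A d by (metis distinct_length_2_or_more)
  have "y = P k j \<or> y = P k l" using K4_common[OF K3, of y] y adj_sym by blast
  moreover have "\<not> P k j \<sim> P l l"
    using nc(4)[of "P k j"] A d by auto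
  ultimately have yy: "y = P k l" using y adj_sym by blast
  have "y' = P l j \<or> y' = P l k" using K4_common[OF K5, of y'] y adj_sym by blast
  moreover have "\<not> P l k \<sim> P j j"
    using nc(4)[of "P l k"] A d by auto
  ultimately have "y' = P l j" using y adj_sym by blast
  then show ?thesis using y yy by simp
qed


lemma two_more_indices:
  "i < 4 \<Longrightarrow> j < 4 \<Longrightarrow> i \<noteq> j \<Longrightarrow> \<exists>k<4. \<exists>l<4. distinct [i, j, k, l :: nat]"
  by simp presburger

lemma distinct_indices:
  assumes "distinct [i, j, k, l :: nat]" "i < 4" "j < 4" "k < 4" "l < 4" "x < 4"
  shows "x \<in> {i, j, k, l}"
proof -
  have "set [i, j, k, l] = {..<4}"
    by (rule card_subset_eq) (use assms distinct_card[OF assms(1)] in simp_all)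
  then show ?thesis using assms(6) by auto
qed

lemma grid_K4:
  assumes "grid P" "distinct [i, j, k, l]" "i < 4" "j < 4" "k < 4" "l < 4" "m < 4"
  shows "K4 (P i m) (P j m) (P k m) (P l m)" "K4 (P m i) (P m j) (P m k) (P m l)"
  using gridD[OF assms(1)] assms(2-) by (auto simp: K4_def)

text \<open>\<open>grid\<close> does not demand distinct entries off the diagonal; this is the one
  coincidence that \<open>grid_adj\<close> cannot exclude by looking at the diagonal alone.\<close>

lemma grid_asym:
  assumes g: "grid P" and ij: "i < 4" "j < 4" "i \<noteq> j"
  shows "P i j \<noteq> P j i"
proof
  assume e: "P i j = P j i"
  obtain k l where kl: "k < 4" "l < 4" "distinct [i, j, k, l]" using two_more_indices[OF ij] by blast
  then have "L4 (P l l) (P j i) (P i k) (P k j)"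
    by (intro grid_line3[OF g]) (use ij in auto)
  then have "\<not> P j i \<sim> P i k" using L4_nadj(4) nadj_not_adj by blast
  moreover have "P i j \<sim> P i k" using gridD(1)[OF g ij(1,2) kl(1)] kl(3) by simp
  ultimately show False using e by simp
qed

lemma grid_diag_indep:
  assumes "grid P" "distinct [i, j, k]" "i < 4" "j < 4" "k < 4"
  shows "indep (P i i) (P j j) (P k k)"
  using assms unfolding grid_def by blast

lemma grid_adj:
  assumes g: "grid P" and d: "i < 4" "j < 4" "k < 4" "l < 4" and a: "P i j \<sim> P k l"
  shows "i = k \<or> j = l"
proof (rule ccontr)
  assume ne: "\<not> (i = k \<or> j = l)"
  obtain p q where pq: "p < 4" "q < 4" "distinct [i, k, p, q]" using two_more_indices[of i k] d ne by blast
  have K: "K4 (P i l) (P k l) (P p l) (P q l)" using grid_K4(1)[OF g] pq d by simp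
  have "P i j \<sim> P i l" using gridD(1)[OF g d(1,2,4)] ne by simp
  then have "P i j = P p l \<or> P i j = P q l" using K4_common[OF K] a by blast
  then obtain x where x: "x < 4" "x \<noteq> i" "P i j = P x l" using pq by auto
  \<comment> \<open>An entry equals or is adjacent to no diagonal entries other than those of its
    own row and column. So a vertex determines its pair of indices up to order.\<close>
  have near: "y = r \<or> y = s \<or> P r s \<noteq> P y y \<and> \<not> P r s \<sim> P y y" if rs: "r < 4" "s < 4" "y < 4" for r s y
  proof (cases "r = s")
    case True
    then show ?thesis using grid_diag_indep[OF g, of r y] two_more_indices[of r y] rs
      by (metis distinct_length_2_or_more indep_nadj nadj_not_adj)
  next
    case False
    show ?thesis
    proof (rule ccontr)
      assume "\<not> ?thesis"
      then have y: "y \<noteq> r" "y \<noteq> s" "P r s = P y y \<or> P r s \<sim> P y y" by auto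
      have i: "indep (P r r) (P s s) (P y y)" using grid_diag_indep[OF g] rs y False by simp
      have "P r s \<sim> P r r" "P r s \<sim> P s s" using gridD[OF g] rs False by auto
      then show False using y(3) indep_no_common[OF i] indep_nadj[OF i] nadj_not_adj adj_sym by metis
    qed
  qed
  have xl: "P i j = P y y \<or> P i j \<sim> P y y" if "y \<in> {x, l, i, j}" for y
  proof -
    have "P r s = P y y \<or> P r s \<sim> P y y" if "y = r \<or> y = s" "r < 4" "s < 4" for r s
      using gridD[OF g] that by (cases "r = s") auto
    then show ?thesis using that x d by (metis insert_iff empty_iff)
  qed
  have "x = i \<or> x = j" "l = i \<or> l = j" using near[OF d(1,2)] xl x(1) d(4) by blast+
  then have "x = j" "l = i" using x(2) ne by auto
  then have "P i j = P j i" "i \<noteq> j" using x by auto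
  then show False using grid_asym[OF g d(1,2)] by blast
qed

text \<open>Permuting the columns by \<open>s\<close> turns a 3-cycle transversal into the diagonal
  of a new grid. A 3-cycle transversal of that grid belongs, in the old one, to a product of two
  3-cycles, here a double transposition.\<close>

lemma grid_line2:
  assumes g: "grid P" and d: "distinct [i, j, k, l]" "i < 4" "j < 4" "k < 4" "l < 4"
  shows "L4 (P i j) (P j i) (P k l) (P l k)"
proof -
  define s where "s = (\<lambda>x. if x = j then l else if x = l then k else if x = k then j else x)"
  have L: "L4 (P i i) (P j l) (P l k) (P k j)" using grid_line3[OF g, of i j l k] d by simp
  have s4: "s x < 4" if "x < 4" for x using that d by (simp add: s_def)
  have si: "s x \<noteq> s y" if "x \<noteq> y" for x y using that d by (auto simp: s_def)
  have sv: "s i = i" "s j = l" "s l = k" "s k = j" using d by (auto simp: s_def)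
  have "grid (\<lambda>x y. P x (s y))"
    unfolding grid_def
  proof (intro conjI allI impI)
    fix x y z :: nat assume a: "x < 4" "y < 4" "z < 4" "y \<noteq> z"
    then show "P x (s y) \<sim> P x (s z)" "P y (s x) \<sim> P z (s x)"
      using gridD[OF g] s4 si by auto
  next
    fix x y z :: nat assume a: "x < 4" "y < 4" "z < 4" "distinct [x, y, z]"
    then have m: "x \<in> {i, j, k, l}" "y \<in> {i, j, k, l}" "z \<in> {i, j, k, l}"
      using distinct_indices[OF d] by blast+
    have I: "indep (P i i) (P j l) (P l k)" "indep (P i i) (P j l) (P k j)"
      "indep (P i i) (P l k) (P k j)" "indep (P j l) (P l k) (P k j)" using L by (auto simp: L4_def)
    have p: "indep b a c \<and> indep a c b \<and> indep b c a \<and> indep c a b \<and> indep c b a" if "indep a b c" for a b c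
      using indep_perm that by blast
    show "indep (P x (s x)) (P y (s y)) (P z (s z))"
      using m a(4) I p[OF I(1)] p[OF I(2)] p[OF I(3)] p[OF I(4)] by (elim insertE emptyE) (simp_all add: sv)
  qed
  from grid_line3[OF this, of l i k j] have "L4 (P l k) (P i j) (P k l) (P j i)"
    using d sv by auto
  then show ?thesis using L4_perm by blast
qed

lemma line_count_ge:
  assumes L: "L4 a b c d" and y: "y \<parallel> a" "y \<notin> {b, c, d}" and nb: "\<not> b \<sim> y" and "c \<sim> y"
  shows "int (card (N y \<inter> (N a \<inter> N b))) \<ge> n + 1"
  using line_count[OF L y] assms by simp

text \<open>The cliques \<open>va\<close> and \<open>va'\<close> match the remaining points of the line \<open>vw\<close> with those of the line \<open>aa'\<close>.
  If the two matchings agreed somewhere, the point \<open>P 0 2\<close> of the grid on \<open>vw\<close> and \<open>a\<close> would have too many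
  neighbours on lines of the grid on \<open>aa'\<close> and \<open>v\<close>.\<close>

lemma corner:
  assumes L1: "L4 v w w2 w3" and L2: "L4 a a' g g'"
    and va: "v \<sim> a" "w \<sim> a" "v \<sim> a'" "w \<sim> a'"
    and b: "v \<sim> b" "a \<sim> b" "w2 \<sim> b" "g \<sim> b"
    and b': "v \<sim> b'" "a' \<sim> b'" "w2 \<sim> b'" "g \<sim> b'"
  shows False
proof -
  obtain P where P: "grid P" "P 0 0 = v" "P 1 1 = w" "P 2 2 = w2" "P 3 3 = w3" "P 1 0 = a"
    using grid_ex[OF L1 va(1,2)] .
  have PK: "K4 v a (P 2 0) (P 3 0)" "K4 v (P 0 1) (P 0 2) (P 0 3)"
    using grid_K4[OF P(1), of 0 1 2 3 0] unfolding P(2,6) by simp_all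
  note PA = grid_adj[OF P(1)]
  have "\<not> P 3 0 \<sim> w2" using PA[of 3 0 2 2] by (auto simp: P(4))
  moreover have "b = P 2 0 \<or> b = P 3 0" using K4_common[OF PK(1)] b adj_sym by blast
  ultimately have bP: "b = P 2 0" using b adj_sym by blast
  show False
  proof (cases "a' = P 0 1")
    case True
    have "L4 a a' (P 2 3) (P 3 2)"
      using grid_line2[OF P(1), of 1 0 2 3] unfolding P(6) True by simp
    then have "g = P 2 3 \<or> g = P 3 2" using L4_unique2[OF _ L2] by blast
    moreover have "\<not> P 3 2 \<sim> P 2 0" using PA[of 3 2 2 0] by auto
    ultimately have g: "g = P 2 3" using b(4) bP by blast
    have "b' = P 0 2 \<or> b' = P 0 3" using K4_common[OF PK(2)] b' True adj_sym by blast
    moreover have "\<not> P 2 2 \<sim> P 0 3" using PA[of 2 2 0 3] by auto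
    ultimately have "b' = P 0 2" using b'(3) P(4) by auto
    then show False using b'(4) PA[of 2 3 0 2] by (auto simp: g)
  next
    case False
    define y where "y = P 0 2"
    define c where "c = P 3 0"
    have K: "K4 v a b c" using PK(1) by (simp add: bP c_def)
    have vy: "v \<sim> y" using PK(2) by (simp add: K4_def y_def)
    obtain t where t: "K4 v a' b' t"
    proof -
      obtain p q where pq: "K4 v a' p q" using K4_ex[OF va(3)] .
      then have "b' = p \<or> b' = q" using K4_common[OF pq] b' adj_sym by blast
      then show thesis using pq that K4_perm by blast
    qed
    have w3t: "w3 \<sim> t" using L4_K4[OF L1 t] va b' by blast
    have tv: "v \<sim> t" "a' \<sim> t" "b' \<sim> t" and cv: "v \<sim> c" "a \<sim> c" using t K by (auto simp: K4_def)
    have aa': "a \<noteq> a'" "\<not> a \<sim> a'" using L4_nadj(1)[OF L2] nadj_not_adj by blast+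
    have ynear: "y \<noteq> s \<and> \<not> y \<sim> s" if s: "v \<sim> s" "s = a' \<or> a' \<sim> s" for s
    proof (rule ccontr)
      assume "\<not> ?thesis"
      then have "y = a' \<or> y \<sim> a'" using same_clique_trans[of v y s a'] s vy va(3) adj_sym by blast
      moreover have "y \<noteq> a'" using va(4) PA[of 1 1 0 2] P(3) by (auto simp: y_def)
      ultimately have "a' \<sim> y" "a' \<sim> v" using adj_sym va by blast+
      moreover have "K4 v y (P 0 1) (P 0 3)" using PK(2) K4_perm unfolding y_def by blast
      ultimately have "a' = P 0 3" using K4_common False by blast
      then show False using va(4) PA[of 1 1 0 3] P(3) by auto
    qed
    have ta: "\<not> a \<sim> t" using same_clique_trans[of v a t a'] tv va aa' adj_sym by blast
    have a'c: "\<not> c \<sim> a'" using same_clique_trans[of v a c a'] cv va aa' adj_sym by blast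
    have ya: "y \<noteq> a" "\<not> y \<sim> a" "y \<noteq> c" "\<not> y \<sim> c" "y \<noteq> b"
    proof -
      have "\<not> w \<sim> y" using PA[of 1 1 0 2] unfolding P(3) y_def by auto
      then show "y \<noteq> a" using va by blast
      show "\<not> y \<sim> a" using PA[of 0 2 1 0] unfolding P(6) y_def by auto
      have "P 3 0 \<sim> P 3 3" using gridD(1)[OF P(1), of 3 0 3] by simp
      then show "y \<noteq> c" using PA[of 0 2 3 3] unfolding y_def c_def by auto
      show "\<not> y \<sim> c" using PA[of 0 2 3 0] unfolding y_def c_def by auto
      show "y \<noteq> b" using grid_asym[OF P(1), of 0 2] unfolding y_def bP by simp
    qed
    have yP: "L4 (P 3 3) (P 1 0) (P 0 2) (P 2 1)" "L4 (P 1 1) (P 3 0) (P 0 2) (P 2 3)"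
      by (rule grid_line3[OF P(1)]; simp)+
    have Lya: "L4 a y w3 (P 2 1)" and Lyc: "L4 c y w (P 2 3)"
      using yP[unfolded P(3,5,6), folded y_def c_def] L4_perm by blast+
    have "\<not> v \<sim> P 2 1" "\<not> v \<sim> P 2 3" using PA[of 0 0 2 1] PA[of 0 0 2 3] unfolding P(2) by auto
    then have off: "t \<notin> {y, w3, P 2 1}" "a' \<notin> {y, w, P 2 3}"
      using tv ynear[of t] ynear[of a'] va w3t adj_irrefl by auto
    have V: "y \<in> V" "a \<in> V" "c \<in> V" "t \<in> V" "a' \<in> V" using vy va cv tv adj_V2 by blast+
    have na: "t \<parallel> a" "a' \<parallel> c" "y \<parallel> a" "y \<parallel> c"
    proof -
      have "t \<noteq> a" using tv aa' adj_sym by blast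
      then show "t \<parallel> a" using V ta adj_sym by (auto simp: nadj_def)
      have "a' \<noteq> c" using cv aa' by blast
      then show "a' \<parallel> c" using V a'c adj_sym by (auto simp: nadj_def)
      show "y \<parallel> a" "y \<parallel> c" using V ya by (auto simp: nadj_def)
    qed
    \<comment> \<open>The point w3 lies on the line of a and y and is adjacent to t, which lifts the
      count above its default n. Read relative to the line of a and t, the same count makes y
      adjacent to a further point of that line. The next count treats c, w and a' in the same
      way.\<close>
    have "int (card (N t \<inter> (N a \<inter> N y))) \<ge> n + 1"
      by (rule line_count_ge[OF Lya na(1) off(1)]) (use ynear[of t] tv w3t in auto)
    moreover have "N t \<inter> (N a \<inter> N y) = N y \<inter> (N a \<inter> N t)" by blast
    ultimately have cnt1: "int (card (N y \<inter> (N a \<inter> N t))) \<ge> n + 1" by simp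
    have "int (card (N a' \<inter> (N c \<inter> N y))) \<ge> n + 1"
      by (rule line_count_ge[OF Lyc na(2) off(2)]) (use ynear[of a'] va in auto)
    moreover have "N a' \<inter> (N c \<inter> N y) = N y \<inter> (N c \<inter> N a')" by blast
    ultimately have cnt2: "int (card (N y \<inter> (N c \<inter> N a'))) \<ge> n + 1" by simp
    obtain Q where Q: "grid Q" "Q 0 0 = a" "Q 1 1 = a'" "Q 2 2 = g" "Q 3 3 = g'" "Q 1 0 = v"
      using grid_ex[OF L2, of v] va adj_sym by blast
    note QA = grid_adj[OF Q(1)]
    have QK: "K4 a v (Q 2 0) (Q 3 0)" "K4 v a' (Q 1 2) (Q 1 3)"
      using grid_K4[OF Q(1), of 0 1 2 3 0] grid_K4[OF Q(1), of 0 1 2 3 1] unfolding Q(2,3,6)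
      by (simp_all add: K4_def adj_commute)
    have "\<not> Q 3 0 \<sim> Q 2 2" using QA[of 3 0 2 2] by auto
    moreover have "b = Q 2 0 \<or> b = Q 3 0" using K4_common[OF QK(1)] b adj_sym by blast
    ultimately have Q20: "Q 2 0 = b" using b(4) Q(4) adj_sym by metis
    have "a \<sim> Q 3 0" "v \<sim> Q 3 0" "Q 2 0 \<sim> Q 3 0" using QK(1) by (simp_all add: K4_def)
    then have "Q 3 0 \<sim> v" "Q 3 0 \<sim> a" "Q 3 0 \<noteq> b" using Q20 adj_neq adj_sym by auto
    then have Q30: "Q 3 0 = c" using K4_common[OF K] by blast
    have "\<not> Q 1 3 \<sim> Q 2 2" using QA[of 1 3 2 2] by auto
    moreover have "b' = Q 1 2 \<or> b' = Q 1 3" using K4_common[OF QK(2)] b' adj_sym by blast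
    ultimately have Q12: "Q 1 2 = b'" using b'(4) Q(4) adj_sym by metis
    have "v \<sim> Q 1 3" "a' \<sim> Q 1 3" "Q 1 2 \<sim> Q 1 3" using QK(2) by (simp_all add: K4_def)
    then have "Q 1 3 \<sim> v" "Q 1 3 \<sim> a'" "Q 1 3 \<noteq> b'" using Q12 adj_neq adj_sym by auto
    then have Q13: "Q 1 3 = t" using K4_common[OF t] by blast
    have "L4 (Q 0 0) (Q 1 3) (Q 3 2) (Q 2 1)" "L4 (Q 1 1) (Q 3 0) (Q 0 2) (Q 2 3)"
      "L4 (Q 3 3) (Q 1 0) (Q 0 2) (Q 2 1)"
      by (rule grid_line3[OF Q(1)]; simp)+
    then have M: "L4 a t (Q 3 2) (Q 2 1)" "L4 c a' (Q 0 2) (Q 2 3)" "L4 g' v (Q 0 2) (Q 2 1)"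
      unfolding Q(2,3,5,6) Q30 Q13 using L4_perm(1) by blast+
    have M4: "L4 v (Q 0 1) (Q 2 3) (Q 3 2)"
      using grid_line2[OF Q(1), of 1 0 2 3] unfolding Q(6) by simp
    have nv: "\<not> v \<sim> Q 3 2" "\<not> v \<sim> Q 2 1" "\<not> v \<sim> Q 0 2" "\<not> v \<sim> Q 2 3"
      using QA[of 1 0 3 2] QA[of 1 0 2 1] QA[of 1 0 0 2] QA[of 1 0 2 3] unfolding Q(6) by auto
    have "y \<notin> {t, Q 3 2, Q 2 1}" "y \<notin> {a', Q 0 2, Q 2 3}"
      using vy nv ynear[of t] ynear[of a'] tv va by auto
    \<comment> \<open>Besides v, the vertex y is now adjacent to two points of the grid Q. Each of
      the four combinations either puts y into a clique of Q or makes it adjacent to three points of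
      a line.\<close>
    then have "y \<sim> Q 3 2 \<or> y \<sim> Q 2 1" "y \<sim> Q 0 2 \<or> y \<sim> Q 2 3"
      using line_count[OF M(1) na(3)] line_count[OF M(2) na(4)] cnt1 cnt2 ynear[of t] ynear[of a'] tv va
      by (auto simp: of_bool_def adj_commute split: if_splits)
    then consider "y \<sim> Q 3 2" "y \<sim> Q 0 2" | "y \<sim> Q 3 2" "y \<sim> Q 2 3"
      | "y \<sim> Q 2 1" "y \<sim> Q 0 2" | "y \<sim> Q 2 1" "y \<sim> Q 2 3" by blast
    then show False
    proof cases
      case 1
      have "K4 (Q 0 2) (Q 3 2) (Q 1 2) (Q 2 2)" using grid_K4(1)[OF Q(1), of 0 3 1 2 2] by simp
      then have "y = Q 1 2 \<or> y = Q 2 2" using K4_common 1 by blast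
      moreover have "y \<noteq> Q 1 2" using ynear[of b'] b' Q12 by blast
      moreover have "y \<noteq> Q 2 2" using QA[of 1 0 2 2] vy Q(6) by auto
      ultimately show False by blast
    next
      case 2
      then show False using L4_no_common(3)[OF M4, of y] vy adj_sym by blast
    next
      case 3
      then show False using L4_no_common(4)[OF M(3), of y] vy adj_sym by blast
    next
      case 4
      have "K4 (Q 2 1) (Q 2 3) (Q 2 0) (Q 2 2)" using grid_K4(2)[OF Q(1), of 1 3 0 2 2] by simp
      then have "y = Q 2 0 \<or> y = Q 2 2" using K4_common 4 by blast
      moreover have "y \<noteq> Q 2 2" using QA[of 1 0 2 2] vy Q(6) by auto
      ultimately show False using ya(5) Q20 by blast
    qed
  qed
qed


section \<open>Rotations\<close>

lemma L4_rot: "L4 v a b c \<Longrightarrow> L4 v b c a" "L4 v a b c \<Longrightarrow> L4 v c a b"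
  using L4_perm(3)[OF L4_perm(2)] L4_perm(2)[OF L4_perm(3)] by blast+

lemma K4_rot: "K4 v a b c \<Longrightarrow> K4 v b c a" "K4 v a b c \<Longrightarrow> K4 v c a b"
  using K4_perm(3)[OF K4_perm(2)] K4_perm(2)[OF K4_perm(3)] by blast+

text \<open>By \<open>corner\<close>, a line through v whose second point is adjacent to both a and
  a' matches the other clique points in the way opposite to the line of a and a'. There are only two
  ways, so the lines of y and of z agree.\<close>

lemma match:
  assumes y: "L4 v y y2 y3" and z: "L4 v z z2 z3" and aa: "\<not> a \<sim> a'" "a \<noteq> a'"
    and a: "v \<sim> a" "y \<sim> a" "z \<sim> a" and a': "v \<sim> a'" "y \<sim> a'" "z \<sim> a'"
    and b: "v \<sim> b" "a \<sim> b" "y2 \<sim> b" "z2 \<sim> b" and b': "v \<sim> b'" "a' \<sim> b'" "y2 \<sim> b'"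
  shows "z2 \<sim> b'"
proof (rule ccontr)
  assume nz: "\<not> z2 \<sim> b'"
  have V: "a \<parallel> a'" using a a' adj_V2 aa by (auto simp: nadj_def)
  obtain g g' where L: "L4 a a' g g'" using L4_ex[OF V] .
  have av: "a \<sim> v" "a' \<sim> v" using a a' adj_sym by blast+
  obtain p q where pq: "K4 a v p q" "g \<sim> p" "g' \<sim> q" using L4_K4_ex[OF L av] .
  have "b = p \<or> b = q" using K4_common[OF pq(1)] b adj_sym by blast
  then obtain h h' where h: "L4 a a' h h'" "h \<sim> b" using L pq L4_perm(3) by blast
  have L': "L4 a' a h h'" using h(1) L4_perm(1) by blast
  obtain p q where pq: "K4 a' v p q" "h \<sim> p" "h' \<sim> q" using L4_K4_ex[OF L' av(2,1)] .
  have pv: "v \<sim> p" "a' \<sim> p" "v \<sim> q" "a' \<sim> q" using pq(1) by (simp_all add: K4_def)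
  have "\<not> h \<sim> b'" using corner[OF y h(1) a(1,2) a'(1,2) b(1,2,3) h(2) b'] by blast
  then have "b' \<noteq> p" using pq by blast
  moreover have "b' = p \<or> b' = q" using K4_common[OF pq(1)] b' adj_sym by blast
  ultimately have "b' = q" by blast
  moreover have K: "K4 v a' p q" using pq(1) K4_perm(1) by blast
  moreover have "indep v z z2" using z by (simp add: L4_def)
  ultimately have "z2 \<sim> p" using indep_mate[OF _ K a'(3)] nz by blast
  then show False using corner[OF z h(1) a(1,3) a'(1,3) b(1,2,4) h(2) pv(1,2) _ pq(2)] by blast
qed

lemma L4_K4_other:
  assumes L: "L4 v p q r" and K: "K4 v x y z" and "p \<sim> x"
  shows "q \<sim> y \<and> r \<sim> z \<or> q \<sim> z \<and> r \<sim> y"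
proof -
  have "indep v p q" using L by (simp add: L4_def)
  then have "q \<sim> y \<longleftrightarrow> \<not> q \<sim> z" using indep_mate K assms(3) by blast
  then show ?thesis using L4_K4[OF L K assms(3)] L4_K4[OF L K4_perm(3)[OF K] assms(3)] by blast
qed

lemma L4_adj_excl:
  assumes "L4 v p q r" "v \<sim> x"
  shows "\<not> (p \<sim> x \<and> q \<sim> x)" "\<not> (p \<sim> x \<and> r \<sim> x)" "\<not> (q \<sim> x \<and> r \<sim> x)"
  using assms by (auto simp: L4_def indep_def)

text \<open>Lines supported by two cliques \<open>k\<close>, \<open>q\<close> at \<open>v\<close> induce bijections between them that agree up to
  rotation.\<close>

lemma rotation_agree:
  assumes p: "L4 v p1 p2 p3" and z: "L4 v z1 z2 z3"
    and k: "K4 v k1 k2 k3" and q: "K4 v q1 q2 q3" and kq: "\<not> k1 \<sim> q1" "k1 \<noteq> q1"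
    and pk: "p1 \<sim> k1" "p2 \<sim> k2" "p3 \<sim> k3" and zk: "z1 \<sim> k1" "z2 \<sim> k2" "z3 \<sim> k3"
    and pq: "p1 \<sim> q1" "p2 \<sim> q2" "p3 \<sim> q3"
  shows "z1 \<sim> q1 \<Longrightarrow> z2 \<sim> q2 \<and> z3 \<sim> q3" "z1 \<sim> q2 \<Longrightarrow> z2 \<sim> q3 \<and> z3 \<sim> q1" "z1 \<sim> q3 \<Longrightarrow> z2 \<sim> q1 \<and> z3 \<sim> q2"
proof -
  have vk: "v \<sim> k1" "v \<sim> k2" "v \<sim> k3" "k1 \<sim> k2" "k1 \<sim> k3" "k2 \<sim> k3" using k by (auto simp: K4_def)
  have vq: "v \<sim> q1" "v \<sim> q2" "v \<sim> q3" "q1 \<sim> q2" "q1 \<sim> q3" "q2 \<sim> q3" using q by (auto simp: K4_def)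
  have sep: "\<not> s \<sim> t \<and> s \<noteq> t" if "s \<in> {k1, k2, k3}" "t \<in> {q1, q2, q3}" for s t
  proof (rule ccontr)
    assume st: "\<not> (\<not> s \<sim> t \<and> s \<noteq> t)"
    have vs: "v \<sim> s" "s = k1 \<or> k1 \<sim> s" "v \<sim> t" "t = q1 \<or> t \<sim> q1" using that vk vq adj_sym by auto
    have "k1 \<sim> t \<or> k1 = t" using same_clique_trans[of v k1 s t] st vs vk by blast
    then show False using same_clique_trans[of v k1 t q1] vs vq vk kq by blast
  qed
  have s: "\<not> k1 \<sim> q1" "k1 \<noteq> q1" "\<not> k2 \<sim> q2" "k2 \<noteq> q2" "\<not> k3 \<sim> q3" "k3 \<noteq> q3"
    using sep[of k1 q1] sep[of k2 q2] sep[of k3 q3] by blast+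
  have zr: "L4 v z2 z3 z1" "L4 v z3 z1 z2" and pr: "L4 v p2 p3 p1" "L4 v p3 p1 p2"
    using z[THEN L4_rot(1)] z[THEN L4_rot(2)] p[THEN L4_rot(1)] p[THEN L4_rot(2)] by auto
  note zq = L4_K4_other[OF z]
  have qr: "K4 v q2 q1 q3" "K4 v q3 q1 q2" using K4_perm(2)[OF q] K4_rot(2)[OF q] by auto
  { assume z1: "z1 \<sim> q1"
    have "z2 \<sim> q2"
      by (rule match[OF p z s(1,2) vk(1) pk(1) zk(1) vq(1) pq(1) z1 vk(2,4) pk(2) zk(2) vq(2,4) pq(2)])
    then show "z2 \<sim> q2 \<and> z3 \<sim> q3" using zq[OF q z1] L4_adj_excl(3)[OF z vq(2)] by blast }
  \<comment> \<open>The alternative to the rotation is a transposition. It fixes one label, where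
    \<open>match\<close> applies and would fix the other labels as well. The last case is
    alike.\<close>
  { assume z1: "z1 \<sim> q2"
    show "z2 \<sim> q3 \<and> z3 \<sim> q1"
    proof (rule ccontr)
      assume "\<not> ?thesis"
      then have z3: "z3 \<sim> q3" using zq[OF qr(1) z1] by blast
      have "z1 \<sim> q1"
        by (rule match[OF pr(2) zr(2) s(5,6) vk(3) pk(3) zk(3) vq(3) pq(3) z3 vk(1) adj_sym[OF vk(5)] pk(1) zk(1) vq(1) adj_sym[OF vq(5)] pq(1)])
      then show False using coclique[of v z1 q1 q2] L4_nadj(1)[OF z] vq z1 by blast
    qed }
  { assume z1: "z1 \<sim> q3"
    show "z2 \<sim> q1 \<and> z3 \<sim> q2"
    proof (rule ccontr)
      assume "\<not> ?thesis"
      then have z2: "z2 \<sim> q2" using zq[OF qr(2) z1] by blast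
      have "z3 \<sim> q3"
        by (rule match[OF pr(1) zr(1) s(3,4) vk(2) pk(2) zk(2) vq(2) pq(2) z2 vk(3,6) pk(3) zk(3) vq(3,6) pq(3)])
      then show False using L4_adj_excl(2)[OF z vq(3)] z1 by blast
    qed }
qed

section \<open>Transporting the orientation of one clique at v to all others\<close>

lemma common_ex:
  assumes "v \<parallel> u" "finite F" "card F \<le> 11"
  obtains x where "v \<sim> x" "u \<sim> x" "x \<notin> F"
proof -
  have "n * (n + 1) \<ge> 3 * 4" using n_ge_3 by (intro mult_mono) auto
  then have "card (N v \<inter> N u) > card F" using card_common_nadj[OF assms(1)] assms(3) by linarith
  then have "\<not> N v \<inter> N u \<subseteq> F" using card_mono[OF assms(2)] by (meson not_less)
  then obtain x where "x \<in> N v \<inter> N u" "x \<notin> F" by blast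
  then show thesis using that[of x] by auto
qed

text \<open>Supplies a line through v that meets the neighbourhoods of two given cliques at
  v.\<close>

lemma common_nbr_ex:
  assumes "v \<sim> a" "v \<sim> x" "a \<noteq> x" "\<not> a \<sim> x"
  obtains y where "y \<parallel> v" "a \<sim> y" "x \<sim> y"
proof -
  have "a \<parallel> x" using assms adj_V2 by (auto simp: nadj_def)
  then obtain y where y: "a \<sim> y" "x \<sim> y" "y \<notin> {v}" using common_ex[of a x "{v}"] by auto
  moreover have "\<not> v \<sim> y" using same_clique_trans[of v a y x] assms y adj_sym by blast
  ultimately have "y \<parallel> v" using adj_V2 adj_V assms adj_sym by (auto simp: nadj_def)
  then show thesis using that y by blast
qed

text \<open>\<open>turn v a b c x x'\<close>: the orientation \<open>a \<rightarrow> b \<rightarrow> c\<close> of a clique at \<open>v\<close>, transported along lines through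
  \<open>v\<close> to the clique of \<open>x\<close>, moves \<open>x\<close> to \<open>x'\<close>.\<close>

definition turn :: "'a \<Rightarrow> 'a \<Rightarrow> 'a \<Rightarrow> 'a \<Rightarrow> 'a \<Rightarrow> 'a \<Rightarrow> bool" where
  "turn v a b c x x' \<longleftrightarrow> v \<sim> x \<and> v \<sim> x' \<and> x \<sim> x' \<and>
    (\<exists>p q r. L4 v p q r \<and> p \<sim> a \<and> q \<sim> b \<and> r \<sim> c \<and> (p \<sim> x \<and> q \<sim> x' \<or> q \<sim> x \<and> r \<sim> x' \<or> r \<sim> x \<and> p \<sim> x'))"

text \<open>Two lines labelled by the base clique may induce different bijections to the clique of
  x, but by \<open>rotation_agree\<close> these differ by a rotation. Hence the line chosen in
  \<open>turn\<close> is immaterial.\<close>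

lemma turn_line:
  assumes K: "K4 v a b c" and t: "turn v a b c x x'"
    and L: "L4 v p q r" "p \<sim> a" "q \<sim> b" "r \<sim> c"
  shows "p \<sim> x \<Longrightarrow> q \<sim> x'" "q \<sim> x \<Longrightarrow> r \<sim> x'" "r \<sim> x \<Longrightarrow> p \<sim> x'"
proof -
  have v: "v \<sim> x" "v \<sim> x'" "x \<sim> x'" using t by (auto simp: turn_def)
  obtain l m h where l: "L4 v l m h" "l \<sim> a" "m \<sim> b" "h \<sim> c"
    "l \<sim> x \<and> m \<sim> x' \<or> m \<sim> x \<and> h \<sim> x' \<or> h \<sim> x \<and> l \<sim> x'"
    using t unfolding turn_def by blast
  obtain x'' where x'': "K4 v x x' x''"
  proof -
    obtain s t where "K4 v x s t" using K4_ex[OF v(1)] .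
    moreover then have "x' = s \<or> x' = t" using K4_common v adj_sym by blast
    ultimately show thesis using that K4_perm(3) by blast
  qed
  have va: "v \<sim> a" "v \<sim> b" "v \<sim> c" using K by (auto simp: K4_def)
  \<comment> \<open>A cyclic relabelling of the clique of x after which l, m, h are adjacent to its
    points in this order.\<close>
  define xs where "xs = (if l \<sim> x then (x, x', x'') else if m \<sim> x then (x'', x, x') else (x', x'', x))"
  obtain x1 x2 x3 where xs: "xs = (x1, x2, x3)" by (cases xs) auto
  have lx: "l \<sim> x1 \<and> m \<sim> x2 \<and> h \<sim> x3 \<and> K4 v x1 x2 x3"
  proof -
    have e: "\<not> (l \<sim> x \<and> m \<sim> x)" "\<not> (l \<sim> x \<and> h \<sim> x)" "\<not> (m \<sim> x \<and> h \<sim> x)"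
      using L4_adj_excl[OF l(1) v(1)] .
    have Kr: "K4 v x'' x x'" "K4 v x' x'' x" using K4_rot[OF x''] by auto
    consider "l \<sim> x" "m \<sim> x'" | "m \<sim> x" "h \<sim> x'" | "h \<sim> x" "l \<sim> x'" using l(5) by blast
    then show ?thesis
    proof cases
      case 1
      then have "h \<sim> x''" using L4_K4[OF l(1) x''] by blast
      then show ?thesis using 1 xs x'' by (simp add: xs_def)
    next
      case 2
      have "l \<sim> x''" using L4_K4[OF L4_rot(1)[OF l(1)] x''] 2 by blast
      then show ?thesis using 2 e xs Kr by (auto simp: xs_def)
    next
      case 3
      have "m \<sim> x''" using L4_K4[OF L4_rot(2)[OF l(1)] x''] 3 by blast
      then show ?thesis using 3 e xs Kr by (auto simp: xs_def)
    qed
  qed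
  have one: "x = x1 \<and> x' = x2 \<or> x = x2 \<and> x' = x3 \<or> x = x3 \<and> x' = x1"
    using xs by (auto simp: xs_def split: if_splits)
  have vx: "v \<sim> x1" "v \<sim> x2" "v \<sim> x3" using lx by (auto simp: K4_def)
  have main: "(p \<sim> x1 \<longrightarrow> q \<sim> x2 \<and> r \<sim> x3) \<and> (p \<sim> x2 \<longrightarrow> q \<sim> x3 \<and> r \<sim> x1) \<and> (p \<sim> x3 \<longrightarrow> q \<sim> x1 \<and> r \<sim> x2)"
  proof (cases "a = x1 \<or> a \<sim> x1")
    case False
    then show ?thesis using rotation_agree[OF l(1) L(1) K _ _ _ l(2,3,4) L(2,3,4), of x1 x2 x3] lx by blast
  next
    case True
    have Kx: "K4 v x1 x2 x3" using lx by blast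
    have s: "y = x1 \<or> y = x2 \<or> y = x3" if "v \<sim> y" "y \<sim> a \<or> y = a" for y
    proof -
      have "y = x1 \<or> y \<sim> x1"
        using same_clique_trans[of v y a x1] True that va vx by blast
      then show ?thesis using K4_common[OF Kx] that adj_sym by blast
    qed
    have un: "y = y'" if "v \<sim> y" "v \<sim> y'" "t \<sim> y" "t \<sim> y'" "y = x1 \<or> y = x2 \<or> y = x3" "y' = x1 \<or> y' = x2 \<or> y' = x3"
        "v \<parallel> t" for y y' t
    proof (rule ccontr)
      assume "y \<noteq> y'"
      then have "y \<sim> y'" using that Kx adj_sym unfolding K4_def by auto
      then show False using coclique[OF that(7) that(1,3,2,4)] by blast
    qed
    have ab: "b \<sim> a" "c \<sim> a" using K adj_sym by (auto simp: K4_def)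
    have "a = x1" using un[OF va(1) vx(1) l(2)] lx s[OF va(1)] L4_nadj(1)[OF l(1)] by blast
    moreover have "b = x2" using un[OF va(2) vx(2) l(3)] lx s[OF va(2)] ab L4_nadj(2)[OF l(1)] by blast
    moreover have "c = x3" using un[OF va(3) vx(3) l(4)] lx s[OF va(3)] ab L4_nadj(3)[OF l(1)] by blast
    ultimately have pq: "p \<sim> x1" "q \<sim> x2" "r \<sim> x3" using L by auto
    then have "\<not> p \<sim> x2" "\<not> p \<sim> x3" using L4_adj_excl[OF L(1)] vx by blast+
    then show ?thesis using pq by blast
  qed
  have pp: "p \<sim> x1 \<or> p \<sim> x2 \<or> p \<sim> x3" if "p \<sim> y \<or> q \<sim> y \<or> r \<sim> y" "y = x1 \<or> y = x2 \<or> y = x3" for y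
  proof -
    have Kx: "K4 v x1 x2 x3" "K4 v x2 x3 x1" "K4 v x3 x1 x2" using lx K4_rot[of v x1 x2 x3] by auto
    have "p \<sim> y2 \<or> p \<sim> y3" if "K4 v y y2 y3" "q \<sim> y \<or> r \<sim> y" for y y2 y3
      using that L4_K4_other[OF L4_rot(1)[OF L(1)] that(1)] L4_K4_other[OF L4_rot(2)[OF L(1)] that(1)] by blast
    then show ?thesis using Kx that by blast
  qed
  have ex: "\<And>y. y \<in> {x1, x2, x3} \<Longrightarrow> \<not> (p \<sim> y \<and> q \<sim> y) \<and> \<not> (p \<sim> y \<and> r \<sim> y) \<and> \<not> (q \<sim> y \<and> r \<sim> y)"
    using L4_adj_excl[OF L(1)] vx by blast
  show "p \<sim> x \<Longrightarrow> q \<sim> x'" using one main by auto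
  show "q \<sim> x \<Longrightarrow> r \<sim> x'" using one main pp[of x] ex[of x1] ex[of x2] ex[of x3] by auto
  show "r \<sim> x \<Longrightarrow> p \<sim> x'" using one main pp[of x] ex[of x1] ex[of x2] ex[of x3] by auto
qed


lemma far_nbr_ex:
  assumes "v \<sim> x"
  obtains y where "y \<parallel> v" "y \<sim> x"
proof -
  have xV: "x \<in> V" "v \<in> V" using assms adj_V adj_V2 by blast+
  have "n\<^sup>2 + 3 * n - 1 \<ge> 0 + 3 * 3 - 1" using n_ge_3 by (intro diff_mono add_mono) auto
  then have "n * (n\<^sup>2 + 3 * n - 1) \<ge> 3 * 8" using n_ge_3 by (intro mult_mono) auto
  then have "card (N x) > 3" using card_N[OF xV(1)] by linarith
  moreover have "card (insert v (N x \<inter> N v)) \<le> 3"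
    using card_common_adj[of x v] assms adj_sym card_insert_le_m1[of 3 "N x \<inter> N v" v] by simp
  ultimately have "\<not> N x \<subseteq> insert v (N x \<inter> N v)"
    using card_mono[of "insert v (N x \<inter> N v)" "N x"] by auto
  then obtain y where "y \<in> N x" "y \<notin> insert v (N x \<inter> N v)" by blast
  then have "x \<sim> y" "y \<noteq> v" "\<not> v \<sim> y" by auto
  then show thesis using that[of y] xV adj_V2 adj_sym unfolding nadj_def by blast
qed

lemma labelled_line:
  assumes K: "K4 v a b c" and y: "y \<parallel> v" "k \<in> {a, b, c}" "y \<sim> k"
  obtains p q r where "L4 v p q r" "p \<sim> a" "q \<sim> b" "r \<sim> c" "y \<in> {p, q, r}"
proof -
  have "v \<parallel> y" using y nadj_commute by blast
  then obtain s t where L: "L4 v y s t" using L4_ex by blast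
  note R = L4_rot[OF L] L4_rot[OF L4_perm(3)[OF L]] L4_perm(3)[OF L]
  have k: "y \<sim> a \<or> y \<sim> b \<or> y \<sim> c" using y by blast
  then show thesis
  proof (elim disjE)
    assume "y \<sim> a"
    then show thesis using L4_K4_other[OF L K] that[OF L] that[OF R(5)] by blast
  next
    assume y: "y \<sim> b"
    have K': "K4 v b c a" using K4_rot(1)[OF K] .
    show thesis using L4_K4_other[OF L K' y] y that[OF R(2)] that[OF R(4)] by blast
  next
    assume y: "y \<sim> c"
    have K': "K4 v c a b" using K4_rot(2)[OF K] .
    show thesis using L4_K4_other[OF L K' y] y that[OF R(1)] that[OF R(3)] by blast
  qed
qed

lemma turnD: "turn v a b c x x' \<Longrightarrow> v \<sim> x \<and> v \<sim> x' \<and> x \<sim> x'"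
  by (simp add: turn_def)

lemma turn_cycle:
  assumes K: "K4 v a b c" and t: "turn v a b c x x'"
  obtains x'' where "K4 v x x' x''" "turn v a b c x' x''" "turn v a b c x'' x"
proof -
  have v: "v \<sim> x" "v \<sim> x'" "x \<sim> x'" using turnD[OF t] by auto
  obtain x'' where x'': "K4 v x x' x''"
  proof -
    obtain s t where "K4 v x s t" using K4_ex[OF v(1)] .
    moreover then have "x' = s \<or> x' = t" using K4_common v adj_sym by blast
    ultimately show thesis using that K4_perm(3) by blast
  qed
  have w: "v \<sim> x''" "x' \<sim> x''" "x'' \<sim> x" using x'' adj_sym by (auto simp: K4_def)
  obtain p q r where l: "L4 v p q r" "p \<sim> a" "q \<sim> b" "r \<sim> c"
    "p \<sim> x \<and> q \<sim> x' \<or> q \<sim> x \<and> r \<sim> x' \<or> r \<sim> x \<and> p \<sim> x'"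
    using t unfolding turn_def by blast
  have "p \<sim> x \<and> q \<sim> x' \<and> r \<sim> x'' \<or> q \<sim> x \<and> r \<sim> x' \<and> p \<sim> x'' \<or> r \<sim> x \<and> p \<sim> x' \<and> q \<sim> x''"
    using l(5) L4_K4[OF l(1) x''] L4_K4[OF L4_rot(1)[OF l(1)] x''] L4_K4[OF L4_rot(2)[OF l(1)] x''] by blast
  then have "turn v a b c x' x''" "turn v a b c x'' x"
    unfolding turn_def using v w l by blast+
  then show thesis using that x'' by blast
qed

lemma same_clique_unique:
  assumes "v \<sim> x" "v \<sim> y" "v \<sim> z" "x \<sim> y" "x \<sim> z" "p \<parallel> v" "p \<sim> y" "p \<sim> z"
  shows "y = z"
proof (rule ccontr)
  assume "y \<noteq> z"
  then have "y \<sim> z" using no_diamond[of v x y z] assms by blast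
  then show False using coclique[OF assms(6), of y z] assms by blast
qed

lemma turn_unique:
  assumes K: "K4 v a b c" and t: "turn v a b c x x'" "turn v a b c x x''"
  shows "x' = x''"
proof -
  have v: "v \<sim> x" "v \<sim> x'" "x \<sim> x'" "v \<sim> x''" "x \<sim> x''" using t[THEN turnD] by auto
  obtain p q r where l: "L4 v p q r" "p \<sim> a" "q \<sim> b" "r \<sim> c"
    "p \<sim> x \<and> q \<sim> x'' \<or> q \<sim> x \<and> r \<sim> x'' \<or> r \<sim> x \<and> p \<sim> x''"
    using t(2) unfolding turn_def by blast
  have n: "p \<parallel> v" "q \<parallel> v" "r \<parallel> v" using L4_nadj(1,2,3)[OF l(1)] nadj_commute by blast+
  show ?thesis
    using l(5) turn_line[OF K t(1) l(1-4)] same_clique_unique[OF v(1,2,4,3,5)] n by blast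
qed

lemma turn_ex:
  assumes K: "K4 v a b c" and x: "v \<sim> x"
  obtains x' where "turn v a b c x x'"
proof -
  have va: "v \<sim> a" "a \<sim> b" "a \<sim> c" using K by (auto simp: K4_def)
  obtain y k where y: "y \<parallel> v" "k \<in> {a, b, c}" "y \<sim> k" "y \<sim> x"
  proof (cases "x \<in> {a, b, c}")
    case True
    then show ?thesis using far_nbr_ex[OF x] that by metis
  next
    case False
    have "\<not> a \<sim> x" using K4_common[OF K, of x] x False adj_sym by blast
    then obtain y where "y \<parallel> v" "a \<sim> y" "x \<sim> y" using common_nbr_ex[OF va(1) x] False by blast
    then show ?thesis using that adj_sym by blast
  qed
  obtain p q r where l: "L4 v p q r" "p \<sim> a" "q \<sim> b" "r \<sim> c" "y \<in> {p, q, r}"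
    using labelled_line[OF K y(1-3)] .
  obtain s t where Ks: "K4 v x s t" using K4_ex[OF x] .
  have vs: "v \<sim> s" "v \<sim> t" "x \<sim> s" "x \<sim> t" using Ks by (auto simp: K4_def)
  have "p \<sim> x \<or> q \<sim> x \<or> r \<sim> x" using l y by blast
  then have "\<exists>x'. (x' = s \<or> x' = t) \<and> (p \<sim> x \<and> q \<sim> x' \<or> q \<sim> x \<and> r \<sim> x' \<or> r \<sim> x \<and> p \<sim> x')"
    using L4_K4_other[OF l(1) Ks] L4_K4_other[OF L4_rot(1)[OF l(1)] Ks] L4_K4_other[OF L4_rot(2)[OF l(1)] Ks]
    by blast
  then obtain x' where x': "x' = s \<or> x' = t" "p \<sim> x \<and> q \<sim> x' \<or> q \<sim> x \<and> r \<sim> x' \<or> r \<sim> x \<and> p \<sim> x'" by blast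
  then have "v \<sim> x'" "x \<sim> x'" using vs by auto
  then have "turn v a b c x x'" unfolding turn_def using x l(1-4) x'(2) by blast
  then show thesis by (rule that)
qed

lemma turn_base:
  assumes K: "K4 v a b c"
  shows "turn v a b c a b"
proof -
  have va: "v \<sim> a" "a \<sim> b" "v \<sim> b" using K by (auto simp: K4_def)
  obtain y where y: "y \<parallel> v" "y \<sim> a" using far_nbr_ex[OF va(1)] .
  obtain p q r where l: "L4 v p q r" "p \<sim> a" "q \<sim> b" "r \<sim> c" using labelled_line[OF K y(1) _ y(2)] by blast
  then show ?thesis unfolding turn_def using va by blast
qed

text \<open>The rotation of y along its line is read off at one clique and must not depend on it. If
  y has no neighbour in the base clique, its line carries no labels; a common neighbour z of a, x
  and t then provides a labelled line meeting all three cliques, and \<open>match\<close> compares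
  the two lines at x and t.\<close>

lemma turn_compat:
  assumes K: "K4 v a b c" and L: "L4 v y y2 y3" and x: "v \<sim> x" "y \<sim> x" "turn v a b c x x'" "y2 \<sim> x'"
    and t: "v \<sim> t" "y \<sim> t" "turn v a b c t t'"
  shows "y2 \<sim> t'"
proof (cases "\<exists>k\<in>{a, b, c}. y \<sim> k")
  case True
  have yv: "y \<parallel> v" using L4_nadj[OF L] nadj_commute by blast
  obtain p q r where l: "L4 v p q r" "p \<sim> a" "q \<sim> b" "r \<sim> c" "y \<in> {p, q, r}"
    using True labelled_line[OF K yv] by metis
  have lx: "L4 v q r p" "L4 v r p q" using L4_rot[OF l(1)] by auto
  have vx': "v \<sim> x'" using turnD[OF x(3)] by blast
  have main: "y2 \<sim> t'" if "L4 v y g h" "g \<sim> x'" "g \<sim> t'" for g h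
  proof -
    have "y2 = g \<or> y2 = h" using L4_unique2[OF that(1) L] by blast
    moreover have "\<not> h \<sim> x'" using L4_adj_excl(3)[OF that(1) vx'] that by blast
    ultimately show ?thesis using that x(4) by blast
  qed
  show ?thesis
    using l(5) main[of q r] main[of r p] main[of p q] l(1) lx x(2) t(2)
      turn_line[OF K x(3) l(1-4)] turn_line[OF K t(3) l(1-4)] by blast
next
  case False
  have yv: "y \<parallel> v" "v \<parallel> y" using L4_nadj[OF L] nadj_commute by blast+
  show ?thesis
  proof (cases "x = t")
    case True
    then show ?thesis using turn_unique[OF K x(3)] t x by blast
  next
    case xt: False
    have va: "v \<sim> a" using K by (simp add: K4_def)
    have nxt: "\<not> x \<sim> t" using coclique[OF yv(1)] x t by blast
    have na: "a \<noteq> s \<and> \<not> a \<sim> s" if "v \<sim> s" "y \<sim> s" for s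
      using K4_common[OF K, of s] that False adj_sym by blast
    have vV: "a \<parallel> x" "t \<parallel> a" using na[OF x(1,2)] na[OF t(1,2)] va x t adj_V2 adj_sym by (auto simp: nadj_def)
    obtain g g' where G: "L4 a x g g'" using L4_ex[OF vV(1)] .
    have "\<not> v \<sim> g" "\<not> v \<sim> g'" using L4_no_common(1,2)[OF G, of v] va x by blast+
    then have "t \<notin> {x, g, g'}" using t xt by auto
    \<comment> \<open>Relative to the line of a and x, the vertex t is not adjacent to x, so the
      count is at least n \<ge> 3 and some common neighbour differs from v.\<close>
    then have "int (card (N t \<inter> (N a \<inter> N x))) \<ge> n"
      using line_count[OF G vV(2)] nxt by simp
    then have "card (N t \<inter> (N a \<inter> N x)) > card {v}" using n_ge_3 by simp
    then have "\<not> N t \<inter> (N a \<inter> N x) \<subseteq> {v}" using card_mono[of "{v}" "N t \<inter> (N a \<inter> N x)"] by auto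
    then obtain z where "z \<in> N t \<inter> (N a \<inter> N x)" "z \<noteq> v" by blast
    then have z: "t \<sim> z" "a \<sim> z" "x \<sim> z" "z \<noteq> v" by auto
    have "\<not> v \<sim> z" using same_clique_trans[of v a z x] va x z na[OF x(1,2)] adj_sym by blast
    then have zv: "z \<parallel> v" using z va adj_V adj_V2 adj_sym by (auto simp: nadj_def)
    have zs: "z \<sim> a" "z \<sim> x" "z \<sim> t" using z adj_sym by auto
    obtain p q r where l: "L4 v p q r" "p \<sim> a" "q \<sim> b" "r \<sim> c" "z \<in> {p, q, r}"
      using labelled_line[OF K zv _ zs(1)] by blast
    have "z = p" using l L4_adj_excl(1,2)[OF l(1) va] zs(1) by blast
    then have q: "q \<sim> x'" "q \<sim> t'" using turn_line(1)[OF K x(3) l(1-4)] turn_line(1)[OF K t(3) l(1-4)] zs by blast+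
    have lz: "L4 v z q r" using l(1) \<open>z = p\<close> by simp
    have d: "v \<sim> x'" "x \<sim> x'" "v \<sim> t'" "t \<sim> t'" using turnD[OF x(3)] turnD[OF t(3)] by auto
    show ?thesis
      by (rule match[OF lz L nxt xt x(1) zs(2) x(2) t(1) zs(3) t(2) d(1,2) q(1) x(4) d(3,4) q(2)])
  qed
qed

section \<open>The rotation at v as an automorphism\<close>

definition rotates :: "'a \<Rightarrow> 'a \<Rightarrow> 'a \<Rightarrow> 'a \<Rightarrow> 'a \<Rightarrow> 'a \<Rightarrow> bool" where
  "rotates v a b c y y' \<longleftrightarrow> y = v \<and> y' = v \<and> v \<in> V \<or> turn v a b c y y' \<or>
    (\<exists>y3. L4 v y y' y3 \<and> (\<exists>x x'. v \<sim> x \<and> y \<sim> x \<and> turn v a b c x x' \<and> y' \<sim> x'))"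

lemma rotates_cases:
  assumes "rotates v a b c y y'"
  obtains "y = v" "y' = v" | "v \<sim> y" "turn v a b c y y'" |
    y3 x x' where "y \<parallel> v" "L4 v y y' y3" "v \<sim> x" "y \<sim> x" "turn v a b c x x'" "y' \<sim> x'"
  using assms turnD[of v a b c y y'] L4_nadj(1)[of v y y'] nadj_commute unfolding rotates_def by metis

lemma rotates_unique:
  assumes K: "K4 v a b c" and r: "rotates v a b c y y'" "rotates v a b c y y''"
  shows "y' = y''"
  using r(1)
proof (cases rule: rotates_cases)
  case 1
  show ?thesis using r(2) 1 by (cases rule: rotates_cases) (auto simp: adj_irrefl nadj_def)
next
  case 2
  show ?thesis using r(2)
  proof (cases rule: rotates_cases)
    case b: 2
    show ?thesis by (rule turn_unique[OF K 2(2) b(2)])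
  qed (use 2(1) adj_sym[OF 2(1)] in \<open>simp_all add: adj_irrefl nadj_def\<close>)
next
  case (3 y3 x x')
  show ?thesis using r(2)
  proof (cases rule: rotates_cases)
    case (3 z3 t t')
    have "y' \<sim> t'" by (rule turn_compat[OF K \<open>L4 v y y' y3\<close> \<open>v \<sim> x\<close> \<open>y \<sim> x\<close> \<open>turn v a b c x x'\<close> \<open>y' \<sim> x'\<close> 3(3-5)])
    moreover have "v \<sim> t'" using turnD[OF 3(5)] by blast
    ultimately have "y'' \<noteq> y3" using L4_adj_excl(3)[OF \<open>L4 v y y' y3\<close>] 3(6) by blast
    then show ?thesis using L4_unique2[OF \<open>L4 v y y' y3\<close> 3(2)] by blast
  qed (use nadj_not_adj[OF 3(1)] in auto)
qed

lemma rotates_ex: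
  assumes K: "K4 v a b c" and y: "y \<in> V"
  obtains y' where "rotates v a b c y y'"
proof -
  have vV: "v \<in> V" using K adj_V by (auto simp: K4_def)
  consider "y = v" | "v \<sim> y" | "v \<parallel> y" using y vV by (auto simp: nadj_def)
  then show thesis
  proof cases
    case 1 then show thesis using that vV by (auto simp: rotates_def)
  next
    case 2
    then obtain y' where "turn v a b c y y'" using turn_ex[OF K] by blast
    then show thesis using that by (auto simp: rotates_def)
  next
    case 3
    obtain y2 y3 where L: "L4 v y y2 y3" using L4_ex[OF 3] .
    obtain x where x: "v \<sim> x" "y \<sim> x" using common_ex[OF 3, of "{}"] by auto
    obtain x' where x': "turn v a b c x x'" using turn_ex[OF K x(1)] .
    obtain x'' where "K4 v x x' x''" using turn_cycle[OF K x'] .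
    then have "y2 \<sim> x' \<or> y3 \<sim> x'" using L4_K4_other[OF L _ x(2)] by blast
    then have "rotates v a b c y y2 \<or> rotates v a b c y y3"
      unfolding rotates_def using L L4_perm(3)[OF L] x x' by blast
    then show thesis using that by blast
  qed
qed

lemma rotates_cycle:
  assumes K: "K4 v a b c" and r: "rotates v a b c y y'"
  shows "\<exists>y''. rotates v a b c y' y'' \<and> rotates v a b c y'' y \<and> (v \<sim> y \<longrightarrow> K4 v y y' y'') \<and> (y \<parallel> v \<longrightarrow> L4 v y y' y'')"
  using r
proof (cases rule: rotates_cases)
  case 1
  then show ?thesis using r by (auto simp: adj_irrefl nadj_def)
next
  case 2
  obtain y'' where "K4 v y y' y''" "turn v a b c y' y''" "turn v a b c y'' y"
    using turn_cycle[OF K 2(2)] .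
  then show ?thesis using 2(1) adj_sym[OF 2(1)] by (auto simp: rotates_def nadj_def)
next
  case (3 y3 x x')
  obtain x'' where x'': "K4 v x x' x''" "turn v a b c x' x''" "turn v a b c x'' x"
    using turn_cycle[OF K 3(5)] .
  have "y3 \<sim> x''" using L4_K4[OF 3(2) x''(1) 3(4,6)] .
  have d: "v \<sim> x'" "v \<sim> x''" using turnD[OF x''(2)] by auto
  have "rotates v a b c y' y3"
    unfolding rotates_def using L4_rot(1)[OF 3(2)] d x''(2) 3(6) \<open>y3 \<sim> x''\<close> by blast
  moreover have "rotates v a b c y3 y"
    unfolding rotates_def using L4_rot(2)[OF 3(2)] d x''(3) 3(4) \<open>y3 \<sim> x''\<close> by blast
  ultimately show ?thesis using 3(2) nadj_not_adj[OF 3(1)] by blast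
qed

text \<open>The essential case is that y and z are both non-adjacent to v. Being adjacent, they have
  at most one common neighbour in N v; rotation does not increase this number, whereas non-adjacent
  y' and z' would have at least n.\<close>

lemma rotates_adj:
  assumes K: "K4 v a b c" and r: "rotates v a b c y y'" "rotates v a b c z z'" and yz: "y \<sim> z"
  shows "y' \<sim> z'"
proof -
  have mixed: "p' \<sim> q'" if "turn v a b c p p'" "q \<parallel> v" "rotates v a b c q q'" "p \<sim> q" for p p' q q'
    using that(3)
  proof (cases rule: rotates_cases)
    case (3 y3 x x')
    have "q' \<sim> p'"
      by (rule turn_compat[OF K 3(2-6) _ adj_sym[OF that(4)] that(1)]) (use turnD[OF that(1)] in blast)
    then show ?thesis by (rule adj_sym)
  qed (use nadj_not_adj[OF that(2)] in auto)
  have centre: "p' \<sim> v" if "p \<sim> v" "rotates v a b c p p'" for p p'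
    using that(2)
  proof (cases rule: rotates_cases)
    case 2 then show ?thesis using turnD adj_sym by blast
  qed (use that in \<open>simp_all add: nadj_def adj_irrefl\<close>)
  show ?thesis using r(1)
  proof (cases rule: rotates_cases)
    case 1
    then show ?thesis using centre[OF _ r(2)] yz adj_sym by blast
  next
    case 2
    note y = 2
    show ?thesis using r(2)
    proof (cases rule: rotates_cases)
      case 1
      then show ?thesis using centre[OF _ r(1)] yz by blast
    next
      case 2
      obtain y'' where y'': "K4 v y y' y''" "turn v a b c y' y''" "turn v a b c y'' y"
        using turn_cycle[OF K y(2)] .
      have "z = y' \<or> z = y''" using K4_common[OF y''(1), of z] yz 2 adj_sym by blast
      then show ?thesis
        using turn_unique[OF K 2(2)] y''(2,3) turnD[OF y''(2)] turnD[OF y(2)] adj_sym by blast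
    next
      case 3
      then show ?thesis using mixed[OF y(2) 3(1) r(2) yz] by blast
    qed
  next
    case (3 y3 x x')
    note y = 3
    show ?thesis using r(2)
    proof (cases rule: rotates_cases)
      case 1
      then show ?thesis using centre[OF _ r(1)] yz by blast
    next
      case 2
      then show ?thesis using mixed[OF 2(2) y(1) r(1) adj_sym[OF yz]] adj_sym by blast
    next
      case (3 z3 t t')
      note z = 3
      have off: "y' \<notin> {z, z', z3}"
      proof
        assume "y' \<in> {z, z', z3}"
        then obtain g h where "L4 v y' g h" "z \<in> {y', g, h}"
          using z(2) L4_rot[OF z(2)] by blast
        moreover have "L4 v y' y3 y" using L4_rot(1)[OF y(2)] .
        ultimately have "z \<in> {y', y3, y}" using L4_unique2 by blast
        then show False using yz L4_nadj[OF y(2)] nadj_not_adj adj_irrefl by blast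
      qed
      have y'v: "y' \<parallel> v" and vz: "v \<parallel> z" using L4_nadj[OF y(2)] L4_nadj[OF z(2)] nadj_commute by blast+
      have "card (N y' \<inter> (N v \<inter> N z')) \<le> card (N y \<inter> (N v \<inter> N z))"
      proof -
        obtain y'' z'' where s: "rotates v a b c y' y''" "rotates v a b c y'' y" "rotates v a b c z' z''" "rotates v a b c z'' z"
            "L4 v y y' y''" "L4 v z z' z''"
          using rotates_cycle[OF K r(1)] rotates_cycle[OF K r(2)] y(1) z(1) by blast
        have nv: "y'' \<parallel> v" "z'' \<parallel> v" "z' \<parallel> v" using L4_nadj[OF s(5)] L4_nadj[OF s(6)] nadj_commute by blast+
        have "\<exists>s'. s' \<in> N y \<inter> (N v \<inter> N z) \<and> (\<exists>s1. turn v a b c s s1 \<and> turn v a b c s1 s')"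
          if "s \<in> N y' \<inter> (N v \<inter> N z')" for s
        proof -
          have a: "v \<sim> s" "s \<sim> y'" "s \<sim> z'" using that adj_sym by auto
          obtain s1 where s1: "turn v a b c s s1" using turn_ex[OF K a(1)] .
          obtain s2 where s2: "turn v a b c s1 s2" using turn_cycle[OF K s1] by blast
          have "s1 \<sim> y''" "s1 \<sim> z''" using mixed[OF s1 y'v s(1) a(2)] mixed[OF s1 nv(3) s(3) a(3)] by auto
          then have "s2 \<sim> y" "s2 \<sim> z" using mixed[OF s2 nv(1) s(2)] mixed[OF s2 nv(2) s(4)] by auto
          then show ?thesis using s1 s2 turnD[OF s2] adj_sym by auto
        qed
        \<comment> \<open>Turning twice is the inverse rotation; it leads from common neighbours of
          y' and z' back to those of y and z.\<close>
        then obtain f where f: "\<And>s. s \<in> N y' \<inter> (N v \<inter> N z') \<Longrightarrow> f s \<in> N y \<inter> (N v \<inter> N z) \<and>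
            (\<exists>s1. turn v a b c s s1 \<and> turn v a b c s1 (f s))" by metis
        have "inj_on f (N y' \<inter> (N v \<inter> N z'))"
        proof (rule inj_onI)
          fix s t assume st: "s \<in> N y' \<inter> (N v \<inter> N z')" "t \<in> N y' \<inter> (N v \<inter> N z')" "f s = f t"
          obtain s1 where s1: "turn v a b c s s1" "turn v a b c s1 (f s)" using f[OF st(1)] by blast
          obtain t1 where t1: "turn v a b c t t1" "turn v a b c t1 (f t)" using f[OF st(2)] by blast
          have "turn v a b c (f s) s" using turn_cycle[OF K s1(1)] turn_unique[OF K s1(2)] by metis
          moreover have "turn v a b c (f t) t" using turn_cycle[OF K t1(1)] turn_unique[OF K t1(2)] by metis
          ultimately show "s = t" using turn_unique[OF K] st(3) by metis
        qed
        then show ?thesis using f by (intro card_inj_on_le[of f]) auto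
      qed
      also have "\<dots> \<le> 1" using common_adj_le_1[OF vz adj_sym[OF yz]] .
      finally have "card (N y' \<inter> (N v \<inter> N z')) \<le> 1" .
      moreover have "int (card (N y' \<inter> (N v \<inter> N z'))) \<ge> n" if "\<not> z' \<sim> y'"
        using line_count[OF L4_perm(2)[OF z(2)] y'v] off that by auto
      ultimately show ?thesis using n_ge_3 adj_sym by fastforce
    qed
  qed
qed

definition aut :: "('a \<Rightarrow> 'a) \<Rightarrow> bool" where
  "aut f \<longleftrightarrow> bij_betw f V V \<and> (\<forall>x\<in>V. \<forall>y\<in>V. f x \<sim> f y \<longleftrightarrow> x \<sim> y)"

lemma rotation_ex:
  assumes K: "K4 v a b c"
  obtains w where "aut w" "w v = v" "w a = b" "w b = c" "w c = a"
    "\<And>x. x \<in> V \<Longrightarrow> w (w (w x)) = x" "\<And>x. v \<sim> x \<Longrightarrow> K4 v x (w x) (w (w x))"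
    "\<And>y. y \<parallel> v \<Longrightarrow> L4 v y (w y) (w (w y))"
proof -
  obtain w where w: "\<And>y. y \<in> V \<Longrightarrow> rotates v a b c y (w y)"
  proof -
    have "\<forall>y\<in>V. \<exists>y'. rotates v a b c y y'" using rotates_ex[OF K] by blast
    then show thesis using that by metis
  qed
  have inV: "y' \<in> V" if "rotates v a b c y y'" for y y'
    using that turnD[of v a b c y y'] adj_V2 L4_nadj(2)[of v y y'] unfolding rotates_def nadj_def by blast
  have un: "y' = w y" if "rotates v a b c y y'" "y \<in> V" for y y'
    using rotates_unique[OF K that(1) w[OF that(2)]] .
  have cyc: "rotates v a b c (w (w y)) y \<and> (v \<sim> y \<longrightarrow> K4 v y (w y) (w (w y))) \<and> (y \<parallel> v \<longrightarrow> L4 v y (w y) (w (w y)))"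
    if "y \<in> V" for y
    using rotates_cycle[OF K w[OF that]] un inV w[OF that] by metis
  have wV: "w y \<in> V" if "y \<in> V" for y using inV[OF w[OF that]] .
  have w3: "w (w (w y)) = y" if "y \<in> V" for y
    using cyc[OF that] un wV that by metis
  have pres: "w x \<sim> w y" if "x \<sim> y" for x y
    using rotates_adj[OF K w w that] that adj_V adj_V2 by blast
  have vV: "v \<in> V" "a \<in> V" "b \<in> V" "c \<in> V" using K adj_V adj_V2 unfolding K4_def by blast+
  have "aut w"
    unfolding aut_def
  proof (intro conjI ballI)
    show "bij_betw w V V"
      by (rule bij_betw_byWitness[where f' = "\<lambda>y. w (w y)"]) (use wV w3 in auto)
    fix x y assume xy: "x \<in> V" "y \<in> V"
    show "w x \<sim> w y \<longleftrightarrow> x \<sim> y"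
    proof
      assume "w x \<sim> w y"
      then have "w (w (w x)) \<sim> w (w (w y))" by (rule pres[OF pres])
      then show "x \<sim> y" using w3 xy by simp
    qed (rule pres)
  qed
  moreover have "w v = v" using un[of v v] vV by (simp add: rotates_def)
  moreover have Kr: "K4 v a b c" "K4 v b c a" "K4 v c a b" using K K4_rot[OF K] by auto
  have "turn v a b c a b" using turn_base[OF K] .
  moreover obtain x'' where x'': "K4 v a b x''" "turn v a b c b x''" "turn v a b c x'' a"
    using turn_cycle[OF K turn_base[OF K]] .
  have "x'' \<sim> a" "x'' \<sim> v" "x'' \<noteq> b" using x''(1) adj_sym adj_neq unfolding K4_def by blast+
  then have "x'' = c" using K4_common[OF K, of x''] by blast
  ultimately have "w a = b" "w b = c" "w c = a"
    using un[of a b] un[of b c] un[of c a] x'' vV unfolding rotates_def by auto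
  show thesis
    by (rule that[OF \<open>aut w\<close> \<open>w v = v\<close> \<open>w a = b\<close> \<open>w b = c\<close> \<open>w c = a\<close> w3])
      (use cyc adj_V2 in \<open>auto simp: nadj_def\<close>)
qed


section \<open>Shifts\<close>

lemma aut_adj: "aut f \<Longrightarrow> x \<in> V \<Longrightarrow> y \<in> V \<Longrightarrow> f x \<sim> f y \<longleftrightarrow> x \<sim> y"
  by (simp add: aut_def)

lemma aut_pres: "aut f \<Longrightarrow> x \<sim> y \<Longrightarrow> f x \<sim> f y"
  using aut_adj adj_V adj_V2 by blast

lemma aut_V: "aut f \<Longrightarrow> x \<in> V \<Longrightarrow> f x \<in> V"
  by (auto simp: aut_def bij_betw_def)

lemma aut_inj: "aut f \<Longrightarrow> x \<in> V \<Longrightarrow> y \<in> V \<Longrightarrow> f x = f y \<Longrightarrow> x = y"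
  by (auto simp: aut_def bij_betw_def inj_on_def)

lemma aut_surj: "aut f \<Longrightarrow> y \<in> V \<Longrightarrow> \<exists>x\<in>V. f x = y"
  unfolding aut_def bij_betw_def by (metis imageE)

lemma aut_nadj: "aut f \<Longrightarrow> x \<parallel> y \<Longrightarrow> f x \<parallel> f y"
  unfolding nadj_def using aut_adj aut_V aut_inj by metis

lemma aut_comp: "aut f \<Longrightarrow> aut g \<Longrightarrow> aut (\<lambda>x. f (g x))"
  unfolding aut_def using bij_betw_trans[of g V V f V] aut_V[unfolded aut_def] by (simp add: comp_def)

lemma aut_indep:
  assumes f: "aut f" and i: "indep a b c"
  shows "indep (f a) (f b) (f c)"
proof -
  have abc: "a \<in> V" "b \<in> V" "c \<in> V" using i by (auto simp: indep_def nadj_def)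
  have "False" if x: "f a \<sim> x" "f b \<sim> x" "f c \<sim> x" for x
  proof -
    obtain y where y: "y \<in> V" "f y = x" using aut_surj[OF f] adj_V2[OF x(1)] by blast
    then have "a \<sim> y" "b \<sim> y" "c \<sim> y" using aut_adj[OF f] abc x by blast+
    then show False using i by (auto simp: indep_def)
  qed
  then show ?thesis using i aut_nadj[OF f] unfolding indep_def by blast
qed

lemma aut_L4: "aut f \<Longrightarrow> L4 a b c d \<Longrightarrow> L4 (f a) (f b) (f c) (f d)"
  unfolding L4_def using aut_indep by blast

lemma aut_K4: "aut f \<Longrightarrow> K4 a b c d \<Longrightarrow> K4 (f a) (f b) (f c) (f d)"
  unfolding K4_def using aut_pres by blast

text \<open>Since p and its neighbours are fixed, f y would be adjacent to all n(n + 1) common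
  neighbours of p and y, which \<open>triple_count\<close> forbids for a vertex other than
  y.\<close>

lemma aut_fix:
  assumes f: "aut f" and p: "p \<in> V" "f p = p" and N: "\<And>x. p \<sim> x \<Longrightarrow> f x = x" and y: "y \<in> V"
  shows "f y = y"
proof (rule ccontr)
  assume ne: "f y \<noteq> y"
  then have py: "p \<parallel> y" using p N y by (auto simp: nadj_def)
  have fy: "f y \<parallel> p" using aut_nadj[OF f py] p nadj_commute by auto
  have "N f_y \<inter> (N p \<inter> N y) = N p \<inter> N y" if "f_y = f y" for f_y
  proof -
    have "f y \<sim> x" if "p \<sim> x" "y \<sim> x" for x using aut_pres[OF f that(2)] N[OF that(1)] by simp
    then show ?thesis using that by auto
  qed
  then have "int (card (N (f y) \<inter> (N p \<inter> N y))) = n * (n + 1)" using card_common_nadj[OF py] by simp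
  then have "(n - 1) * (n * (n + 1)) + int (card (N (f y) \<inter> T p y)) \<le> n * (n + 1)"
    using triple_count[OF py fy ne] n_ge_3 by (auto simp: of_bool_def)
  then have "(n - 1) * (n * (n + 1)) \<le> 1 * (n * (n + 1))" by linarith
  moreover have "n * (n + 1) > 0" using n_ge_3 by simp
  ultimately show False using n_ge_3 by (simp add: mult_le_cancel_right)
qed

text \<open>The trace of the translation from p to c on one clique and its neighbours;
  \<open>swaps_shift\<close> extends the conditions to all vertices.\<close>

definition swaps :: "('a \<Rightarrow> 'a) \<Rightarrow> 'a \<Rightarrow> 'a \<Rightarrow> 'a \<Rightarrow> 'a \<Rightarrow> bool" where
  "swaps f p c k1 k2 \<longleftrightarrow> aut f \<and> K4 p c k1 k2 \<and> f p = c \<and> f c = p \<and> f k1 = k2 \<and> f k2 = k1 \<and>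
    (\<forall>k\<in>{p, c, k1, k2}. \<forall>y. y \<sim> k \<longrightarrow> y \<sim> f y)"

text \<open>An automorphism exchanging \<open>p \<leftrightarrow> c\<close>, \<open>k1 \<leftrightarrow> k2\<close> that moves every neighbour of the clique
  \<open>p, c, k1, k2\<close> along an edge is determined on the neighbours of \<open>p\<close>.\<close>

lemma transport:
  assumes sw: "swaps f p c k1 k2"
    and Ks: "K4 p s s2 s3" and cs: "\<not> c \<sim> s" "c \<noteq> s"
    and L: "L4 c s y y'" "y \<sim> k2" "y \<sim> s2"
  shows "L4 p (f s) (f y) (f y')" "f y \<sim> k1" "f y \<sim> s2" "K4 s2 y (f y) (f s2)"
    "\<And>q. q \<sim> s2 \<Longrightarrow> q \<sim> y \<Longrightarrow> q \<sim> k1 \<Longrightarrow> q = f y"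
    "f (f s) = s" "f (f y) = y" "f (f s2) = s2" "s \<sim> f s" "c \<sim> f s" "y' \<sim> k1" "y' \<sim> s3"
proof -
  have f: "aut f" and K: "K4 p c k1 k2" and fK: "f p = c" "f c = p" "f k1 = k2" "f k2 = k1"
    and E: "\<And>k y. k \<in> {p, c, k1, k2} \<Longrightarrow> y \<sim> k \<Longrightarrow> y \<sim> f y"
    using sw unfolding swaps_def by blast+
  have k: "p \<sim> c" "p \<sim> k1" "p \<sim> k2" "c \<sim> k1" "c \<sim> k2" "k1 \<sim> k2" using K by (auto simp: K4_def)
  have s: "p \<sim> s" "p \<sim> s2" "p \<sim> s3" "s \<sim> s2" "s \<sim> s3" "s2 \<sim> s3" using Ks by (auto simp: K4_def)
  have V: "p \<in> V" "c \<in> V" "s \<in> V" "s2 \<in> V" "k1 \<in> V" "k2 \<in> V" using k s adj_V adj_V2 by blast+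
  have yV: "y \<in> V" "y' \<in> V" using L4_nadj[OF L(1)] by (auto simp: nadj_def)
  have ps: "s \<sim> p" "s2 \<sim> p" "c \<sim> p" using s k adj_sym by blast+
  show sfs: "s \<sim> f s" using E[of p s] ps by simp
  show cfs: "c \<sim> f s" using aut_pres[OF f s(1)] fK by simp
  have sK: "\<not> s \<sim> c" "s \<noteq> c" using cs adj_sym by blast+
  have sep: "\<not> t \<sim> k1 \<and> t \<noteq> k1" if "p \<sim> t" "t = s \<or> t \<sim> s" for t
  proof -
    have "\<not> (t \<sim> c \<or> t = c)" using same_clique_trans[of p s t c] that s(1) k(1) sK adj_sym by blast
    then show ?thesis using same_clique_trans[of p t k1 c] that(1) k adj_sym by blast
  qed
  have npf: "p \<parallel> f s"
  proof -
    have "\<not> p \<sim> f s"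
    proof
      assume "p \<sim> f s"
      then have "s \<sim> c" using no_diamond[of p "f s" s c] s(1) k(1) sfs cfs sK adj_sym by blast
      then show False using sK by blast
    qed
    moreover have "p \<noteq> f s" using aut_inj[OF f V(3,2)] fK sK by auto
    ultimately show ?thesis using V aut_V[OF f] by (auto simp: nadj_def)
  qed
  have cp: "c \<sim> p" "s \<sim> p" using ps by auto
  have ny: "\<not> y \<sim> p" "\<not> y' \<sim> p" using L4_no_common(1,2)[OF L(1), of p] k(1) s(1) adj_sym by blast+
  have Kc: "K4 c p k2 k1" and Ksp: "K4 s p s2 s3"
    using K4_perm(3)[OF K4_perm(1)[OF K]] K4_perm(1)[OF Ks] by auto
  show y'k: "y' \<sim> k1" using L4_K4[OF L(1) Kc cp(2) L(2)] .
  show y's: "y' \<sim> s3" using L4_K4[OF L4_perm(1)[OF L(1)] Ksp cp(1) L(3)] .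
  have L': "L4 p (f s) (f y) (f y')" using aut_L4[OF f L(1)] fK by simp
  then show "L4 p (f s) (f y) (f y')" .
  have yf: "y \<sim> f y" using E[of k2 y] L(2) by simp
  show fyk: "f y \<sim> k1" using aut_pres[OF f L(2)] fK by simp
  have fs: "f s \<sim> c" "f s \<sim> s" using cfs sfs adj_sym by blast+
  \<comment> \<open>The points \<open>f y\<close> and y' already share the neighbour k1 in the
    clique of p and c; \<open>corner\<close> at p forbids them to share s3 in the clique of p and
    s.\<close>
  have "\<not> f y \<sim> s3"
    using corner[OF L' L4_perm(3)[OF L(1)] k(1) fs(1) s(1) fs(2) k(2,4) fyk y'k s(3,5) _ y's] by blast
  moreover have "indep p (f s) (f y)" using L' by (simp add: L4_def)
  ultimately show fys: "f y \<sim> s2" using indep_mate[OF _ Ks fs(2)] by blast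
  define r where "r = f s2"
  have rs: "s2 \<sim> r" using E[of p s2] ps by (simp add: r_def)
  have ry: "r \<sim> f y" using aut_pres[OF f L(3)] adj_sym by (simp add: r_def)
  have rc: "r \<sim> c" using aut_pres[OF f s(2)] fK adj_sym by (simp add: r_def)
  have "\<not> y \<sim> c" using L4_nadj(2)[OF L(1)] nadj_not_adj by blast
  then have "y \<noteq> r" using rc by blast
  have sy: "s2 \<sim> y" "s2 \<sim> f y" using L(3) fys adj_sym by blast+
  have "y \<sim> r" using no_diamond[OF sy(2) sy(1) adj_sym[OF yf] rs adj_sym[OF ry] \<open>y \<noteq> r\<close>] .
  then have K': "K4 s2 y (f y) r" using sy rs yf adj_sym[OF ry] by (simp add: K4_def)
  then show K'': "K4 s2 y (f y) (f s2)" by (simp add: r_def)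
  \<comment> \<open>The common neighbours of s2 and y are \<open>f y\<close> and r. Excluding r
    characterises \<open>f y\<close> by adjacencies that do not mention f.\<close>
  have "\<not> r \<sim> k1"
  proof
    assume a: "r \<sim> k1"
    have "r = p \<or> r = k2" using K4_common[of c k1 p k2 r] K a rc unfolding K4_def using adj_sym by blast
    then have "s2 \<sim> p \<and> s2 \<sim> k2 \<or> r = p" using ps(2) rs by blast
    moreover have "r \<noteq> p" using sep[OF s(2)] s(4) adj_sym ry ny(1) \<open>y \<sim> r\<close> by blast
    moreover have "\<not> s2 \<sim> k2"
      using same_clique_trans[of p s2 k2 k1] sep[OF s(2)] s(2,4) k adj_sym by blast
    ultimately show False by blast
  qed
  then show "\<And>q. q \<sim> s2 \<Longrightarrow> q \<sim> y \<Longrightarrow> q \<sim> k1 \<Longrightarrow> q = f y"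
    using K4_common[OF K'] by blast
  have fK': "K4 r (f y) (f (f y)) (f r)" using aut_K4[OF f K'] by (simp add: r_def)
  have Kr: "K4 r (f y) s2 y"
    using K' by (simp add: K4_def adj_commute)
  have "f r \<sim> p" using aut_pres[OF f rc] fK by simp
  then have "f r \<noteq> y" using ny by blast
  have in2: "t = s2 \<or> t = y" if "t = f r \<or> t = f (f y)" for t
    using K4_common[OF Kr, of t] that fK' adj_sym by (auto simp: K4_def)
  then have fr: "f r = s2" using \<open>f r \<noteq> y\<close> by blast
  then show "f (f s2) = s2" by (simp add: r_def)
  have "f (f y) \<sim> f r" using fK' by (simp add: K4_def)
  then show ffy: "f (f y) = y" using in2 fr adj_irrefl by metis
  have "L4 c (f (f s)) (f (f y)) (f (f y'))" using aut_L4[OF f L'] fK by simp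
  then have "L4 c y (f (f y')) (f (f s))" using ffy L4_rot(1) by simp
  then have "f (f s) = s \<or> f (f s) = y'" using L4_unique2[OF L4_rot(1)[OF L(1)]] by blast
  moreover have "f (f s) \<sim> p" using aut_pres[OF f aut_pres[OF f ps(1)]] fK by simp
  ultimately show "f (f s) = s" using ny by blast
qed

lemma swaps_commute: "swaps f p c k1 k2 \<Longrightarrow> swaps f p c k2 k1"
  unfolding swaps_def using K4_perm(3) by blast

text \<open>Puts an arbitrary neighbour x of p outside the clique of c into the role of
  \<open>s2\<close> in \<open>transport\<close>.\<close>

lemma transport_setup:
  assumes K: "K4 p c k1 k2" and x: "p \<sim> x" "\<not> c \<sim> x" "c \<noteq> x"
  obtains s t y y' where "K4 p s x t" "\<not> c \<sim> s" "c \<noteq> s" "L4 c s y y'" "y \<sim> k1 \<or> y \<sim> k2" "y \<sim> x"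
proof -
  obtain s t where Kx: "K4 p x s t" using K4_ex[OF x(1)] .
  have v: "p \<sim> s" "x \<sim> s" using Kx by (auto simp: K4_def)
  have k: "p \<sim> c" using K by (auto simp: K4_def)
  have sep: "\<not> c \<sim> s" "c \<noteq> s"
    using same_clique_trans[of p c s x] x k v adj_sym by blast+
  have "c \<parallel> s" using sep k v adj_V2 by (auto simp: nadj_def)
  then obtain z z' where L: "L4 c s z z'" using L4_ex by blast
  have Ks: "K4 s p x t" using Kx by (simp add: K4_def adj_commute)
  have "z \<sim> x \<or> z' \<sim> x" using L4_K4_other[OF L4_perm(1)[OF L] Ks adj_sym[OF k]] by blast
  then obtain y y' where L: "L4 c s y y'" "y \<sim> x" using L L4_perm(3)[OF L] by blast
  have Kc: "K4 c p k1 k2" using K4_perm(1)[OF K] .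
  have "y \<sim> k1 \<or> y \<sim> k2" using L4_K4_other[OF L(1) Kc adj_sym[OF v(1)]] by blast
  then show thesis using that[OF K4_perm(2)[OF Kx] sep L(1) _ L(2)] by blast
qed

text \<open>By \<open>transport\<close>, x and f x lie in one clique with y and f y, whose
  neighbours in the base clique include k1 and k2. As y is chosen before f and f y is characterised
  without f, the vertex f x is determined.\<close>

lemma swaps_nbr:
  assumes f: "swaps f p c k1 k2" and x: "p \<sim> x" "\<not> c \<sim> x" "c \<noteq> x"
  shows "f (f x) = x" "\<And>q. q \<sim> x \<Longrightarrow> q \<sim> f x \<Longrightarrow> q \<sim> k1 \<or> q \<sim> k2" "\<And>g. swaps g p c k1 k2 \<Longrightarrow> g x = f x"
proof -
  have K: "K4 p c k1 k2" using f by (simp add: swaps_def)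
  obtain s t y y' where s: "K4 p s x t" "\<not> c \<sim> s" "c \<noteq> s" "L4 c s y y'" "y \<sim> k1 \<or> y \<sim> k2" "y \<sim> x"
    using transport_setup[OF K x] .
  have main: "f (f x) = x \<and> (\<forall>q. q \<sim> x \<and> q \<sim> f x \<longrightarrow> q \<sim> h1 \<or> q \<sim> h2) \<and> (\<forall>g. swaps g p c h1 h2 \<longrightarrow> g x = f x)"
    if h: "swaps f p c h1 h2" "y \<sim> h2" for h1 h2
  proof (intro conjI allI impI)
    note T = transport[OF h(1) s(1-4) h(2) s(6)]
    show "f (f x) = x" by (rule T(8))
    show "q \<sim> h1 \<or> q \<sim> h2" if "q \<sim> x \<and> q \<sim> f x" for q
    proof -
      have "K4 x (f x) y (f y)" using K4_rot(2)[OF T(4)] .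
      then have "q = y \<or> q = f y" using K4_common that by blast
      then show ?thesis using h(2) T(2) by blast
    qed
    fix g assume g: "swaps g p c h1 h2"
    note G = transport[OF g s(1-4) h(2) s(6)]
    have "g y \<sim> x" "g y \<sim> y" using G(3,4) adj_sym by (auto simp: K4_def)
    then have gy: "g y = f y" using T(5) G(2) by blast
    have "g x \<sim> x" "g x \<sim> y" "g x \<sim> f y" using G(4) gy adj_sym by (auto simp: K4_def)
    then show "g x = f x" using K4_common[OF T(4)] adj_irrefl by metis
  qed
  show "f (f x) = x" "\<And>q. q \<sim> x \<Longrightarrow> q \<sim> f x \<Longrightarrow> q \<sim> k1 \<or> q \<sim> k2" "\<And>g. swaps g p c k1 k2 \<Longrightarrow> g x = f x"
    using s(5) main[OF f] main[OF swaps_commute[OF f]] swaps_commute by blast+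
qed

definition shift :: "('a \<Rightarrow> 'a) \<Rightarrow> bool" where
  "shift f \<longleftrightarrow> aut f \<and> (\<forall>y\<in>V. f (f y) = y) \<and> (\<forall>y\<in>V. y \<sim> f y)"

lemma shift_swaps:
  assumes "shift f" and K: "K4 p (f p) k1 k2"
  shows "swaps f p (f p) k1 k2"
proof -
  have f: "aut f" "\<And>y. y \<in> V \<Longrightarrow> f (f y) = y" "\<And>y. y \<in> V \<Longrightarrow> y \<sim> f y"
    using assms by (auto simp: shift_def)
  have k: "p \<sim> k1" "p \<sim> k2" "f p \<sim> k1" "p \<sim> f p" using K by (auto simp: K4_def)
  have V: "p \<in> V" "k1 \<in> V" "k2 \<in> V" using k adj_V adj_V2 by blast+
  have "f k1 \<sim> f p" "f k1 \<sim> p"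
    using aut_pres[OF f(1) k(1)] aut_pres[OF f(1) k(3)] f(2)[OF V(1)] adj_sym by auto
  then have "f k1 = k1 \<or> f k1 = k2" using K4_common[OF K] by blast
  moreover have "f k1 \<noteq> k1" using f(3)[OF V(2)] adj_irrefl by metis
  ultimately have fk: "f k1 = k2" by blast
  then have "f k2 = k1" using f(2)[OF V(2)] by blast
  then show ?thesis using f K fk V adj_V unfolding swaps_def by blast
qed

text \<open>The square of f fixes p and its neighbours, hence everything. If y were not adjacent to
  f y, then y, f y would form an independent triple with p, by the second part of
  \<open>swaps_nbr\<close>, and by applying f also with c. Uniqueness of the line through y and f y
  would put p and c on one line, although they are adjacent.\<close>

lemma swaps_shift:
  assumes s: "swaps f p c k1 k2"
  shows "shift f"
proof -
  have f: "aut f" and K: "K4 p c k1 k2" and fK: "f p = c" "f c = p" "f k1 = k2" "f k2 = k1"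
    and E: "\<And>k y. k \<in> {p, c, k1, k2} \<Longrightarrow> y \<sim> k \<Longrightarrow> y \<sim> f y"
    using s unfolding swaps_def by blast+
  have k: "p \<sim> c" "p \<sim> k1" "p \<sim> k2" "c \<sim> k1" "c \<sim> k2" "k1 \<sim> k2" using K by (auto simp: K4_def)
  have V: "p \<in> V" "c \<in> V" using k adj_V adj_V2 by blast+
  have ffx: "f (f x) = x" if "p \<sim> x" for x
  proof (cases "x \<in> {c, k1, k2}")
    case False
    then have "\<not> c \<sim> x" using K4_common[OF K, of x] that adj_sym by blast
    then show ?thesis using swaps_nbr(1)[OF s that] False by blast
  qed (use fK in auto)
  have ff: "f (f y) = y" if "y \<in> V" for y
    by (rule aut_fix[OF aut_comp[OF f f] V(1) _ ffx that]) (use fK in auto)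
  have "y \<sim> f y" if y: "y \<in> V" for y
  proof (rule ccontr)
    assume ny: "\<not> y \<sim> f y"
    have nk: "\<not> y \<sim> z" "y \<noteq> z" if "z \<in> {p, c, k1, k2}" for z
    proof -
      show "\<not> y \<sim> z" using E[OF that, of y] ny by blast
      show "y \<noteq> z" using E[of p y] E[of c y] that k ny adj_sym by blast
    qed
    have py: "p \<parallel> y" "c \<parallel> y" using nk[of p] nk[of c] V y adj_sym by (auto simp: nadj_def)
    have pfy: "c \<parallel> f y" "p \<parallel> f y" using aut_nadj[OF f py(1)] aut_nadj[OF f py(2)] fK by auto
    have no: "\<not> (p \<sim> x \<and> y \<sim> x \<and> f y \<sim> x)" for x
    proof
      assume x: "p \<sim> x \<and> y \<sim> x \<and> f y \<sim> x"
      have "x \<noteq> c" "x \<noteq> k1" "x \<noteq> k2" using x nk by blast+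
      then have cx: "\<not> c \<sim> x" "c \<noteq> x" using K4_common[OF K, of x] x adj_sym by blast+
      have "y \<sim> f x" using aut_pres[OF f, of "f y" x] ff[OF y] x by auto
      then have "y \<sim> k1 \<or> y \<sim> k2" using swaps_nbr(2)[OF s _ cx] x by blast
      then show False using nk by blast
    qed
    have "f y \<noteq> y"
    proof
      assume "f y = y"
      obtain x where "p \<sim> x" "y \<sim> x" using common_ex[OF py(1), of "{}"] by auto
      then show False using no \<open>f y = y\<close> by metis
    qed
    then have yfy: "y \<parallel> f y" using y aut_V[OF f y] ny by (auto simp: nadj_def)
    have i: "indep y (f y) p" unfolding indep_def using yfy py pfy nadj_commute no by blast
    have "indep (f y) (f (f y)) (f p)" by (rule aut_indep[OF f i])
    then have ic: "indep y (f y) c" using indep_perm(1) fK ff[OF y] by simp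
    obtain q where "L4 y (f y) p q" using fourth_ex[OF i] fourth_L4[OF i] by blast
    then have "c = p \<or> p \<parallel> c" using L4_unique[OF _ ic] L4_nadj(6) by blast
    then show False using k(1) adj_irrefl nadj_not_adj by blast
  qed
  then show ?thesis using f ff by (simp add: shift_def)
qed


text \<open>The vertex h is a point of the line of p and g = wx s. The transversal line through g
  and p relative to the line g, x, s, g' is that line, and its point adjacent to c is adjacent to s
  as well.\<close>

lemma rotation_product_adj:
  assumes K: "K4 x p b c" and w0: "aut w0" "w0 b = c" "\<And>g. g \<parallel> p \<Longrightarrow> L4 p g (w0 g) (w0 (w0 g))"
    and wx: "aut wx" "wx p = b" "\<And>s. s \<parallel> x \<Longrightarrow> L4 x s (wx s) (wx (wx s))"
    and s: "p \<sim> s" "s \<parallel> x"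
  shows "s \<sim> w0 (wx s)"
proof -
  define g where "g = wx s"
  define g' where "g' = wx g"
  define h where "h = w0 g"
  have k: "x \<sim> p" "x \<sim> b" "x \<sim> c" "p \<sim> b" "p \<sim> c" "b \<sim> c" using K by (auto simp: K4_def)
  have L: "L4 x s g g'" using wx(3)[OF s(2)] by (simp add: g_def g'_def)
  have bg: "b \<sim> g" using aut_pres[OF wx(1) s(1)] wx(2) by (simp add: g_def)
  have ch: "c \<sim> h" using aut_pres[OF w0(1) bg] w0(2) by (simp add: h_def)
  have sp: "s \<sim> p" "g \<sim> b" "p \<sim> x" using s(1) bg k adj_sym by blast+
  have "\<not> g \<sim> p" using L4_no_common(1)[OF L sp(3) s(1)] adj_sym by blast
  moreover have "g \<noteq> p" using L4_nadj(2)[OF L] k(1) nadj_not_adj by blast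
  ultimately have gp: "g \<parallel> p" using bg k adj_V2 by (auto simp: nadj_def)
  have Lp: "L4 p g h (w0 h)" using w0(3)[OF gp] by (simp add: h_def)
  have g'c: "g' \<sim> c" using L4_K4[OF L K sp(1,2)] .
  have Lg: "L4 g x s g'" using L4_perm(1)[OF L4_perm(2)[OF L]] .
  obtain \<beta> \<gamma> where Kg: "K4 g b \<beta> \<gamma>" "s \<sim> \<beta>" "g' \<sim> \<gamma>" using L4_K4_ex[OF Lg sp(2) k(2)] .
  obtain y y' where y: "L4 g p y y'" "s \<sim> y" "c \<sim> y"
    using transversal_line[OF Lg K sp(2,1) g'c Kg] by blast
  have "h = y \<or> h = y'" using L4_unique2[OF L4_perm(1)[OF y(1)] Lp] by blast
  moreover have "h \<noteq> y'" using L4_no_common(4)[OF y(1), of c] k(5) y(3) ch adj_sym by blast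
  ultimately show ?thesis using y(2) by (simp add: h_def g_def)
qed

text \<open>The shift along an edge is the quotient of two rotations around vertices of its clique.\<close>

lemma shift_ex:
  assumes pu: "p \<sim> u"
  obtains f where "shift f" "f p = u"
proof -
  obtain x b where Ku: "K4 p u x b" using K4_ex[OF pu] .
  define c where "c = u"
  have K: "K4 p c x b" using Ku by (simp add: c_def)
  have k: "p \<sim> c" "p \<sim> x" "p \<sim> b" "c \<sim> x" "c \<sim> b" "x \<sim> b" using K by (auto simp: K4_def)
  have Kp: "K4 p x b c" "K4 x p b c" "K4 p x c b" using K by (simp_all add: K4_def adj_commute)
  obtain w0 where w0: "aut w0" "w0 p = p" "w0 x = b" "w0 b = c" "w0 c = x"
    "\<And>y. y \<in> V \<Longrightarrow> w0 (w0 (w0 y)) = y" "\<And>y. y \<parallel> p \<Longrightarrow> L4 p y (w0 y) (w0 (w0 y))"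
    using rotation_ex[OF Kp(1)] by metis
  obtain wx where wx: "aut wx" "wx x = x" "wx p = b" "wx b = c" "wx c = p"
    "\<And>y. y \<in> V \<Longrightarrow> wx (wx (wx y)) = y" "\<And>y. y \<parallel> x \<Longrightarrow> L4 x y (wx y) (wx (wx y))"
    using rotation_ex[OF Kp(2)] by metis
  define f where "f = (\<lambda>y. w0 (wx y))"
  define fi where "fi = (\<lambda>y. wx (wx (w0 (w0 y))))"
  have f: "aut f" unfolding f_def by (rule aut_comp[OF w0(1) wx(1)])
  have fK: "f p = c" "f c = p" "f x = b" "f b = x" using w0 wx by (auto simp: f_def)
  have ffi: "f (fi y) = y" if "y \<in> V" for y
    using that w0(6) wx(6) aut_V[OF w0(1)] by (simp add: f_def fi_def)
  have V: "p \<in> V" "x \<in> V" using k adj_V adj_V2 by blast+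
  have Ep: "y \<sim> f y" if y: "y \<sim> p" for y
  proof (cases "y \<in> {x, b, c}")
    case True
    then show ?thesis using fK k adj_sym by auto
  next
    case False
    then have "\<not> y \<sim> x" using K4_common[OF Kp(1), of y] y by blast
    then have "y \<parallel> x" using False V y adj_V by (auto simp: nadj_def)
    then show ?thesis
      using rotation_product_adj[OF Kp(2) w0(1,4,7) wx(1,3,7) adj_sym[OF y]] by (simp add: f_def)
  qed
  \<comment> \<open>At x the two rotations trade places. Adjacency is therefore shown first for the
    inverse \<open>fi\<close>, a product of squared rotations to which the lemma applies with p and
    x interchanged. The neighbours of c and b then follow by transport along f.\<close>
  have Ex: "y \<sim> f y" if y: "y \<sim> x" for y
  proof -
    have yV: "y \<in> V" using y adj_V by blast
    have "y \<sim> fi y"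
    proof (cases "y \<in> {p, b, c}")
      case True
      then show ?thesis using w0 wx k adj_sym by (auto simp: fi_def)
    next
      case False
      then have "\<not> y \<sim> p" using K4_common[OF Kp(2), of y] y by blast
      then have "y \<parallel> p" using False V yV by (auto simp: nadj_def)
      moreover have "L4 x g (wx (wx g)) (wx (wx (wx (wx g))))" if "g \<parallel> x" for g
        using L4_perm(3)[OF wx(7)[OF that]] wx(6) that aut_V[OF wx(1)] by (simp add: nadj_def)
      moreover have "L4 p g (w0 (w0 g)) (w0 (w0 (w0 (w0 g))))" if "g \<parallel> p" for g
        using L4_perm(3)[OF w0(7)[OF that]] w0(6) that aut_V[OF w0(1)] by (simp add: nadj_def)
      ultimately show ?thesis
        using rotation_product_adj[OF Kp(3) aut_comp[OF wx(1) wx(1)] _ _ aut_comp[OF w0(1) w0(1)] _ _ adj_sym[OF y]]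
          w0 wx by (simp add: fi_def)
    qed
    then have "f y \<sim> f (fi y)" by (rule aut_pres[OF f])
    then show ?thesis using ffi[OF yV] adj_sym by simp
  qed
  have Ec: "y \<sim> f y" if y: "y \<sim> c" for y
  proof -
    obtain s where s: "s \<in> V" "f s = y" using aut_surj[OF f] y adj_V by blast
    then have "s \<sim> p" using aut_adj[OF f s(1) V(1)] y fK by simp
    then have "f s \<sim> f (f s)" using Ep aut_pres[OF f] by blast
    then show ?thesis using s by simp
  qed
  have Eb: "y \<sim> f y" if y: "y \<sim> b" for y
  proof -
    have "f y \<sim> x" using aut_pres[OF f y] fK by simp
    then have "f y \<sim> f (f y)" by (rule Ex)
    moreover have "y \<in> V" using y adj_V by blast
    ultimately show ?thesis using aut_adj[OF f _ aut_V[OF f]] by blast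
  qed
  have "swaps f p c x b" unfolding swaps_def using f K fK Ep Ex Ec Eb by blast
  then have "shift f" by (rule swaps_shift)
  then show thesis using that fK by (simp add: c_def)
qed

section \<open>Shifts commute, and the vertex set is a single orbit\<close>

lemma shift_aut: "shift f \<Longrightarrow> aut f" and shift_adj: "shift f \<Longrightarrow> y \<in> V \<Longrightarrow> y \<sim> f y"
  and shift_invol: "shift f \<Longrightarrow> y \<in> V \<Longrightarrow> f (f y) = y"
  by (auto simp: shift_def)

text \<open>With origin p and a suitable cube root of unity \<omega>, the line of u and s has the
  points y = \<omega>^2 u + \<omega> s and y' = \<omega> u + \<omega>^2 s, so f y' and g y should
  both be \<omega>^2 (u + s). Once they are known to agree, p, f s, f y and p, g u, g y span the
  same line; g u = f y is excluded by adjacency to s.\<close>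

lemma shift_exchange:
  assumes f: "shift f" and g: "shift g" and fp: "f p \<parallel> g p" and p: "p \<in> V"
  shows "f (g p) = g (f p)"
proof -
  define u where "u = f p"
  define s where "s = g p"
  have pu: "p \<sim> u" "p \<sim> s" using shift_adj[OF f p] shift_adj[OF g p] by (auto simp: u_def s_def)
  have us: "u \<parallel> s" "\<not> u \<sim> s" "u \<noteq> s" "\<not> s \<sim> u" "s \<noteq> u"
    using fp nadj_not_adj[OF fp] unfolding u_def s_def by auto
  obtain y y' where L: "L4 u s y y'" using L4_ex[OF us(1)] .
  obtain k1 k2 where K: "K4 p u k1 k2" "y \<sim> k2"
  proof -
    obtain k1 k2 where K: "K4 p u k1 k2" using K4_ex[OF pu(1)] .
    then show thesis
      using L4_K4_other[OF L K4_perm(1)[OF K] adj_sym[OF pu(2)]] that K4_perm(3)[OF K] by blast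
  qed
  obtain s2 s3 where Ks: "K4 p s s2 s3" "y \<sim> s2"
  proof -
    obtain s2 s3 where Ks: "K4 p s s2 s3" using K4_ex[OF pu(2)] .
    then show thesis
      using L4_K4_other[OF L4_perm(1)[OF L] K4_perm(1)[OF Ks] adj_sym[OF pu(1)]] that K4_perm(3)[OF Ks] by blast
  qed
  have sf: "swaps f p u k1 k2" using shift_swaps[OF f] K by (simp add: u_def)
  have sg: "swaps g p s s3 s2" using shift_swaps[OF g] K4_perm(3)[OF Ks(1)] by (simp add: s_def)
  note F = transport[OF sf Ks(1) us(2,3) L K(2) Ks(2)]
  note G = transport[OF sg K4_perm(3)[OF K(1)] us(4,5) L4_perm(1)[OF L] Ks(2) K(2)]
  have fs: "f s \<sim> u" "f s \<sim> s" using F(9,10) adj_sym by blast+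
  have wk: "f y' \<sim> k2" using L4_K4[OF F(1) K(1) fs(1) F(2)] .
  have ws: "f y' \<sim> s3" using L4_K4[OF F(1) Ks(1) fs(2) F(3)] .
  have yV: "y \<in> V" using L4_nadj[OF L] by (auto simp: nadj_def)
  have yf: "y \<sim> f y" using shift_adj[OF f yV] .
  have fsy: "\<not> f s \<sim> y" using L4_no_common(1)[OF L, of "f s"] fs by blast
  have Lc: "L4 p (f y) (f s) (f y')" using L4_perm(2)[OF F(1)] .
  have "\<not> p \<sim> y" using L4_no_common(1)[OF L, of p] pu by blast
  moreover have "p \<noteq> y" using L4_nadj(2)[OF L] pu(1) nadj_not_adj adj_sym by blast
  ultimately have yp: "y \<parallel> p" using p yV adj_sym by (auto simp: nadj_def)
  have off: "y \<notin> {f y, f s, f y'}"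
  proof -
    have "y \<noteq> f y" using yf adj_irrefl by metis
    moreover have "y \<noteq> f s" using fs(1) L4_nadj(2)[OF L] nadj_not_adj by blast
    moreover have "\<not> f y' \<sim> f y" using L4_nadj(6)[OF F(1)] nadj_not_adj by blast
    then have "y \<noteq> f y'" using yf by metis
    ultimately show ?thesis by blast
  qed
  have "p \<sim> s2" using Ks by (simp add: K4_def)
  then have "s2 \<in> N y \<inter> (N p \<inter> N (f y))" using Ks(2) F(3) by simp
  then have "int (card (N y \<inter> (N p \<inter> N (f y)))) > 0" by (metis card_gt_0_iff empty_iff finite_Int finite_N of_nat_0_less_iff)
  \<comment> \<open>As y is adjacent to \<open>f y\<close>, the count equals the number of
    adjacencies of y to \<open>f s\<close> and \<open>f y'\<close>; the vertex s2 makes it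
    positive.\<close>
  then have "f y' \<sim> y" using line_count[OF Lc yp off] adj_sym[OF yf] fsy by (auto simp: of_bool_def split: if_splits)
  then have e: "f y' = g y" using G(5)[of "f y'"] wk ws by blast
  have "L4 p (f y') (f s) (f y)" using L4_rot(2)[OF F(1)] .
  moreover have "L4 p (f y') (g u) (g y')" using L4_perm(2)[OF G(1)] e by simp
  ultimately have "g u = f s \<or> g u = f y" using L4_unique2 by blast
  moreover have "\<not> f y \<sim> s" using L4_no_common(1)[OF F(1), of s] adj_sym pu fs by blast
  moreover have "g u \<sim> s" using G(10) adj_sym by blast
  ultimately show ?thesis by (auto simp: u_def s_def)
qed

lemma shift_commute:
  assumes f: "shift f" and g: "shift g" and y: "y \<in> V"
  shows "f (g y) = g (f y)"
proof -
  note af = shift_aut[OF f] and ag = shift_aut[OF g]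
  have V: "f y \<in> V" "g y \<in> V" using aut_V af ag y by blast+
  consider "f y = g y" | "f y \<sim> g y" | "f y \<parallel> g y" using V by (auto simp: nadj_def)
  then show ?thesis
  proof cases
    case 1
    then show ?thesis using shift_invol f g y by metis
  next
    case 2
    have yf: "y \<sim> f y" "y \<sim> g y" using shift_adj f g y by blast+
    obtain k where K: "K4 y (f y) (g y) k"
    proof -
      obtain a b where "K4 y (f y) a b" using K4_ex[OF yf(1)] .
      moreover then have "g y = a \<or> g y = b" using K4_common yf(2) 2 adj_sym by blast
      ultimately show thesis using that K4_perm(3) by blast
    qed
    have "f (g y) = k" using shift_swaps[OF f K] by (simp add: swaps_def)
    moreover have "g (f y) = k" using shift_swaps[OF g K4_perm(2)[OF K]] by (simp add: swaps_def)
    ultimately show ?thesis by simp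
  next
    case 3
    then show ?thesis by (rule shift_exchange[OF f g _ y])
  qed
qed

text \<open>A homogeneous set is an orbit of the group generated by some of the commuting involutions \<open>shift\<close>:
  adding one more shift either preserves it or doubles it.\<close>

definition transl :: "('a \<Rightarrow> 'a) \<Rightarrow> bool" where
  "transl f \<longleftrightarrow> (\<forall>x\<in>V. f x \<in> V) \<and> (\<forall>g. shift g \<longrightarrow> (\<forall>x\<in>V. f (g x) = g (f x)))"

definition homogeneous :: "'a set \<Rightarrow> bool" where
  "homogeneous U \<longleftrightarrow> U \<subseteq> V \<and> U \<noteq> {} \<and> (\<exists>r. card U = 2 ^ r) \<and>
    (\<forall>y\<in>U. \<forall>z\<in>U. \<exists>f. transl f \<and> f y = z \<and> f ` U = U)"

lemma transl_comp: "transl f \<Longrightarrow> transl g \<Longrightarrow> transl (\<lambda>x. f (g x))"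
  by (simp add: transl_def)

lemma shift_transl: "shift f \<Longrightarrow> transl f"
  using shift_commute aut_V shift_aut by (auto simp: transl_def)

lemma homogeneous_double:
  assumes h: "homogeneous U" and g: "shift g" and y: "y \<in> U" "g y \<notin> U"
  shows "homogeneous (U \<union> g ` U) \<and> card (U \<union> g ` U) = 2 * card U"
proof -
  have U: "U \<subseteq> V" "U \<noteq> {}" and tr: "\<And>y z. y \<in> U \<Longrightarrow> z \<in> U \<Longrightarrow> \<exists>f. transl f \<and> f y = z \<and> f ` U = U"
    using h by (auto simp: homogeneous_def)
  obtain r where r: "card U = 2 ^ r" using h by (auto simp: homogeneous_def)
  have fin: "finite U" using U finite_V finite_subset by blast
  note ag = shift_aut[OF g]
  \<comment> \<open>If g kept a single x of U inside U, a map commuting with g, preserving U and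
    taking x to y would put g y into U.\<close>
  have disj: "U \<inter> g ` U = {}"
  proof (rule ccontr)
    assume "\<not> ?thesis"
    then obtain x where x: "x \<in> U" "g x \<in> U" by blast
    obtain f where f: "transl f" "f x = y" "f ` U = U" using tr[OF x(1) y(1)] by blast
    have "g y = f (g x)" using f(1,2) g x U by (auto simp: transl_def)
    then show False using f(3) x y by blast
  qed
  have "inj_on g U" using aut_inj[OF ag] U by (auto intro!: inj_onI)
  then have card: "card (U \<union> g ` U) = 2 * card U"
    using card_Un_disjoint[OF fin _ disj] fin by (simp add: card_image)
  have gg: "g ` (U \<union> g ` U) = U \<union> g ` U"
  proof -
    have "g (g x) = x" if "x \<in> U" for x using shift_invol[OF g] that U by blast
    then have "g ` g ` U = U" by (force simp: image_image)
    then show ?thesis by (auto simp: image_Un)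
  qed
  have hom: "\<exists>f. transl f \<and> f a = b \<and> f ` (U \<union> g ` U) = U \<union> g ` U" if ab: "a \<in> U \<union> g ` U" "b \<in> U \<union> g ` U" for a b
  proof -
    have inv: "\<exists>a0\<in>U. (a = a0 \<and> g a0 = g a) \<or> (a = g a0 \<and> g a = a0)" if "a \<in> U \<union> g ` U" for a
      using that shift_invol[OF g] U by blast
    obtain a0 where a0: "a0 \<in> U" "a = a0 \<or> a = g a0" using ab by blast
    obtain b0 where b0: "b0 \<in> U" "b = b0 \<or> b = g b0" using ab by blast
    obtain f where f: "transl f" "f a0 = b0" "f ` U = U" using tr[OF a0(1) b0(1)] by blast
    have fg: "f (g x) = g (f x)" if "x \<in> U" for x using f(1) g that U by (auto simp: transl_def)
    have "f ` g ` U = g ` f ` U" using fg by (auto simp: image_image cong: image_cong)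
    then have fU: "f ` (U \<union> g ` U) = U \<union> g ` U" using f(3) by (simp add: image_Un)
    have "f a = b \<or> g (f a) = b"
      using a0 b0 f(2) fg[OF a0(1)] shift_invol[OF g] U by auto
    then show ?thesis
    proof
      assume "f a = b"
      then show ?thesis using f(1) fU by blast
    next
      assume b: "g (f a) = b"
      have "transl (\<lambda>x. g (f x))" using transl_comp[OF shift_transl[OF g] f(1)] .
      moreover have "(\<lambda>x. g (f x)) ` (U \<union> g ` U) = U \<union> g ` U"
        using fU gg by (metis image_image)
      ultimately show ?thesis using b by (intro exI[of _ "\<lambda>x. g (f x)"]) blast
    qed
  qed
  have "U \<union> g ` U \<subseteq> V" using U aut_V[OF ag] by blast
  moreover have "U \<union> g ` U \<noteq> {}" using U by simp
  moreover have "\<exists>r. card (U \<union> g ` U) = 2 ^ r" using card r by (intro exI[of _ "Suc r"]) simp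
  moreover have "\<forall>a\<in>U \<union> g ` U. \<forall>b\<in>U \<union> g ` U. \<exists>f. transl f \<and> f a = b \<and> f ` (U \<union> g ` U) = U \<union> g ` U"
    by (intro ballI hom)
  ultimately show ?thesis using card unfolding homogeneous_def by simp
qed

text \<open>A homogeneous set of maximal size is closed under adjacency, since a shift along an edge
  leaving it would double it. As non-adjacent vertices have common neighbours, it is
  everything.\<close>

lemma card_V_power_2: "\<exists>r. card V = 2 ^ r"
proof -
  have "V \<noteq> {}"
  proof
    assume "V = {}"
    then have "(n\<^sup>2 + 3 * n - 2)\<^sup>2 = 0" using card_V by simp
    moreover have "n\<^sup>2 + 3 * n - 2 \<ge> 0 + 3 * 3 - 2" using n_ge_3 by (intro diff_mono add_mono) auto
    ultimately show False by simp
  qed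
  then obtain p where p: "p \<in> V" by blast
  have "homogeneous {p}"
  proof -
    have "transl (\<lambda>x. x)" by (simp add: transl_def)
    moreover have "card {p} = 2 ^ 0" by simp
    ultimately show ?thesis using p unfolding homogeneous_def by (intro conjI) (auto intro: exI[of _ 0])
  qed
  moreover have "finite {card U |U. homogeneous U}"
  proof (rule finite_subset[of _ "{..card V}"])
    show "{card U |U. homogeneous U} \<subseteq> {..card V}"
      using card_mono[OF finite_V] by (auto simp: homogeneous_def)
  qed simp
  ultimately obtain U where U: "homogeneous U" and mx: "\<And>U'. homogeneous U' \<Longrightarrow> card U' \<le> card U"
    using Max_in[of "{card U |U. homogeneous U}"] Max_ge[of "{card U |U. homogeneous U}"]
    by (smt (verit, ccfv_threshold) empty_Collect_eq mem_Collect_eq)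
  have sub: "U \<subseteq> V" and ne: "U \<noteq> {}" and r: "\<exists>r. card U = 2 ^ r" using U by (auto simp: homogeneous_def)
  have "finite U" using sub finite_V finite_subset by blast
  then have pos: "card U > 0" using ne by (simp add: card_gt_0_iff)
  have step: "z \<in> U" if yz: "y \<in> U" "y \<sim> z" for y z
  proof (rule ccontr)
    assume "z \<notin> U"
    obtain g where g: "shift g" "g y = z" using shift_ex[OF yz(2)] .
    then show False using homogeneous_double[OF U g(1) yz(1)] \<open>z \<notin> U\<close> mx pos by fastforce
  qed
  have "V \<subseteq> U"
  proof
    fix z assume z: "z \<in> V"
    obtain y where y: "y \<in> U" using ne by blast
    then have "y \<in> V" using sub by blast
    then consider "z = y" | "y \<sim> z" | "y \<parallel> z" using z by (auto simp: nadj_def)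
    then show "z \<in> U"
    proof cases
      case 3
      then obtain x where "y \<sim> x" "z \<sim> x" using common_ex[OF 3, of "{}"] by auto
      then show ?thesis using step y adj_sym by blast
    qed (use y step in auto)
  qed
  then have "U = V" using sub by blast
  then show ?thesis using r by blast
qed

end

section \<open>The equation \<open>n\<^sup>2 + 3 n - 2 = 2\<^sup>e\<close>\<close>

text \<open>Since \<open>x mod 0 = x\<close>, the map \<open>pell 0\<close> multiplies \<open>x + y \<surd>2\<close> by the unit \<open>3 + 2 \<surd>2\<close> of norm 1.\<close>

definition pell :: "int \<Rightarrow> int \<times> int \<Rightarrow> int \<times> int" where
  "pell m p = ((3 * fst p + 4 * snd p) mod m, (2 * fst p + 3 * snd p) mod m)"

lemma pell_Pair: "pell m (a, b) = ((3 * a + 4 * b) mod m, (2 * a + 3 * b) mod m)"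
  by (simp add: pell_def)

lemma pell_mod:
  "(fst ((pell 0 ^^ i) p) mod m, snd ((pell 0 ^^ i) p) mod m) = (pell m ^^ i) (fst p mod m, snd p mod m)"
proof (induction i)
  case (Suc i)
  define q where "q = (pell 0 ^^ i) p"
  have "(pell m ^^ Suc i) (fst p mod m, snd p mod m) = pell m (fst q mod m, snd q mod m)"
    using Suc by (simp add: q_def)
  also have "\<dots> = (fst (pell 0 q) mod m, snd (pell 0 q) mod m)"
    by (simp add: pell_def, intro conjI mod_add_cong) (simp_all add: mod_mult_right_eq)
  finally show ?case by (simp add: q_def)
qed simp

text \<open>Descent by the inverse unit: for y > 8 the step to (3 x - 4 y, 3 y - 2 x) stays in the
  region and lowers y. Below, only (5, 2), (5, -2) and (7, 4) remain, and (7, 4) is the image of (5,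
  -2).\<close>

lemma pell_orbit_ex:
  fixes x y :: int
  assumes "x > 0" "y \<ge> -2" "x\<^sup>2 - 2 * y\<^sup>2 = 17"
  shows "\<exists>i. (x, y) = (pell 0 ^^ i) (5, 2) \<or> (x, y) = (pell 0 ^^ i) (5, -2)"
  using assms
proof (induction "nat (y + 2)" arbitrary: x y rule: less_induct)
  case less
  show ?case
  proof (cases "y \<le> 8")
    case True
    have "x < 13"
    proof (rule ccontr)
      assume "\<not> x < 13"
      then have "13\<^sup>2 \<le> x\<^sup>2" by (intro power_mono) auto
      moreover have "\<bar>y\<bar> \<le> 8" using True less.prems by auto
      then have "\<bar>y\<bar>\<^sup>2 \<le> 8\<^sup>2" by (intro power_mono) auto
      ultimately show False using less.prems(3) by simp
    qed
    then have x: "x \<in> {1, 2, 3, 4, 5, 6, 7, 8, 9, 10, 11, 12}" using less.prems(1) by simp presburger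
    have "y = -2 \<or> y = -1 \<or> y = 0 \<or> y = 1 \<or> y = 2 \<or> y = 3 \<or> y = 4 \<or> y = 5 \<or> y = 6 \<or> y = 7 \<or> y = 8"
      using True less.prems(2) by presburger
    then have "(x, y) = (5, 2) \<or> (x, y) = (5, -2) \<or> (x, y) = (7, 4)"
      using x less.prems(3) by (elim disjE insertE emptyE) simp_all
    moreover have "(5, 2) = (pell 0 ^^ 0) (5, 2)" "(5, -2) = (pell 0 ^^ 0) (5, -2)" "(7, 4) = (pell 0 ^^ 1) (5, -2)"
      by (simp_all add: pell_def)
    ultimately show ?thesis by metis
  next
    case False
    define x' where "x' = 3 * x - 4 * y"
    define y' where "y' = 3 * y - 2 * x"
    have y9: "y \<ge> 9" using False by simp
    have "9\<^sup>2 \<le> y\<^sup>2" using y9 by (intro power_mono) auto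
    have "(4 * y)\<^sup>2 < (3 * x)\<^sup>2" using less.prems(3)
      by (simp add: power_mult_distrib) (use zero_le_power2[of y] in linarith)
    then have "4 * y < 3 * x" by (rule power2_less_imp_less) (use less.prems(1) in simp)
    moreover have "(2 * x)\<^sup>2 \<le> (3 * y)\<^sup>2" using less.prems(3) \<open>9\<^sup>2 \<le> y\<^sup>2\<close> unfolding power_mult_distrib by simp
    then have "2 * x \<le> 3 * y" by (rule power2_le_imp_le) (use y9 in simp)
    moreover have "y\<^sup>2 < x\<^sup>2" using less.prems(3) zero_le_power2[of y] by linarith
    then have "y < x" by (rule power2_less_imp_less) (use less.prems(1) in simp)
    ultimately have "x' > 0" "y' \<ge> -2" "nat (y' + 2) < nat (y + 2)"
      using y9 by (auto simp: x'_def y'_def)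
    moreover have "x'\<^sup>2 - 2 * y'\<^sup>2 = 17"
      using less.prems(3) by (simp add: x'_def y'_def power2_eq_square algebra_simps)
    ultimately obtain i where "(x', y') = (pell 0 ^^ i) (5, 2) \<or> (x', y') = (pell 0 ^^ i) (5, -2)"
      using less.hyps[of y' x'] by blast
    moreover have "(x, y) = pell 0 (x', y')" by (simp add: x'_def y'_def pell_def)
    ultimately have "(x, y) = (pell 0 ^^ Suc i) (5, 2) \<or> (x, y) = (pell 0 ^^ Suc i) (5, -2)" by auto
    then show ?thesis by blast
  qed
qed

text \<open>Applying f to the argument first lets the simplifier reduce to a concrete pair after
  every step.\<close>

lemma funpow_numeral: "(f ^^ numeral k) x = (f ^^ pred_numeral k) (f x)"
  by (simp add: numeral_eq_Suc funpow_swap1)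

text \<open>The entries 30 and 255 are -2 modulo 32 and 257.\<close>

lemma pell_periods:
  "(pell 32 ^^ 16) (5, 2) = (5, 2)" "(pell 32 ^^ 16) (5, 30) = (5, 30)"
  "(pell 257 ^^ 64) (5, 2) = (5, 2)" "(pell 257 ^^ 64) (5, 255) = (5, 255)"
  by (simp_all add: funpow_numeral pell_Pair)

lemma less_16: "(i::nat) < 16 \<Longrightarrow> i \<in> {0, 1, 2, 3, 4, 5, 6, 7, 8, 9, 10, 11, 12, 13, 14, 15}"
  by simp presburger

lemma pell_zeros_32:
  "i < 16 \<Longrightarrow> snd ((pell 32 ^^ i) (5, 2)) = 0 \<Longrightarrow> i = 9"
  "i < 16 \<Longrightarrow> snd ((pell 32 ^^ i) (5, 30)) = 0 \<Longrightarrow> i = 7"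
  by (drule less_16, elim insertE emptyE; simp add: funpow_numeral pell_Pair)+

lemma pell_values_257:
  "(pell 257 ^^ 9) (5, 2) = (80, 218)"
  "(pell 257 ^^ 25) (5, 2) = (175, 150)"
  "(pell 257 ^^ 41) (5, 2) = (177, 39)"
  "(pell 257 ^^ 57) (5, 2) = (82, 107)"
  "(pell 257 ^^ 7) (5, 255) = (82, 150)"
  "(pell 257 ^^ 23) (5, 255) = (177, 218)"
  "(pell 257 ^^ 39) (5, 255) = (175, 107)"
  "(pell 257 ^^ 55) (5, 255) = (80, 39)"
  by (simp_all add: funpow_numeral pell_Pair)

text \<open>Divisibility of \<open>y\<close> by 32 fixes the index in the orbit modulo 16, hence \<open>y\<close> modulo 257 up to four
  values. None of them has 16th power 1, unlike the powers of 2, because \<open>2\<^sup>1\<^sup>6 = 1\<close> modulo 257.\<close>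

lemma no_large_solution:
  fixes x :: int
  assumes "x > 0" "5 \<le> j" "x\<^sup>2 - 2 * (2 ^ j)\<^sup>2 = 17"
  shows False
proof -
  define y :: int where "y = 2 ^ j"
  have "y mod 32 = 0"
    using le_imp_power_dvd[OF assms(2), of "2::int"] by (simp add: y_def dvd_imp_mod_0)
  have "y ^ 16 = (2 ^ 16) ^ j" unfolding y_def by (metis power_mult mult.commute)
  then have "y ^ 16 mod 257 = (2 ^ 16 mod 257) ^ j mod 257" by (simp only: power_mod)
  then have y257: "(y mod 257) ^ 16 mod 257 = 1" by (simp add: power_mod)
  obtain i where i: "(x, y) = (pell 0 ^^ i) (5, 2) \<or> (x, y) = (pell 0 ^^ i) (5, -2)"
    using pell_orbit_ex[of x y] assms order_trans[of "-2" 0 y] by (auto simp: y_def)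
  obtain q where r: "i mod 64 = 16 * q + i mod 16" "q = 0 \<or> q = 1 \<or> q = 2 \<or> q = 3"
  proof
    show "i mod 64 = 16 * (i div 16 mod 4) + i mod 16" using mod_mult2_eq[of i 16 4] by simp
    have "q < 4 \<Longrightarrow> q = 0 \<or> q = 1 \<or> q = 2 \<or> q = 3" for q :: nat by presburger
    then show "i div 16 mod 4 = 0 \<or> i div 16 mod 4 = 1 \<or> i div 16 mod 4 = 2 \<or> i div 16 mod 4 = 3" by simp
  qed
  from i show False
  proof
    assume e: "(x, y) = (pell 0 ^^ i) (5, 2)"
    have "y mod m = snd ((pell m ^^ i) (5 mod m, 2 mod m))" for m
      using pell_mod[of i "(5, 2)" m] e by (metis fst_conv snd_conv)
    from this[of 32] this[of 257] have y: "y mod 32 = snd ((pell 32 ^^ (i mod 16)) (5, 2))"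
      "y mod 257 = snd ((pell 257 ^^ (i mod 64)) (5, 2))"
      using funpow_mod_eq[OF pell_periods(1), of i] funpow_mod_eq[OF pell_periods(3), of i] by simp_all
    have "i mod 16 = 9" using pell_zeros_32(1)[of "i mod 16"] y(1) \<open>y mod 32 = 0\<close> by simp
    then have "i mod 64 \<in> {9, 25, 41, 57}" using r by auto
    then show False using y(2) y257 by (auto simp: pell_values_257)
  next
    assume e: "(x, y) = (pell 0 ^^ i) (5, -2)"
    have "y mod m = snd ((pell m ^^ i) (5 mod m, (-2) mod m))" for m
      using pell_mod[of i "(5, -2)" m] e by (metis fst_conv snd_conv)
    from this[of 32] this[of 257] have y: "y mod 32 = snd ((pell 32 ^^ (i mod 16)) (5, 30))"
      "y mod 257 = snd ((pell 257 ^^ (i mod 64)) (5, 255))"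
      using funpow_mod_eq[OF pell_periods(2), of i] funpow_mod_eq[OF pell_periods(4), of i] by simp_all
    have "i mod 16 = 7" using pell_zeros_32(2)[of "i mod 16"] y(1) \<open>y mod 32 = 0\<close> by simp
    then have "i mod 64 \<in> {7, 23, 39, 55}" using r by auto
    then show False using y(2) y257 by (auto simp: pell_values_257)
  qed
qed

lemma power_of_2_values:
  fixes n :: int
  assumes n: "3 \<le> n" and r: "(n\<^sup>2 + 3 * n - 2)\<^sup>2 = 2 ^ r"
  shows "n = 3 \<or> n = 10"
proof -
  define m where "m = nat (n\<^sup>2 + 3 * n - 2)"
  have "n\<^sup>2 + 3 * n - 2 \<ge> 0 + 3 * 3 - 2" using n by (intro diff_mono add_mono) auto
  then have m: "int m = n\<^sup>2 + 3 * n - 2" by (simp add: m_def)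
  then have "int (m\<^sup>2) = int (2 ^ r)" using r by simp
  then have "m\<^sup>2 = 2 ^ r" by (simp only: of_nat_eq_iff)
  then have "m dvd 2 ^ r" by (metis dvd_triv_left power2_eq_square)
  then obtain e where e: "m = 2 ^ e" using divides_primepow_nat[of 2 m r] by auto
  define x where "x = 2 * n + 3"
  have x9: "x \<ge> 9" using n by (simp add: x_def)
  have "x\<^sup>2 = 4 * int m + 17" unfolding m by (simp add: x_def power2_eq_square algebra_simps)
  then have x2: "x\<^sup>2 = 4 * 2 ^ e + 17" by (simp add: e)
  show ?thesis
  proof (cases "even e")
    case True
    then obtain j where j: "e = 2 * j" by blast
    define a where "a = x - 2 * 2 ^ j"
    define b where "b = x + 2 * 2 ^ j"
    have ab: "a * b = 17" using x2 by (simp add: a_def b_def j power_mult power2_eq_square algebra_simps flip: power_mult_distrib)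
    have b: "b > 0" using x9 unfolding b_def by (intro add_pos_pos) auto
    have a: "a > 0" using ab b by (metis zero_less_mult_pos2 zero_less_numeral)
    have "a < b" by (simp add: a_def b_def)
    have "a < 5"
    proof (rule ccontr)
      assume "\<not> a < 5"
      then have "5 * 5 \<le> a * b" using \<open>a < b\<close> by (intro mult_mono) auto
      then show False using ab by simp
    qed
    then have "a \<in> {1, 2, 3, 4}" using a by auto
    then have "a = 1" "b = 17" using ab by (auto; presburger)+
    then have "x = 9" by (simp add: a_def b_def)
    then show ?thesis by (simp add: x_def)
  next
    case False
    then obtain j where j: "e = 2 * j + 1" by (elim oddE)
    have "2 * (2 ^ (j + 1))\<^sup>2 = (4::int) * 2 ^ e"
      unfolding j by (simp add: power_even_eq power_mult_distrib)
    then have eq: "x\<^sup>2 - 2 * (2 ^ (j + 1))\<^sup>2 = 17" using x2 by simp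
    have "j + 1 < 5"
    proof (rule ccontr)
      assume "\<not> j + 1 < 5"
      then show False using no_large_solution[of x "j + 1"] eq x9 by simp
    qed
    then have "j \<in> {0, 1, 2, 3}" by auto
    then have "x\<^sup>2 \<in> {25, 49, 145, 529}" using eq by auto
    moreover have "x\<^sup>2 \<ge> 9\<^sup>2" using x9 by (intro power_mono) auto
    moreover have "x\<^sup>2 \<noteq> 145"
    proof
      assume "x\<^sup>2 = 145"
      then have "12\<^sup>2 < x\<^sup>2" "x\<^sup>2 < 13\<^sup>2" by simp_all
      then have "12 < x" "x < 13" using x9 power2_less_imp_less[of 12 x] power2_less_imp_less[of x 13] by auto
      then show False by simp
    qed
    ultimately have "x\<^sup>2 = 23\<^sup>2" by auto
    then have "x = 23" by (rule power2_eq_imp_eq) (use x9 in simp_all)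
    then show ?thesis by (simp add: x_def)
  qed
qed

section \<open>Strongly regular pair graphs\<close>

lemma pverts_diamond: "pverts diamond = {0, 1, 2, 3}"
  by (simp add: diamond_def)

lemma parcs_diamond:
  "parcs diamond = {(2, 3), (3, 2), (2, 0), (0, 2), (3, 0), (0, 3), (2, 1), (1, 2), (3, 1), (1, 3)}"
  by (auto simp: diamond_def)

lemma diamond_free_arc:
  assumes G: "pair_graph G" and free: "diamond_free G"
    and arcs: "(x, y) \<in> parcs G" "(x, z) \<in> parcs G" "(y, z) \<in> parcs G" "(x, w) \<in> parcs G" "(y, w) \<in> parcs G"
    and zw: "z \<noteq> w"
  shows "(z, w) \<in> parcs G"
proof (rule ccontr)
  assume no: "(z, w) \<notin> parcs G"
  interpret pair_graph G by (rule G)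
  have sym: "(b, a) \<in> parcs G" if "(a, b) \<in> parcs G" for a b
    using pair_sym_arcs that by (simp add: symmetric_def sym_def)
  have irr: "(a, a) \<notin> parcs G" for a
    using pair_no_loops[of "(a, a)"] by auto
  have d: "x \<noteq> y" "x \<noteq> z" "y \<noteq> z" "x \<noteq> w" "y \<noteq> w" "z \<noteq> w"
    using arcs zw irr by auto
  have wz: "(w, z) \<notin> parcs G" using no sym by blast
  define H where "H = with_proj G \<restriction> {z, w, x, y}"
  \<comment> \<open>The non-adjacent pair z, w goes to 0, 1, the pair missing in
    \<open>diamond\<close>.\<close>
  define f :: "'a \<Rightarrow> nat" where "f a = (if a = z then 0 else if a = w then 1 else if a = x then 2 else 3)" for a
  have f: "f z = 0" "f w = 1" "f x = 2" "f y = 3" using d by (auto simp: f_def)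
  define h where "h = \<lparr>iso_verts = f, iso_arcs = map_prod f f, iso_head = snd, iso_tail = fst\<rparr>"
  have V: "{z, w, x, y} \<subseteq> pverts G"
    using arcs in_arcsD1 in_arcsD2 by auto
  then have H: "induced_subgraph H (with_proj G)"
    unfolding H_def by (rule induced_induce)
  have vH: "verts H = {z, w, x, y}" by (simp add: H_def induce_subgraph_def)
  have aH: "arcs H = {(x, y), (y, x), (x, z), (z, x), (y, z), (z, y), (x, w), (w, x), (y, w), (w, y)}" (is "_ = ?A")
  proof
    have "(a, b) \<in> ?A" if "(a, b) \<in> parcs G" "a \<in> {z, w, x, y}" "b \<in> {z, w, x, y}" for a b
      using that(2,3,1) irr[of x] irr[of y] irr[of z] irr[of w] no wz
      by (elim insertE emptyE) simp_all
    then show "arcs H \<subseteq> ?A" unfolding H_def induce_subgraph_def by (intro subrelI) simp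
    show "?A \<subseteq> arcs H" using arcs arcs[THEN sym] by (simp add: H_def induce_subgraph_def)
  qed
  have tH: "tail H = fst" "head H = snd" by (simp_all add: H_def induce_subgraph_def)
  have inj: "inj_on f {z, w, x, y}" using d by (auto simp: inj_on_def f_def)
  have "wf_digraph H"
    by (unfold_locales) (auto simp: vH aH tH)
  moreover have "inj_on (map_prod f f) (arcs H)"
    by (rule inj_on_subset[OF map_prod_inj_on[OF inj inj]]) (auto simp: aH)
  ultimately have "pre_digraph.digraph_isomorphism H h"
    using inj by (simp add: pre_digraph.digraph_isomorphism_def h_def vH tH)
  moreover have "with_proj diamond = app_iso h H"
    by (rule pre_digraph.equality) (simp_all add: h_def vH aH tH f pverts_diamond parcs_diamond)
  ultimately have "digraph_iso H (with_proj diamond)" by (auto simp: digraph_iso_def)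
  then show False using free H by (auto simp: diamond_free_def)
qed

lemma strongly_regular_arcs:
  assumes "strongly_regular G \<nu> k l m"
  shows "finite (pverts G)" "int (card (pverts G)) = \<nu>"
    and "(u, v) \<in> parcs G \<Longrightarrow> (v, u) \<in> parcs G" "(u, u) \<notin> parcs G"
    and "(u, v) \<in> parcs G \<Longrightarrow> u \<in> pverts G \<and> v \<in> pverts G"
    and "u \<in> pverts G \<Longrightarrow> int (card {w. (u, w) \<in> parcs G}) = k"
    and "(u, v) \<in> parcs G \<Longrightarrow> int (card {w. (u, w) \<in> parcs G \<and> (v, w) \<in> parcs G}) = l"
    and "u \<in> pverts G \<Longrightarrow> v \<in> pverts G \<Longrightarrow> u \<noteq> v \<Longrightarrow> (u, v) \<notin> parcs G \<Longrightarrow>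
      int (card {w. (u, w) \<in> parcs G \<and> (v, w) \<in> parcs G}) = m"
proof -
  interpret pair_graph G using assms by (simp add: strongly_regular_def)
  show fin: "finite (pverts G)" by (rule pair_finite_verts)
  show card: "int (card (pverts G)) = \<nu>" using assms by (simp add: strongly_regular_def)
  show "(v, u) \<in> parcs G" if "(u, v) \<in> parcs G"
    using pair_sym_arcs that by (simp add: symmetric_def sym_def)
  show "(u, u) \<notin> parcs G" using pair_no_loops[of "(u, u)"] by auto
  show V: "(u, v) \<in> parcs G \<Longrightarrow> u \<in> pverts G \<and> v \<in> pverts G" for u v using in_arcsD1 in_arcsD2 by blast
  have cn: "common_neighbors G u v = {w. (u, w) \<in> parcs G \<and> (v, w) \<in> parcs G}" for u v
    using V by (auto simp: common_neighbors_def)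
  show "int (card {w. (u, w) \<in> parcs G}) = k" if "u \<in> pverts G"
  proof -
    have "out_arcs (with_proj G) u = Pair u ` {w. (u, w) \<in> parcs G}"
      by (auto simp: out_arcs_def)
    then have "out_degree (with_proj G) u = card {w. (u, w) \<in> parcs G}"
      by (simp add: out_degree_def card_image inj_on_def)
    moreover have "int (out_degree (with_proj G) u) = k" using assms that by (simp add: strongly_regular_def)
    ultimately show ?thesis by simp
  qed
  show "int (card {w. (u, w) \<in> parcs G \<and> (v, w) \<in> parcs G}) = l" if "(u, v) \<in> parcs G"
    using assms that V by (auto simp: strongly_regular_def cn)
  show "int (card {w. (u, w) \<in> parcs G \<and> (v, w) \<in> parcs G}) = m"
    if "u \<in> pverts G" "v \<in> pverts G" "u \<noteq> v" "(u, v) \<notin> parcs G"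
    using assms that by (auto simp: strongly_regular_def cn)
qed

lemma strongly_regular_degree_less:
  assumes sr: "strongly_regular G \<nu> k l m"
  shows "k \<noteq> \<nu> - 1"
proof
  note A = strongly_regular_arcs[OF sr]
  assume k: "k = \<nu> - 1"
  have "{w. (u, w) \<in> parcs G} = pverts G - {u}" if u: "u \<in> pverts G" for u
  proof (rule card_subset_eq)
    show "finite (pverts G - {u})" using A(1) by simp
    show "{w. (u, w) \<in> parcs G} \<subseteq> pverts G - {u}" using A(4) A(5) by blast
    have "card (pverts G) > 0" using u A(1) card_gt_0_iff by blast
    then show "card {w. (u, w) \<in> parcs G} = card (pverts G - {u})"
      using A(6)[OF u] A(2) k u A(1) by (simp add: card_Diff_singleton)
  qed
  then have "parcs G = {(u, v). (u, v) \<in> pverts G \<times> pverts G \<and> u \<noteq> v}"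
    using A(4) A(5) by blast
  then have "complete_digraph (card (pverts G)) (with_proj G)"
    using A(1) by (simp add: complete_digraph_pair_def)
  then show False using sr by (simp add: strongly_regular_def)
qed

text \<open>If \<open>m = 0\<close> then adjacency is transitive on distinct vertices, so a connected graph is complete.\<close>

lemma strongly_regular_mu_pos:
  assumes sr: "strongly_regular G \<nu> k l m" and conn: "Digraph_Component.connected (with_proj G)"
  shows "m \<noteq> 0"
proof
  assume m: "m = 0"
  note A = strongly_regular_arcs[OF sr]
  interpret pair_graph G using sr by (simp add: strongly_regular_def)
  have trans: "u = w \<or> (u, w) \<in> parcs G" if "(u, v) \<in> parcs G" "(v, w) \<in> parcs G" for u v w
  proof (rule ccontr)
    assume no: "\<not> (u = w \<or> (u, w) \<in> parcs G)"
    have "finite {x. (u, x) \<in> parcs G \<and> (w, x) \<in> parcs G}"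
      by (rule finite_subset[OF _ A(1)]) (use A(5) in blast)
    moreover have "card {x. (u, x) \<in> parcs G \<and> (w, x) \<in> parcs G} = 0"
      using A(8)[of u w] A(5)[OF that(1)] A(5)[OF that(2)] no m by simp
    ultimately show False using that(1) A(3)[OF that(2)] by auto
  qed
  have mk: "parcs (mk_symmetric (with_proj G)) = parcs G"
    using adj_mk_symmetric_eq pair_sym_arcs by simp
  have "u = v \<or> (u, v) \<in> parcs G" if uv: "u \<in> pverts G" "v \<in> pverts G" for u v
  proof -
    have "(u, v) \<in> rtrancl_on (pverts G) (parcs G)"
      using conn uv mk by (auto simp: connected_def strongly_connected_def reachable_def)
    then show ?thesis
      by (induction rule: rtrancl_on_induct) (use trans in blast)+
  qed
  then have "parcs G = {(u, v). (u, v) \<in> pverts G \<times> pverts G \<and> u \<noteq> v}"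
    using A(4) A(5) by blast
  then have "complete_digraph (card (pverts G)) (with_proj G)"
    using A(1) by (simp add: complete_digraph_pair_def)
  then show False using sr by (simp add: strongly_regular_def)
qed

text \<open>For n \<le> -4 the degree is not positive. The values n = -3 and n = 1 give 4 vertices
  of degree 3, a complete graph, and n = -1 and n = 0 give \<mu> = 0, against connectedness.\<close>

lemma small_parameters:
  fixes n :: int
  assumes sr: "strongly_regular G ((n\<^sup>2 + 3 * n - 2)\<^sup>2) (n * (n\<^sup>2 + 3 * n - 1)) 2 (n * (n + 1))"
    and conn: "Digraph_Component.connected (with_proj G)" and "n < 3"
  shows "n \<in> {-2, 2}"
proof -
  note A = strongly_regular_arcs[OF sr]
  have "parcs G \<noteq> {}" using sr by (simp add: strongly_regular_def)
  then obtain u v where uv: "(u, v) \<in> parcs G" by auto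
  then have u: "u \<in> pverts G" using A(5) by blast
  have "finite {w. (u, w) \<in> parcs G}" by (rule finite_subset[OF _ A(1)]) (use A(5) in blast)
  then have "card {w. (u, w) \<in> parcs G} > 0" using uv card_gt_0_iff by blast
  then have k: "n * (n\<^sup>2 + 3 * n - 1) > 0" using A(6)[OF u] by simp
  have "n > -4"
  proof (rule ccontr)
    assume n: "\<not> n > -4"
    then have "n * (n + 3) \<ge> 0" by (intro mult_nonpos_nonpos) auto
    then have "n\<^sup>2 + 3 * n \<ge> 0" by (simp add: power2_eq_square algebra_simps)
    moreover have "n\<^sup>2 + 3 * n \<noteq> 0"
    proof
      assume "n\<^sup>2 + 3 * n = 0"
      then have "n * (n + 3) = 0" by (simp add: power2_eq_square algebra_simps)
      then show False using n by auto
    qed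
    ultimately have "n * (n\<^sup>2 + 3 * n - 1) \<le> 0" using n by (intro mult_nonpos_nonneg) auto
    then show False using k by simp
  qed
  then have "n = -3 \<or> n = -2 \<or> n = -1 \<or> n = 0 \<or> n = 1 \<or> n = 2" using \<open>n < 3\<close> by presburger
  moreover have "n \<noteq> -3" "n \<noteq> 1" using strongly_regular_degree_less[OF sr] by auto
  moreover have "n \<noteq> -1" "n \<noteq> 0" using strongly_regular_mu_pos[OF sr conn] by auto
  ultimately show ?thesis by auto
qed

theorem theorem1:
  fixes n :: int and G :: "'a pair_pre_digraph"
  assumes "strongly_regular G ((n\<^sup>2 + 3 * n - 2)\<^sup>2) (n * (n\<^sup>2 + 3 * n - 1)) 2 (n * (n + 1))"
    and "Digraph_Component.connected (with_proj G)"
    and "Digraph_Component.connected (with_proj (graph_complement G))"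
    and "diamond_free G"
    and "\<And>u v. u \<in> pverts G \<Longrightarrow> v \<in> pverts G \<Longrightarrow> u \<noteq> v \<Longrightarrow> (u, v) \<notin> parcs G \<Longrightarrow>
      \<exists>w \<in> pverts G. w \<noteq> u \<and> w \<noteq> v \<and> (w, u) \<notin> parcs G \<and> (w, v) \<notin> parcs G \<and>
        (\<forall>x \<in> common_neighbors G u v. (w, x) \<notin> parcs G)"
  shows "n \<in> {-2, 2, 3, 10}"
proof (cases "n < 3")
  case True
  then show ?thesis using small_parameters[OF assms(1,2)] by auto
next
  case False
  note A = strongly_regular_arcs[OF assms(1)]
  have G: "pair_graph G" using assms(1) by (simp add: strongly_regular_def)
  interpret diamond_free_srg "pverts G" "\<lambda>u v. (u, v) \<in> parcs G" n
  proof
    show "\<exists>w\<in>pverts G. w \<noteq> x \<and> w \<noteq> y \<and> (w, x) \<notin> parcs G \<and> (w, y) \<notin> parcs G \<and>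
        (\<forall>z. (x, z) \<in> parcs G \<and> (y, z) \<in> parcs G \<longrightarrow> (w, z) \<notin> parcs G)"
      if "x \<in> pverts G" "y \<in> pverts G" "x \<noteq> y" "(x, y) \<notin> parcs G" for x y
      using assms(5)[OF that] A(5) by (fastforce simp: common_neighbors_def)
    show "(z, w) \<in> parcs G"
      if "(x, y) \<in> parcs G" "(x, z) \<in> parcs G" "(y, z) \<in> parcs G" "(x, w) \<in> parcs G" "(y, w) \<in> parcs G" "z \<noteq> w"
      for x y z w
      using diamond_free_arc[OF G assms(4)] that by blast
    show "card {z. (x, z) \<in> parcs G \<and> (y, z) \<in> parcs G} = 2" if "(x, y) \<in> parcs G" for x y
      using A(7)[OF that] by simp
  qed (use A False in auto)
  obtain r where "card (pverts G) = 2 ^ r" using card_V_power_2 by blast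
  then have "(n\<^sup>2 + 3 * n - 2)\<^sup>2 = 2 ^ r" using A(2) by (metis of_nat_numeral of_nat_power)
  then show ?thesis using power_of_2_values[of n r] False by auto
qed

end
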